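(* Let $R$ be a $k$-algebra, let $(\mathcal{C},R)$ be a coring with coproduct $\Delta$ and counit $\epsilon$, and let $R^{\mathrm{e}}=R\otimes_k R^{\mathrm{op}}$. Let $C^0=\mathcal{C}\otimes_{R^{\mathrm{e}}}R$ and $C^n=\mathcal{C}\otimes_{R^{\mathrm{e}}}\mathcal{C}^{\otimes_R n}$ for $n\ge1$. Then the following maps are well-defined and make $\{C^n\}_{n\ge0}$ a cocyclic $k$-module: Cofaces $\delta_i:C^n\to C^{n+1}$, $0\le i\le n+1$: for $n\ge1$, $$\delta_i(c_0\otimes_{R^{\mathrm{e}}}c_1\otimes_R\cdots\otimes_R c_n)=c_0\otimes_{R^{\mathrm{e}}}c_1\otimes_R\cdots\otimes_R\Delta(c_i)\otimes_R\cdots\otimes_R c_n\quad(0\le i\le n)$$ (for $i=0$ this means $c_0^{(1)}\otimes_{R^{\mathrm{e}}}c_0^{(2)}\otimes_R c_1\otimes_R\cdots\otimes_R c_n$), and $$\delta_{n+1}(c_0\otimes_{R^{\mathrm{e}}}c_1\otimes_R\cdots\otimes_R c_n)=c_0^{(2)}\otimes_{R^{\mathrm{e}}}c_1\otimes_R\cdots\otimes_R c_n\otimes_R c_0^{(1)};$$ for $n=0$, $\delta_0(c\otimes_{R^{\mathrm{e}}}r)=c^{(1)}\otimes_{R^{\mathrm{e}}}c^{(2)}r$ and $\delta_1(c\otimes_{R^{\mathrm{e}}}r)=c^{(2)}\otimes_{R^{\mathrm{e}}}rc^{(1)}$. Codegeneracies $\sigma_j:C^n\to C^{n-1}$, $0\le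 j\le n-1$: $$\sigma_j(c_0\otimes_{R^{\mathrm{e}}}c_1\otimes_R\cdots\otimes_R c_n)=c_0\otimes_{R^{\mathrm{e}}}c_1\otimes_R\cdots\otimes_R\epsilon(c_{j+1})\otimes_R\cdots\otimes_R c_n.$$ Cyclic operators $\tau:C^n\to C^n$: $$\tau(c_0\otimes_{R^{\mathrm{e}}}c_1\otimes_R\cdots\otimes_R c_n)=c_1\otimes_{R^{\mathrm{e}}}c_2\otimes_R\cdots\otimes_R c_n\otimes_R c_0\quad(n\ge1),\qquad\tau=\mathrm{id}\text{ on }C^0.$$
   Context: $k$ is the ground field; algebras are associative and unital over $k$, not necessarily commutative. A coring over $R$ is an $(R,R)$-bimodule $\mathcal{C}$ with $(R,R)$-bimodule maps $\Delta:\mathcal{C}\to\mathcal{C}\otimes_R\mathcal{C}$, $\epsilon:\mathcal{C}\to R$ that are coassociative and counital; Sweedler notation $\Delta(c)=c^{(1)}\otimes_R c^{(2)}$ (summation understood). Module structures used: $\mathcal{C}$ is a right $R^{\mathrm{e}}$-module by $c\cdot(r\otimes s)=s\,c\,r$; for $n\ge1$, $\mathcal{C}^{\otimes_R n}$ is a left $R^{\mathrm{e}}$-module by $(r\otimes s)\cdot(c_1\otimes_R\cdots\otimes_R c_n)=rc_1\otimes_R\cdots\otimes_R c_n s$; and $R$ is a left $R^{\mathrm{e}}$-module by $(r\otimes s)\cdot t=rts$. A cocyclic $k$-module is a cosimplicial $k$-module $(C^n,\delta_i,\sigma_j)$ with operators $\tau=\tau_n:C^n\to C^n$ satisfying $\tau\delta_i=\delta_{i-1}\tau$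 ($1\le i\le n+1$), $\tau\delta_0=\delta_{n+1}$, $\tau\sigma_j=\sigma_{j-1}\tau$ ($j\ge1$), $\tau\sigma_0=\sigma_n\tau^2$ and $\tau_n^{n+1}=\mathrm{id}$. *)

theory Defs
  imports "HOL-Algebra.Free_Abelian_Groups" "HOL-Algebra.Generated_Groups" "HOL-Algebra.Module"
begin

section \<open>Abelian groups given by generators and relations\<close>

definition pres_rels :: "'a set \<Rightarrow> ('a \<Rightarrow>\<^sub>0 int) set \<Rightarrow> ('a \<Rightarrow>\<^sub>0 int) set"
  where "pres_rels S P = generate (free_Abelian_group S) P"

definition pres_group :: "'a set \<Rightarrow> ('a \<Rightarrow>\<^sub>0 int) set \<Rightarrow> ('a \<Rightarrow>\<^sub>0 int) set monoid"
  where "pres_group S P = free_Abelian_group S Mod pres_rels S P"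

definition gen_class :: "'a set \<Rightarrow> ('a \<Rightarrow>\<^sub>0 int) set \<Rightarrow> 'a \<Rightarrow> ('a \<Rightarrow>\<^sub>0 int) set"
  where "gen_class S P x = pres_rels S P #>\<^bsub>free_Abelian_group S\<^esub> frag_of x"

text \<open>The homomorphism from a presented group to a commutative group \<open>G\<close> that is determined by
  the images \<open>f x\<close> of the generators.  It is meaningful when \<open>f\<close> respects the relations: then
  the \<open>\<int>\<close>-linear extension of \<open>f\<close> is constant on the coset \<open>X\<close>.\<close>

definition induced :: "('b, 'z) monoid_scheme \<Rightarrow> ('a \<Rightarrow> 'b) \<Rightarrow> ('a \<Rightarrow>\<^sub>0 int) set \<Rightarrow> 'b"
  where "induced G f X =
    the_elem ((\<lambda>z. finprod G (\<lambda>x. f x [^]\<^bsub>G\<^esub> Poly_Mapping.lookup z x) (Poly_Mapping.keys z)) ` X)"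


section \<open>Balanced tensor products of two modules\<close>

text \<open>\<open>M \<otimes>\<^sub>A N\<close>, where \<open>\<rho>\<close> is the right action of \<open>A\<close> on \<open>M\<close> and \<open>\<mu>\<close> the left action of
  \<open>A\<close> on \<open>N\<close>; only the carrier of \<open>A\<close> and the additive groups of \<open>M\<close>, \<open>N\<close> are used.\<close>

definition tensor_rels ::
    "('a, 'x) ring_scheme \<Rightarrow> ('m, 'y) ring_scheme \<Rightarrow> ('m \<Rightarrow> 'a \<Rightarrow> 'm) \<Rightarrow>
     ('n, 'z) ring_scheme \<Rightarrow> ('a \<Rightarrow> 'n \<Rightarrow> 'n) \<Rightarrow> ('m \<times> 'n \<Rightarrow>\<^sub>0 int) set"
  where "tensor_rels A M \<rho> N \<mu> =
    {frag_of (m \<oplus>\<^bsub>M\<^esub> m', n) - frag_of (m, n) - frag_of (m', n) | m m' n.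
       m \<in> carrier M \<and> m' \<in> carrier M \<and> n \<in> carrier N} \<union>
    {frag_of (m, n \<oplus>\<^bsub>N\<^esub> n') - frag_of (m, n) - frag_of (m, n') | m n n'.
       m \<in> carrier M \<and> n \<in> carrier N \<and> n' \<in> carrier N} \<union>
    {frag_of (\<rho> m a, n) - frag_of (m, \<mu> a n) | m a n.
       m \<in> carrier M \<and> a \<in> carrier A \<and> n \<in> carrier N}"

definition tensor_group ::
    "('a, 'x) ring_scheme \<Rightarrow> ('m, 'y) ring_scheme \<Rightarrow> ('m \<Rightarrow> 'a \<Rightarrow> 'm) \<Rightarrow>
     ('n, 'z) ring_scheme \<Rightarrow> ('a \<Rightarrow> 'n \<Rightarrow> 'n) \<Rightarrow> ('m \<times> 'n \<Rightarrow>\<^sub>0 int) set monoid"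
  where "tensor_group A M \<rho> N \<mu> =
    pres_group (carrier M \<times> carrier N) (tensor_rels A M \<rho> N \<mu>)"

definition pure_tensor ::
    "('a, 'x) ring_scheme \<Rightarrow> ('m, 'y) ring_scheme \<Rightarrow> ('m \<Rightarrow> 'a \<Rightarrow> 'm) \<Rightarrow>
     ('n, 'z) ring_scheme \<Rightarrow> ('a \<Rightarrow> 'n \<Rightarrow> 'n) \<Rightarrow> 'm \<Rightarrow> 'n \<Rightarrow> ('m \<times> 'n \<Rightarrow>\<^sub>0 int) set"
  where "pure_tensor A M \<rho> N \<mu> m n =
    gen_class (carrier M \<times> carrier N) (tensor_rels A M \<rho> N \<mu>) (m, n)"


section \<open>Algebras over a field and their enveloping algebras\<close>

locale field_algebra = K?: field K + R?: ring R + module K R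
  for K :: "('k, 'x) ring_scheme" (structure)
    and R :: "('k, 'r, 'y) module_scheme" (structure) +
  assumes smult_mult_left: "\<lbrakk>a \<in> carrier K; x \<in> carrier R; y \<in> carrier R\<rbrakk> \<Longrightarrow>
      (a \<odot>\<^bsub>R\<^esub> x) \<otimes>\<^bsub>R\<^esub> y = a \<odot>\<^bsub>R\<^esub> (x \<otimes>\<^bsub>R\<^esub> y)"
    and smult_mult_right: "\<lbrakk>a \<in> carrier K; x \<in> carrier R; y \<in> carrier R\<rbrakk> \<Longrightarrow>
      x \<otimes>\<^bsub>R\<^esub> (a \<odot>\<^bsub>R\<^esub> y) = a \<odot>\<^bsub>R\<^esub> (x \<otimes>\<^bsub>R\<^esub> y)"

definition op_algebra :: "('k, 'r, 'y) module_scheme \<Rightarrow> ('k, 'r, 'y) module_scheme"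
  where "op_algebra R = R\<lparr>mult := (\<lambda>x y. y \<otimes>\<^bsub>R\<^esub> x)\<rparr>"

definition algebra_tensor ::
    "('k, 'x) ring_scheme \<Rightarrow> ('k, 'a, 'y) module_scheme \<Rightarrow> ('k, 'b, 'z) module_scheme \<Rightarrow>
     ('a \<times> 'b \<Rightarrow>\<^sub>0 int) set ring"
  where "algebra_tensor K A B =
    (let \<rho> = (\<lambda>x k. k \<odot>\<^bsub>A\<^esub> x);
         G = tensor_group K A \<rho> B (smult B);
         t = pure_tensor K A \<rho> B (smult B)
     in \<lparr>carrier = carrier G,
         mult = (\<lambda>X Y. induced G (\<lambda>(a, b). induced G (\<lambda>(a', b').
                    t (a \<otimes>\<^bsub>A\<^esub> a') (b \<otimes>\<^bsub>B\<^esub> b')) Y) X),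
         one = t \<one>\<^bsub>A\<^esub> \<one>\<^bsub>B\<^esub>,
         zero = one G,
         add = mult G\<rparr>)"

type_synonym 'r env = "('r \<times> 'r \<Rightarrow>\<^sub>0 int) set"

definition env_algebra :: "('k, 'x) ring_scheme \<Rightarrow> ('k, 'r, 'y) module_scheme \<Rightarrow> 'r env ring"
  where "env_algebra K R = algebra_tensor K R (op_algebra R)"


section \<open>Bimodules\<close>

record ('r, 'c) bimodule = "('r, 'c) module" +
  rsmult :: "['c, 'r] \<Rightarrow> 'c" (infixl \<open>\<odot>\<^sub>r\<index>\<close> 70)

text \<open>The two induced actions of the ground field on a bimodule over an algebra are required to
  coincide; this is what makes a bimodule the same thing as an \<open>R\<^sup>e\<close>-module.\<close>

locale algebra_bimodule = field_algebra K R + C?: abelian_group C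
  for K :: "('k, 'x) ring_scheme" (structure)
    and R :: "('k, 'r, 'y) module_scheme" (structure)
    and C :: "('r, 'c, 'z) bimodule_scheme" (structure) +
  assumes lact_closed: "\<lbrakk>r \<in> carrier R; c \<in> carrier C\<rbrakk> \<Longrightarrow> r \<odot>\<^bsub>C\<^esub> c \<in> carrier C"
    and ract_closed: "\<lbrakk>r \<in> carrier R; c \<in> carrier C\<rbrakk> \<Longrightarrow> c \<odot>\<^sub>r\<^bsub>C\<^esub> r \<in> carrier C"
    and lact_add: "\<lbrakk>r \<in> carrier R; c \<in> carrier C; d \<in> carrier C\<rbrakk> \<Longrightarrow>
      r \<odot>\<^bsub>C\<^esub> (c \<oplus>\<^bsub>C\<^esub> d) = r \<odot>\<^bsub>C\<^esub> c \<oplus>\<^bsub>C\<^esub> r \<odot>\<^bsub>C\<^esub> d"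
    and add_lact: "\<lbrakk>r \<in> carrier R; s \<in> carrier R; c \<in> carrier C\<rbrakk> \<Longrightarrow>
      (r \<oplus>\<^bsub>R\<^esub> s) \<odot>\<^bsub>C\<^esub> c = r \<odot>\<^bsub>C\<^esub> c \<oplus>\<^bsub>C\<^esub> s \<odot>\<^bsub>C\<^esub> c"
    and mult_lact: "\<lbrakk>r \<in> carrier R; s \<in> carrier R; c \<in> carrier C\<rbrakk> \<Longrightarrow>
      (r \<otimes>\<^bsub>R\<^esub> s) \<odot>\<^bsub>C\<^esub> c = r \<odot>\<^bsub>C\<^esub> (s \<odot>\<^bsub>C\<^esub> c)"
    and one_lact: "c \<in> carrier C \<Longrightarrow> \<one>\<^bsub>R\<^esub> \<odot>\<^bsub>C\<^esub> c = c"
    and ract_add: "\<lbrakk>r \<in> carrier R; c \<in> carrier C; d \<in> carrier C\<rbrakk> \<Longrightarrow>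
      (c \<oplus>\<^bsub>C\<^esub> d) \<odot>\<^sub>r\<^bsub>C\<^esub> r = c \<odot>\<^sub>r\<^bsub>C\<^esub> r \<oplus>\<^bsub>C\<^esub> d \<odot>\<^sub>r\<^bsub>C\<^esub> r"
    and add_ract: "\<lbrakk>r \<in> carrier R; s \<in> carrier R; c \<in> carrier C\<rbrakk> \<Longrightarrow>
      c \<odot>\<^sub>r\<^bsub>C\<^esub> (r \<oplus>\<^bsub>R\<^esub> s) = c \<odot>\<^sub>r\<^bsub>C\<^esub> r \<oplus>\<^bsub>C\<^esub> c \<odot>\<^sub>r\<^bsub>C\<^esub> s"
    and mult_ract: "\<lbrakk>r \<in> carrier R; s \<in> carrier R; c \<in> carrier C\<rbrakk> \<Longrightarrow>
      c \<odot>\<^sub>r\<^bsub>C\<^esub> (r \<otimes>\<^bsub>R\<^esub> s) = (c \<odot>\<^sub>r\<^bsub>C\<^esub> r) \<odot>\<^sub>r\<^bsub>C\<^esub> s"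
    and one_ract: "c \<in> carrier C \<Longrightarrow> c \<odot>\<^sub>r\<^bsub>C\<^esub> \<one>\<^bsub>R\<^esub> = c"
    and lact_ract: "\<lbrakk>r \<in> carrier R; s \<in> carrier R; c \<in> carrier C\<rbrakk> \<Longrightarrow>
      (r \<odot>\<^bsub>C\<^esub> c) \<odot>\<^sub>r\<^bsub>C\<^esub> s = r \<odot>\<^bsub>C\<^esub> (c \<odot>\<^sub>r\<^bsub>C\<^esub> s)"
    and ground_central: "\<lbrakk>k \<in> carrier K; c \<in> carrier C\<rbrakk> \<Longrightarrow>
      (k \<odot>\<^bsub>R\<^esub> \<one>\<^bsub>R\<^esub>) \<odot>\<^bsub>C\<^esub> c = c \<odot>\<^sub>r\<^bsub>C\<^esub> (k \<odot>\<^bsub>R\<^esub> \<one>\<^bsub>R\<^esub>)"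

definition bimodule_hom ::
    "('r, 'x) ring_scheme \<Rightarrow> ('r, 'c, 'y) bimodule_scheme \<Rightarrow> ('r, 'd, 'z) bimodule_scheme \<Rightarrow>
     ('c \<Rightarrow> 'd) set"
  where "bimodule_hom R M N =
    {h \<in> carrier M \<rightarrow> carrier N.
       (\<forall>x\<in>carrier M. \<forall>y\<in>carrier M. h (x \<oplus>\<^bsub>M\<^esub> y) = h x \<oplus>\<^bsub>N\<^esub> h y) \<and>
       (\<forall>r\<in>carrier R. \<forall>x\<in>carrier M. h (r \<odot>\<^bsub>M\<^esub> x) = r \<odot>\<^bsub>N\<^esub> h x) \<and>
       (\<forall>r\<in>carrier R. \<forall>x\<in>carrier M. h (x \<odot>\<^sub>r\<^bsub>M\<^esub> r) = h x \<odot>\<^sub>r\<^bsub>N\<^esub> r)}"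

definition self_bimodule :: "('r, 'x) ring_scheme \<Rightarrow> ('r, 'r) bimodule"
  where "self_bimodule R =
    \<lparr>carrier = carrier R, mult = mult R, one = one R, zero = zero R, add = add R,
     smult = mult R, rsmult = mult R\<rparr>"

definition env_lact ::
    "('r, 'c, 'z) bimodule_scheme \<Rightarrow> 'r env \<Rightarrow> 'c \<Rightarrow> 'c"
  where "env_lact M X x = induced (add_monoid M) (\<lambda>(r, s). (r \<odot>\<^bsub>M\<^esub> x) \<odot>\<^sub>r\<^bsub>M\<^esub> s) X"

definition env_ract ::
    "('r, 'c, 'z) bimodule_scheme \<Rightarrow> 'c \<Rightarrow> 'r env \<Rightarrow> 'c"
  where "env_ract M x X = induced (add_monoid M) (\<lambda>(r, s). (s \<odot>\<^bsub>M\<^esub> x) \<odot>\<^sub>r\<^bsub>M\<^esub> r) X"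


section \<open>Tensor powers of a bimodule\<close>

text \<open>For \<open>n \<ge> 1\<close>, the \<open>n\<close>-fold tensor power of \<open>C\<close> over \<open>R\<close> is generated by lists
  \<open>[c\<^sub>1, \<dots>, c\<^sub>n]\<close>, standing for \<open>c\<^sub>1 \<otimes>\<^sub>R \<dots> \<otimes>\<^sub>R c\<^sub>n\<close>, subject to additivity in each place and
  \<open>R\<close>-balancedness between neighbours.\<close>

type_synonym 'c tp = "('c list \<Rightarrow>\<^sub>0 int) set"

definition tpow_gens :: "('r, 'c, 'z) bimodule_scheme \<Rightarrow> nat \<Rightarrow> 'c list set"
  where "tpow_gens C n = {cs. length cs = n \<and> set cs \<subseteq> carrier C}"

definition tpow_rels ::
    "('r, 'x) ring_scheme \<Rightarrow> ('r, 'c, 'z) bimodule_scheme \<Rightarrow> nat \<Rightarrow> ('c list \<Rightarrow>\<^sub>0 int) set"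
  where "tpow_rels R C n =
    {frag_of (us @ [x \<oplus>\<^bsub>C\<^esub> y] @ vs) - frag_of (us @ [x] @ vs) - frag_of (us @ [y] @ vs) | us x y vs.
       us @ [x] @ vs \<in> tpow_gens C n \<and> y \<in> carrier C} \<union>
    {frag_of (us @ [x \<odot>\<^sub>r\<^bsub>C\<^esub> r, y] @ vs) - frag_of (us @ [x, r \<odot>\<^bsub>C\<^esub> y] @ vs) | us x r y vs.
       us @ [x, y] @ vs \<in> tpow_gens C n \<and> r \<in> carrier R}"

definition tprod ::
    "('r, 'x) ring_scheme \<Rightarrow> ('r, 'c, 'z) bimodule_scheme \<Rightarrow> 'c list \<Rightarrow> 'c tp"
  where "tprod R C cs = gen_class (tpow_gens C (length cs)) (tpow_rels R C (length cs)) cs"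

text \<open>The fields \<open>mult\<close> and \<open>one\<close> are inherited from the record type of rings and play no role
  for modules.\<close>

definition tpow ::
    "('r, 'x) ring_scheme \<Rightarrow> ('r, 'c, 'z) bimodule_scheme \<Rightarrow> nat \<Rightarrow> ('r, 'c tp) bimodule"
  where "tpow R C n =
    (let G = pres_group (tpow_gens C n) (tpow_rels R C n)
     in \<lparr>carrier = carrier G, mult = undefined, one = undefined, zero = one G, add = mult G,
         smult = (\<lambda>r. induced G (\<lambda>cs. tprod R C ((r \<odot>\<^bsub>C\<^esub> hd cs) # tl cs))),
         rsmult = (\<lambda>X r. induced G (\<lambda>cs. tprod R C (butlast cs @ [last cs \<odot>\<^sub>r\<^bsub>C\<^esub> r])) X)\<rparr>)"


section \<open>Corings\<close>

text \<open>\<open>\<Delta>(c) = \<Sum>\<^sub>i a\<^sub>i \<otimes>\<^sub>R b\<^sub>i\<close> with \<open>i < m\<close>.  Formulas in Sweedler notation are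
  stated for all such representations.\<close>

definition sweedler ::
    "('r, 'x) ring_scheme \<Rightarrow> ('r, 'c, 'z) bimodule_scheme \<Rightarrow> ('c \<Rightarrow> 'c tp) \<Rightarrow>
     'c \<Rightarrow> nat \<Rightarrow> (nat \<Rightarrow> 'c) \<Rightarrow> (nat \<Rightarrow> 'c) \<Rightarrow> bool"
  where "sweedler R C \<Delta> c m a b \<longleftrightarrow>
    a \<in> {..<m} \<rightarrow> carrier C \<and> b \<in> {..<m} \<rightarrow> carrier C \<and>
    \<Delta> c = (\<Oplus>\<^bsub>tpow R C 2\<^esub>i\<in>{..<m}. tprod R C [a i, b i])"

locale coring = algebra_bimodule K R C
  for K :: "('k, 'x) ring_scheme" (structure)
    and R :: "('k, 'r, 'y) module_scheme" (structure)
    and C :: "('r, 'c, 'z) bimodule_scheme" (structure) +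
  fixes \<Delta> :: "'c \<Rightarrow> 'c tp"
    and \<epsilon> :: "'c \<Rightarrow> 'r"
  assumes coproduct_hom: "\<Delta> \<in> bimodule_hom R C (tpow R C 2)"
    and counit_hom: "\<epsilon> \<in> bimodule_hom R C (self_bimodule R)"
    and coassoc:
      "\<lbrakk>c \<in> carrier C; sweedler R C \<Delta> c m a b;
        \<And>i. i < m \<Longrightarrow> sweedler R C \<Delta> (a i) (p i) (a1 i) (a2 i);
        \<And>i. i < m \<Longrightarrow> sweedler R C \<Delta> (b i) (q i) (b1 i) (b2 i)\<rbrakk> \<Longrightarrow>
       (\<Oplus>\<^bsub>tpow R C 3\<^esub>i\<in>{..<m}. \<Oplus>\<^bsub>tpow R C 3\<^esub>j\<in>{..<p i}. tprod R C [a1 i j, a2 i j, b i]) =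
       (\<Oplus>\<^bsub>tpow R C 3\<^esub>i\<in>{..<m}. \<Oplus>\<^bsub>tpow R C 3\<^esub>j\<in>{..<q i}. tprod R C [a i, b1 i j, b2 i j])"
    and counit_left:
      "\<lbrakk>c \<in> carrier C; sweedler R C \<Delta> c m a b\<rbrakk> \<Longrightarrow> (\<Oplus>\<^bsub>C\<^esub>i\<in>{..<m}. \<epsilon> (a i) \<odot>\<^bsub>C\<^esub> b i) = c"
    and counit_right:
      "\<lbrakk>c \<in> carrier C; sweedler R C \<Delta> c m a b\<rbrakk> \<Longrightarrow> (\<Oplus>\<^bsub>C\<^esub>i\<in>{..<m}. a i \<odot>\<^sub>r\<^bsub>C\<^esub> \<epsilon> (b i)) = c"


section \<open>Cocyclic modules\<close>

text \<open>Linear maps are taken extensional (equal to \<open>undefined\<close> off the domain), so that unique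
  existence of such a map is meaningful.\<close>

definition linear_maps ::
    "('k, 'x) ring_scheme \<Rightarrow> ('k, 'v, 'y) module_scheme \<Rightarrow> ('k, 'w, 'z) module_scheme \<Rightarrow>
     ('v \<Rightarrow> 'w) set"
  where "linear_maps K M N =
    {h \<in> carrier M \<rightarrow>\<^sub>E carrier N.
       (\<forall>x\<in>carrier M. \<forall>y\<in>carrier M. h (x \<oplus>\<^bsub>M\<^esub> y) = h x \<oplus>\<^bsub>N\<^esub> h y) \<and>
       (\<forall>k\<in>carrier K. \<forall>x\<in>carrier M. h (k \<odot>\<^bsub>M\<^esub> x) = k \<odot>\<^bsub>N\<^esub> h x)}"

text \<open>\<open>\<delta> n i\<close> maps \<open>X n\<close> to \<open>X (n + 1)\<close> for \<open>i \<le> n + 1\<close>; \<open>\<sigma> n j\<close> maps \<open>X n\<close> to \<open>X (n - 1)\<close>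
  for \<open>j < n\<close>; \<open>\<tau> n\<close> maps \<open>X n\<close> to itself.\<close>

locale cosimplicial_module =
  fixes K :: "('k, 'x) ring_scheme"
    and X :: "nat \<Rightarrow> ('k, 'v) module"
    and \<delta> \<sigma> :: "nat \<Rightarrow> nat \<Rightarrow> 'v \<Rightarrow> 'v"
  assumes modules: "module K (X n)"
    and coface_linear: "i \<le> n + 1 \<Longrightarrow> \<delta> n i \<in> linear_maps K (X n) (X (n + 1))"
    and codegeneracy_linear: "j < n \<Longrightarrow> \<sigma> n j \<in> linear_maps K (X n) (X (n - 1))"
    and coface_coface: "\<lbrakk>i < j; j \<le> n + 2; x \<in> carrier (X n)\<rbrakk> \<Longrightarrow>
      \<delta> (n + 1) j (\<delta> n i x) = \<delta> (n + 1) i (\<delta> n (j - 1) x)"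
    and codegeneracy_codegeneracy: "\<lbrakk>i \<le> j; j < n; x \<in> carrier (X (n + 1))\<rbrakk> \<Longrightarrow>
      \<sigma> n j (\<sigma> (n + 1) i x) = \<sigma> n i (\<sigma> (n + 1) (j + 1) x)"
    and codegeneracy_coface_less: "\<lbrakk>i < j; j \<le> n; x \<in> carrier (X n)\<rbrakk> \<Longrightarrow>
      \<sigma> (n + 1) j (\<delta> n i x) = \<delta> (n - 1) i (\<sigma> n (j - 1) x)"
    and codegeneracy_coface_id: "\<lbrakk>j \<le> n; i = j \<or> i = j + 1; x \<in> carrier (X n)\<rbrakk> \<Longrightarrow>
      \<sigma> (n + 1) j (\<delta> n i x) = x"
    and codegeneracy_coface_greater: "\<lbrakk>j + 1 < i; i \<le> n + 1; x \<in> carrier (X n)\<rbrakk> \<Longrightarrow>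
      \<sigma> (n + 1) j (\<delta> n i x) = \<delta> (n - 1) (i - 1) (\<sigma> n j x)"

locale cocyclic_module = cosimplicial_module K X \<delta> \<sigma>
  for K :: "('k, 'x) ring_scheme"
    and X :: "nat \<Rightarrow> ('k, 'v) module"
    and \<delta> \<sigma> :: "nat \<Rightarrow> nat \<Rightarrow> 'v \<Rightarrow> 'v" +
  fixes \<tau> :: "nat \<Rightarrow> 'v \<Rightarrow> 'v"
  assumes cyclic_linear: "\<tau> n \<in> linear_maps K (X n) (X n)"
    and cyclic_coface: "\<lbrakk>1 \<le> i; i \<le> n + 1; x \<in> carrier (X n)\<rbrakk> \<Longrightarrow>
      \<tau> (n + 1) (\<delta> n i x) = \<delta> n (i - 1) (\<tau> n x)"
    and cyclic_coface_0: "x \<in> carrier (X n) \<Longrightarrow> \<tau> (n + 1) (\<delta> n 0 x) = \<delta> n (n + 1) x"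
    and cyclic_codegeneracy: "\<lbrakk>1 \<le> j; j \<le> n; x \<in> carrier (X (n + 1))\<rbrakk> \<Longrightarrow>
      \<tau> n (\<sigma> (n + 1) j x) = \<sigma> (n + 1) (j - 1) (\<tau> (n + 1) x)"
    and cyclic_codegeneracy_0: "x \<in> carrier (X (n + 1)) \<Longrightarrow>
      \<tau> n (\<sigma> (n + 1) 0 x) = \<sigma> (n + 1) n (\<tau> (n + 1) (\<tau> (n + 1) x))"
    and cyclic_order: "x \<in> carrier (X n) \<Longrightarrow> (\<tau> n ^^ (n + 1)) x = x"


section \<open>The modules and operators attached to a coring\<close>

text \<open>The bimodules \<open>R\<close> (for \<open>n = 0\<close>) and \<open>C\<^bsup>\<otimes>n\<^esup>\<close> (for \<open>n \<ge> 1\<close>) live in different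
  types; they are copied into a common sum type along \<open>Inl\<close> and \<open>Inr\<close>.\<close>

definition relabel ::
    "('c \<Rightarrow> 'd) \<Rightarrow> ('d \<Rightarrow> 'c) \<Rightarrow> ('r, 'c) bimodule \<Rightarrow> ('r, 'd) bimodule"
  where "relabel f g M =
    \<lparr>carrier = f ` carrier M, mult = undefined, one = undefined,
     zero = f \<zero>\<^bsub>M\<^esub>, add = (\<lambda>x y. f (g x \<oplus>\<^bsub>M\<^esub> g y)),
     smult = (\<lambda>r x. f (r \<odot>\<^bsub>M\<^esub> g x)), rsmult = (\<lambda>x r. f (g x \<odot>\<^sub>r\<^bsub>M\<^esub> r))\<rparr>"

definition coeff ::
    "('r, 'x) ring_scheme \<Rightarrow> ('r, 'c, 'z) bimodule_scheme \<Rightarrow> nat \<Rightarrow> ('r, 'r + 'c tp) bimodule"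
  where "coeff R C n =
    (if n = 0 then relabel Inl projl (self_bimodule R) else relabel Inr projr (tpow R C n))"

type_synonym ('r, 'c) cochain = "('c \<times> ('r + 'c tp) \<Rightarrow>\<^sub>0 int) set"

definition cochain_tensor ::
    "('k, 'x) ring_scheme \<Rightarrow> ('k, 'r, 'y) module_scheme \<Rightarrow> ('r, 'c, 'z) bimodule_scheme \<Rightarrow>
     nat \<Rightarrow> 'c \<Rightarrow> 'r + 'c tp \<Rightarrow> ('r, 'c) cochain"
  where "cochain_tensor K R C n =
    pure_tensor (env_algebra K R) C (env_ract C) (coeff R C n) (env_lact (coeff R C n))"

text \<open>\<open>C\<^sup>n\<close>, with \<open>k\<close> acting through the coring factor.\<close>

definition cochains ::
    "('k, 'x) ring_scheme \<Rightarrow> ('k, 'r, 'y) module_scheme \<Rightarrow> ('r, 'c, 'z) bimodule_scheme \<Rightarrow>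
     nat \<Rightarrow> ('k, ('r, 'c) cochain) module"
  where "cochains K R C n =
    (let G = tensor_group (env_algebra K R) C (env_ract C) (coeff R C n) (env_lact (coeff R C n))
     in \<lparr>carrier = carrier G, mult = undefined, one = undefined, zero = one G, add = mult G,
         smult = (\<lambda>k. induced G (\<lambda>(c, x).
           cochain_tensor K R C n ((k \<odot>\<^bsub>R\<^esub> \<one>\<^bsub>R\<^esub>) \<odot>\<^bsub>C\<^esub> c) x))\<rparr>)"

text \<open>The pure tensors \<open>c \<otimes> r\<close> in \<open>C\<^sup>0\<close> and \<open>c\<^sub>0 \<otimes> c\<^sub>1 \<otimes> \<dots> \<otimes> c\<^sub>n\<close> in \<open>C\<^sup>n\<close>, \<open>n \<ge> 1\<close>.\<close>

definition elt0 ::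
    "('k, 'x) ring_scheme \<Rightarrow> ('k, 'r, 'y) module_scheme \<Rightarrow> ('r, 'c, 'z) bimodule_scheme \<Rightarrow>
     'c \<Rightarrow> 'r \<Rightarrow> ('r, 'c) cochain"
  where "elt0 K R C c r = cochain_tensor K R C 0 c (Inl r)"

definition elt ::
    "('k, 'x) ring_scheme \<Rightarrow> ('k, 'r, 'y) module_scheme \<Rightarrow> ('r, 'c, 'z) bimodule_scheme \<Rightarrow>
     'c \<Rightarrow> 'c list \<Rightarrow> ('r, 'c) cochain"
  where "elt K R C c cs = cochain_tensor K R C (length cs) c (Inr (tprod R C cs))"

text \<open>In the next three definitions a list \<open>cs\<close> is \<open>[c\<^sub>1, \<dots>, c\<^sub>n]\<close>, so \<open>cs ! (i - 1)\<close> is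
  \<open>c\<^sub>i\<close>.\<close>

definition is_coface ::
    "('k, 'x) ring_scheme \<Rightarrow> ('k, 'r, 'y) module_scheme \<Rightarrow> ('r, 'c, 'z) bimodule_scheme \<Rightarrow>
     ('c \<Rightarrow> 'c tp) \<Rightarrow> nat \<Rightarrow> nat \<Rightarrow> (('r, 'c) cochain \<Rightarrow> ('r, 'c) cochain) \<Rightarrow> bool"
  where "is_coface K R C \<Delta> n i d \<longleftrightarrow>
    d \<in> linear_maps K (cochains K R C n) (cochains K R C (n + 1)) \<and>
    (n = 0 \<longrightarrow> (\<forall>c\<in>carrier C. \<forall>r\<in>carrier R. \<forall>m a b. sweedler R C \<Delta> c m a b \<longrightarrow>
       d (elt0 K R C c r) =
         (if i = 0
          then (\<Oplus>\<^bsub>cochains K R C 1\<^esub>l\<in>{..<m}. elt K R C (a l) [b l \<odot>\<^sub>r\<^bsub>C\<^esub> r])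
          else (\<Oplus>\<^bsub>cochains K R C 1\<^esub>l\<in>{..<m}. elt K R C (b l) [r \<odot>\<^bsub>C\<^esub> a l])))) \<and>
    (n \<ge> 1 \<longrightarrow> (\<forall>c0\<in>carrier C. \<forall>cs\<in>tpow_gens C n. \<forall>m a b.
       sweedler R C \<Delta> (if 1 \<le> i \<and> i \<le> n then cs ! (i - 1) else c0) m a b \<longrightarrow>
       d (elt K R C c0 cs) =
         (\<Oplus>\<^bsub>cochains K R C (n + 1)\<^esub>l\<in>{..<m}.
            if i = 0 then elt K R C (a l) (b l # cs)
            else if i \<le> n then elt K R C c0 (take (i - 1) cs @ [a l, b l] @ drop i cs)
            else elt K R C (b l) (cs @ [a l]))))"

text \<open>For \<open>n \<ge> 2\<close> the scalar \<open>\<epsilon>(c\<^bsub>j+1\<^esub>)\<close> is absorbed by the factor on its right, or, for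
  \<open>j = n - 1\<close>, by the factor on its left.\<close>

definition counit_at ::
    "('r, 'c, 'z) bimodule_scheme \<Rightarrow> ('c \<Rightarrow> 'r) \<Rightarrow> nat \<Rightarrow> 'c list \<Rightarrow> 'c list"
  where "counit_at C \<epsilon> j cs =
    (if j + 1 < length cs
     then take j cs @ [\<epsilon> (cs ! j) \<odot>\<^bsub>C\<^esub> cs ! (j + 1)] @ drop (j + 2) cs
     else take (j - 1) cs @ [cs ! (j - 1) \<odot>\<^sub>r\<^bsub>C\<^esub> \<epsilon> (cs ! j)])"

definition is_codegeneracy ::
    "('k, 'x) ring_scheme \<Rightarrow> ('k, 'r, 'y) module_scheme \<Rightarrow> ('r, 'c, 'z) bimodule_scheme \<Rightarrow>
     ('c \<Rightarrow> 'r) \<Rightarrow> nat \<Rightarrow> nat \<Rightarrow> (('r, 'c) cochain \<Rightarrow> ('r, 'c) cochain) \<Rightarrow> bool"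
  where "is_codegeneracy K R C \<epsilon> n j s \<longleftrightarrow>
    s \<in> linear_maps K (cochains K R C n) (cochains K R C (n - 1)) \<and>
    (\<forall>c0\<in>carrier C. \<forall>cs\<in>tpow_gens C n.
       s (elt K R C c0 cs) =
         (if n = 1 then elt0 K R C c0 (\<epsilon> (cs ! 0)) else elt K R C c0 (counit_at C \<epsilon> j cs)))"

definition is_cyclic_operator ::
    "('k, 'x) ring_scheme \<Rightarrow> ('k, 'r, 'y) module_scheme \<Rightarrow> ('r, 'c, 'z) bimodule_scheme \<Rightarrow>
     nat \<Rightarrow> (('r, 'c) cochain \<Rightarrow> ('r, 'c) cochain) \<Rightarrow> bool"
  where "is_cyclic_operator K R C n t \<longleftrightarrow>
    t \<in> linear_maps K (cochains K R C n) (cochains K R C n) \<and>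
    (n = 0 \<longrightarrow> (\<forall>x\<in>carrier (cochains K R C 0). t x = x)) \<and>
    (n \<ge> 1 \<longrightarrow> (\<forall>c0\<in>carrier C. \<forall>cs\<in>tpow_gens C n.
       t (elt K R C c0 cs) = elt K R C (hd cs) (tl cs @ [c0])))"

end

theory Submission
  imports Defs
begin

text \<open>The module \<open>C\<^sup>n\<close> consists of cyclic words.  It is generated by words \<open>c\<^sub>0 c\<^sub>1 \<dots> c\<^sub>n\<close> of length
  \<open>n + 1\<close>: for \<open>n \<ge> 1\<close> the word stands for \<open>c\<^sub>0 \<otimes> c\<^sub>1 \<otimes> \<dots> \<otimes> c\<^sub>n\<close>, and for \<open>n = 0\<close> the word \<open>c\<close>
  stands for \<open>c \<otimes> 1\<close>.  The relations are additivity in each letter and \<open>R\<close>-balancedness between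
  neighbouring letters, where the last letter and the first one count as neighbours: the tensor
  product over \<open>R\<^sup>e\<close> identifies \<open>s c\<^sub>0 r \<otimes> x\<close> with \<open>c\<^sub>0 \<otimes> r x s\<close>, so that \<open>r\<close> passes between
  \<open>c\<^sub>0\<close> and \<open>c\<^sub>1\<close> while \<open>s\<close> passes between \<open>c\<^sub>0\<close> and \<open>c\<^sub>n\<close>.  Hence a linear map out of \<open>C\<^sup>n\<close> is
  the same thing as a linear function on words that respects these relations (lemmas
  \<open>word_cyclically_balanced\<close>, \<open>words_lift\<close> and \<open>words_ext\<close>), uniformly in \<open>n\<close>.  The relations
  are invariant under rotation of words, and that is where the cyclic structure comes from.

  On words, \<open>\<tau>\<close> moves the first letter to the end, \<open>\<delta>\<^sub>i\<close> with \<open>i \<le> n\<close> replaces the letter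
  \<open>c\<^sub>i\<close> by the two letters of \<open>\<Delta>(c\<^sub>i)\<close>, \<open>\<sigma>\<^sub>j\<close> contracts the letters \<open>x y\<close> at the positions
  \<open>j, j + 1\<close> to \<open>x \<epsilon>(y)\<close>, and \<open>\<delta>\<^bsub>n+1\<^esub> = \<tau> \<delta>\<^sub>0\<close>.  Well-definedness has to be checked for \<open>\<tau>\<close>,
  \<open>\<delta>\<^sub>0\<close> and \<open>\<sigma>\<^sub>0\<close> only, because rotating a word back and forth brings every position to the
  front: \<open>\<delta>\<^sub>i = \<tau>\<^bsup>n+2-i\<^esup> \<delta>\<^sub>0 \<tau>\<^bsup>i\<^esup>\<close> and \<open>\<sigma>\<^sub>j = \<tau>\<^bsup>n-j\<^esup> \<sigma>\<^sub>0 \<tau>\<^bsup>j\<^esup>\<close> on \<open>C\<^sup>n\<close>.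

  The cocyclic identities are compared on words.  Operators that touch disjoint sets of letters
  commute for trivial reasons.  The remaining cases are coassociativity
  (\<open>cofaces_adjacent\<close>), the two counit laws (\<open>\<sigma>_\<delta>_same\<close>, \<open>\<sigma>_\<delta>_last\<close>) and the \<open>R\<close>-linearity of
  \<open>\<Delta>\<close> and \<open>\<epsilon>\<close>.  The rules for exchanging
  the last coface with another coface or with a codegeneracy follow formally from
  \<open>\<delta>\<^bsub>n+1\<^esub> = \<tau> \<delta>\<^sub>0\<close> and the remaining identities.\<close>

section \<open>Presented abelian groups\<close>

text \<open>The group from which a bimodule or module record takes its addition and the
  additive monoid of that record differ in their record types, so they can only be compared field
  by field.\<close>

lemma induced_cong:
  fixes f :: "'c \<Rightarrow> 'a"
  assumes "carrier G = carrier H" "mult G = mult H" "one G = one H"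
  shows "induced G f = induced H f"
proof -
  have inv: "m_inv G = m_inv H"
    by (rule ext) (simp add: m_inv_def assms)
  have pow: "x [^]\<^bsub>G\<^esub> (i::int) = x [^]\<^bsub>H\<^esub> i" for x i
    by (simp add: int_pow_def nat_pow_def Let_def assms inv)
  have "finprod G g A = finprod H g A" for g :: "'c \<Rightarrow> 'a" and A
    by (simp add: finprod_def assms)
  then show ?thesis
    by (simp add: induced_def fun_eq_iff pow)
qed

context comm_group
begin

lemma free_extension_hom:
  assumes f: "f \<in> S \<rightarrow> carrier G"
  shows "(\<lambda>z. finprod G (\<lambda>x. f x [^] Poly_Mapping.lookup z x) (Poly_Mapping.keys z))
    \<in> hom (free_Abelian_group S) G" (is "?h \<in> _")
proof (rule homI)
  show "?h z \<in> carrier G" if "z \<in> carrier (free_Abelian_group S)" for z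
    using that f by (auto intro!: finprod_closed)
next
  fix y z
  assume "y \<in> carrier (free_Abelian_group S)" "z \<in> carrier (free_Abelian_group S)"
  then have yz: "Poly_Mapping.keys y \<subseteq> S" "Poly_Mapping.keys z \<subseteq> S"
    by auto
  \<comment> \<open>The three products become comparable over a common finite support.\<close>
  let ?T = "Poly_Mapping.keys y \<union> Poly_Mapping.keys z"
  have T: "finite ?T" "?T \<subseteq> S"
    using yz by auto
  have fT: "f x \<in> carrier G" if "x \<in> ?T" for x
    using that T f by blast
  have h: "?h w = finprod G (\<lambda>x. f x [^] Poly_Mapping.lookup w x) ?T"
    if "Poly_Mapping.keys w \<subseteq> ?T" for w
  proof (rule finprod_mono_neutral_cong_left[OF T(1) that])
    show "f i [^] Poly_Mapping.lookup w i = \<one>" if "i \<in> ?T - Poly_Mapping.keys w" for i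
      using that by (simp add: in_keys_iff)
  qed (use T f in auto)
  have c: "(\<lambda>x. f x [^] Poly_Mapping.lookup w x) \<in> ?T \<rightarrow> carrier G" for w :: "_ \<Rightarrow>\<^sub>0 int"
    using fT by (intro funcsetI int_pow_closed)
  have "?h (y + z) =
      finprod G (\<lambda>x. f x [^] Poly_Mapping.lookup y x \<otimes> f x [^] Poly_Mapping.lookup z x) ?T"
    unfolding h[OF keys_add]
    by (intro finprod_cong' refl funcsetI m_closed int_pow_closed fT)
      (simp_all only: lookup_add int_pow_mult[OF fT])
  also have "\<dots> = ?h y \<otimes> ?h z"
    by (simp only: h[OF Un_upper1] h[OF Un_upper2] finprod_multf[OF c c])
  finally show "?h (y \<otimes>\<^bsub>free_Abelian_group S\<^esub> z) = ?h y \<otimes> ?h z"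
    by simp
qed

end

text \<open>Every presentation below has relations of two shapes only: \<open>x = y + z\<close>, collected
  in \<open>T\<close>, and \<open>x = y\<close>, collected in \<open>E\<close>.  Keeping the two sets apart makes the condition for a
  map of generators to extend readable.\<close>

locale presentation =
  fixes S :: "'a set" and T :: "('a \<times> 'a \<times> 'a) set" and E :: "('a \<times> 'a) set"
    and P :: "('a \<Rightarrow>\<^sub>0 int) set"
  assumes rels: "P = {frag_of x - frag_of y - frag_of z | x y z. (x, y, z) \<in> T} \<union>
      {frag_of x - frag_of y | x y. (x, y) \<in> E}"
    and sum_gens: "(x, y, z) \<in> T \<Longrightarrow> x \<in> S \<and> y \<in> S \<and> z \<in> S"
    and eq_gens: "(x, y) \<in> E \<Longrightarrow> x \<in> S \<and> y \<in> S"
begin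

abbreviation F where "F \<equiv> free_Abelian_group S"
abbreviation G where "G \<equiv> pres_group S P"
abbreviation gen where "gen \<equiv> gen_class S P"

lemma rels_subset: "P \<subseteq> carrier F"
proof -
  have "frag_of x - frag_of y - frag_of z \<in> carrier F" if "(x, y, z) \<in> T" for x y z
    using sum_gens[OF that] keys_diff[of "frag_of x - frag_of y" "frag_of z"]
      keys_diff[of "frag_of x" "frag_of y"] by auto
  moreover have "frag_of x - frag_of y \<in> carrier F" if "(x, y) \<in> E" for x y
    using eq_gens[OF that] keys_diff[of "frag_of x" "frag_of y"] by auto
  ultimately show ?thesis
    unfolding rels by blast
qed

sublocale F: comm_group F
  by (rule abelian_free_Abelian_group)

lemma normal_rels: "pres_rels S P \<lhd> F"
  unfolding pres_rels_def
  by (intro F.normal_iff_subgroup[THEN iffD2] F.generate_is_subgroup rels_subset)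

sublocale N: normal "pres_rels S P" F
  by (rule normal_rels)

sublocale G: comm_group G
  unfolding pres_group_def by (intro F.abelian_FactGroup N.is_subgroup)

lemma coset_hom: "(\<lambda>z. pres_rels S P #>\<^bsub>F\<^esub> z) \<in> hom F G"
  unfolding pres_group_def by (rule N.r_coset_hom_Mod)

lemma carrier_G: "carrier G = (\<lambda>z. pres_rels S P #>\<^bsub>F\<^esub> z) ` carrier F"
  by (auto simp: pres_group_def FactGroup_def RCOSETS_def)

lemma gen_closed: "x \<in> S \<Longrightarrow> gen x \<in> carrier G"
  by (auto simp: gen_class_def carrier_G)

text \<open>The cosets of the generators generate the quotient because the generators generate
  the free group.  Uniqueness of homomorphisms out of the presented group rests on this.\<close>

lemma carrier_generated: "carrier G = generate G (gen ` S)"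
proof
  show "generate G (gen ` S) \<subseteq> carrier G"
    by (rule G.generate_incl) (auto intro: gen_closed)
  have "pres_rels S P #>\<^bsub>F\<^esub> z \<in> generate G (gen ` S)" if "Poly_Mapping.keys z \<subseteq> S" for z
  proof (rule free_Abelian_group_induct[OF that])
    show "pres_rels S P #>\<^bsub>F\<^esub> 0 \<in> generate G (gen ` S)"
      using generate.one[of G "gen ` S"] hom_one[OF coset_hom] by simp
  next
    fix x y
    assume xy: "Poly_Mapping.keys x \<subseteq> S" "Poly_Mapping.keys y \<subseteq> S"
      "pres_rels S P #>\<^bsub>F\<^esub> x \<in> generate G (gen ` S)"
      "pres_rels S P #>\<^bsub>F\<^esub> y \<in> generate G (gen ` S)"
    have "pres_rels S P #>\<^bsub>F\<^esub> (x - y) =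
        (pres_rels S P #>\<^bsub>F\<^esub> x) \<otimes>\<^bsub>G\<^esub> inv\<^bsub>G\<^esub> (pres_rels S P #>\<^bsub>F\<^esub> y)"
      using xy hom_mult[OF coset_hom, of x "- y"]
        group_hom.hom_inv[OF group_hom.intro[OF F.is_group G.is_group group_hom_axioms.intro[OF coset_hom]], of y]
      by simp
    moreover have "gen ` S \<subseteq> carrier G"
      using gen_closed by auto
    ultimately show "pres_rels S P #>\<^bsub>F\<^esub> (x - y) \<in> generate G (gen ` S)"
      using xy by (simp add: G.generate_m_inv_closed generate.eng)
  next
    show "pres_rels S P #>\<^bsub>F\<^esub> frag_of a \<in> generate G (gen ` S)" if "a \<in> S" for a
      unfolding gen_class_def[symmetric] using that by (auto intro: generate.incl)
  qed
  then show "carrier G \<subseteq> generate G (gen ` S)"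
    by (auto simp: carrier_G)
qed

lemma hom_eqI:
  assumes A: "group A" and hom: "h \<in> hom G A" "g \<in> hom G A"
    and eq: "\<And>x. x \<in> S \<Longrightarrow> h (gen x) = g (gen x)"
    and X: "X \<in> carrier G"
  shows "h X = g X"
proof -
  interpret A: group A by (rule A)
  interpret h: group_hom G A h using hom by unfold_locales
  interpret g: group_hom G A g using hom by unfold_locales
  have carr: "generate G (gen ` S) = carrier G"
    by (simp add: carrier_generated)
  from X have "X \<in> generate G (gen ` S)"
    by (simp add: carr)
  then show ?thesis
  proof induction
    case (eng X Y)
    then show ?case by (simp add: carr)
  qed (auto simp: eq gen_closed)
qed

lemma coset_eqI:
  assumes "x \<in> carrier F" "y \<in> carrier F" "x - y \<in> P"
  shows "pres_rels S P #>\<^bsub>F\<^esub> x = pres_rels S P #>\<^bsub>F\<^esub> y"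
proof -
  have "x \<otimes>\<^bsub>F\<^esub> inv\<^bsub>F\<^esub> y \<in> pres_rels S P"
    using assms by (simp add: pres_rels_def generate.incl)
  then have "x \<in> pres_rels S P #>\<^bsub>F\<^esub> y"
    using assms N.rcos_module[OF F.is_group] by simp
  then show ?thesis
    using F.repr_independence N.subgroup_axioms assms by metis
qed

lemma gen_sum:
  assumes "(x, y, z) \<in> T"
  shows "gen x = gen y \<otimes>\<^bsub>G\<^esub> gen z"
proof -
  note xyz = sum_gens[OF assms]
  have yz: "frag_of y + frag_of z \<in> carrier F"
    using xyz F.m_closed[of "frag_of y" "frag_of z"] by simp
  have "frag_of x - (frag_of y + frag_of z) \<in> P"
    unfolding rels diff_diff_eq[symmetric] using assms by blast
  then have "gen x = pres_rels S P #>\<^bsub>F\<^esub> (frag_of y + frag_of z)"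
    unfolding gen_class_def using xyz yz by (intro coset_eqI) auto
  then show ?thesis
    using hom_mult[OF coset_hom, of "frag_of y" "frag_of z"] xyz by (simp add: gen_class_def)
qed

lemma gen_eq:
  assumes "(x, y) \<in> E"
  shows "gen x = gen y"
  unfolding gen_class_def
  by (rule coset_eqI) (use eq_gens[OF assms] assms in \<open>auto simp: rels\<close>)

text \<open>The linear extension of \<open>f\<close> to the free group kills every relation, hence the
  subgroup that they generate, and so it is constant on cosets.\<close>

lemma induced_lift:
  assumes A: "comm_group A" and f: "f \<in> S \<rightarrow> carrier A"
    and sum: "\<And>x y z. (x, y, z) \<in> T \<Longrightarrow> f x = f y \<otimes>\<^bsub>A\<^esub> f z"
    and eq: "\<And>x y. (x, y) \<in> E \<Longrightarrow> f x = f y"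
  shows "induced A f \<in> hom G A" and "x \<in> S \<Longrightarrow> induced A f (gen x) = f x"
proof -
  interpret A: comm_group A by (rule A)
  define h where
    "h z = finprod A (\<lambda>x. f x [^]\<^bsub>A\<^esub> Poly_Mapping.lookup z x) (Poly_Mapping.keys z)"
    for z :: "'a \<Rightarrow>\<^sub>0 int"
  have hom: "h \<in> hom F A"
    unfolding h_def by (rule A.free_extension_hom[OF f])
  interpret h: group_hom F A h
    using hom by unfold_locales
  have h_gen: "h (frag_of x) = f x" if "x \<in> S" for x
  proof -
    have "f x [^]\<^bsub>A\<^esub> (1::int) = f x"
      using that f by (intro A.int_pow_1) auto
    then show ?thesis
      using that f by (simp add: h_def A.finprod_singleton Pi_iff)
  qed
  have h_diff: "h (y - z) = h y \<otimes>\<^bsub>A\<^esub> inv\<^bsub>A\<^esub> h z" if "y \<in> carrier F" "z \<in> carrier F" for y z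
    using that h.hom_mult[of y "- z"] h.hom_inv[of z] by simp
  have fc: "f x \<in> carrier A" if "x \<in> S" for x
    using that f by auto
  have "h p = \<one>\<^bsub>A\<^esub>" if "p \<in> P" for p
  proof -
    from that consider x y z where "p = frag_of x - frag_of y - frag_of z" "(x, y, z) \<in> T"
      | x y where "p = frag_of x - frag_of y" "(x, y) \<in> E"
      unfolding rels by blast
    then show ?thesis
    proof cases
      case 1
      note S = sum_gens[OF 1(2)]
      have "frag_of x - frag_of y \<in> carrier F"
        using S keys_diff[of "frag_of x" "frag_of y"] by auto
      moreover have "f y \<otimes>\<^bsub>A\<^esub> f z \<otimes>\<^bsub>A\<^esub> inv\<^bsub>A\<^esub> f y = f z"
        using S fc A.m_comm[of "f y" "f z"] by (simp add: A.m_assoc)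
      ultimately show ?thesis
        using S fc by (simp add: 1 h_diff h_gen sum[OF 1(2)])
    next
      case 2
      then show ?thesis
        using eq_gens[OF 2(2)] fc by (simp add: h_diff h_gen eq[OF 2(2)])
    qed
  qed
  then have "P \<subseteq> kernel F A h"
    using rels_subset unfolding kernel_def by blast
  then have ker: "pres_rels S P \<subseteq> kernel F A h"
    unfolding pres_rels_def by (rule F.generate_subgroup_incl[OF _ h.subgroup_kernel])
  have h_coset: "induced A f (pres_rels S P #>\<^bsub>F\<^esub> z) = h z" if z: "z \<in> carrier F" for z
  proof -
    have "h w = h z" if w: "w \<in> pres_rels S P #>\<^bsub>F\<^esub> z" for w
    proof -
      obtain p where p: "p \<in> pres_rels S P" "w = p \<otimes>\<^bsub>F\<^esub> z"
        using w unfolding r_coset_def by blast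
      then have "p \<in> carrier F" "h p = \<one>\<^bsub>A\<^esub>"
        using ker unfolding kernel_def by blast+
      then have "h w = \<one>\<^bsub>A\<^esub> \<otimes>\<^bsub>A\<^esub> h z"
        using h.hom_mult[OF _ z, of p] unfolding p(2) by metis
      then show ?thesis
        using A.l_one[OF h.hom_closed[OF z]] by simp
    qed
    moreover have "z \<in> pres_rels S P #>\<^bsub>F\<^esub> z"
      using F.rcos_self[OF z N.is_subgroup] .
    ultimately have "h ` (pres_rels S P #>\<^bsub>F\<^esub> z) = {h z}"
      by blast
    moreover have "induced A f X = the_elem (h ` X)" for X
      by (simp add: induced_def h_def)
    ultimately show ?thesis
      by simp
  qed
  show "induced A f \<in> hom G A"
  proof (rule homI)
    show "induced A f X \<in> carrier A" if "X \<in> carrier G" for X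
      using that h_coset h.hom_closed by (fastforce simp: carrier_G)
    show "induced A f (X \<otimes>\<^bsub>G\<^esub> Y) = induced A f X \<otimes>\<^bsub>A\<^esub> induced A f Y"
      if XY: "X \<in> carrier G" "Y \<in> carrier G" for X Y
    proof -
      from XY obtain x y where "x \<in> carrier F" "y \<in> carrier F"
        and "X = pres_rels S P #>\<^bsub>F\<^esub> x" "Y = pres_rels S P #>\<^bsub>F\<^esub> y"
        unfolding carrier_G by blast
      then show ?thesis
        using hom_mult[OF coset_hom, of x y] h_coset F.m_closed h.hom_mult
        by (metis (no_types, lifting))
    qed
  qed
  show "induced A f (gen x) = f x" if "x \<in> S"
    unfolding gen_class_def using that by (subst h_coset) (auto simp: h_gen)
qed

end

section \<open>Additive maps and finite sums\<close>

text \<open>Unlike the linear maps of a cocyclic module these maps need not be extensional, so that they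
  can be composed and added pointwise.\<close>

definition additive_maps ::
    "('a, 'x) ring_scheme \<Rightarrow> ('b, 'y) ring_scheme \<Rightarrow> ('a \<Rightarrow> 'b) set"
  where "additive_maps M N =
    {h \<in> carrier M \<rightarrow> carrier N.
       \<forall>x\<in>carrier M. \<forall>y\<in>carrier M. h (x \<oplus>\<^bsub>M\<^esub> y) = h x \<oplus>\<^bsub>N\<^esub> h y}"

lemma additiveI:
  assumes "\<And>x. x \<in> carrier M \<Longrightarrow> h x \<in> carrier N"
    and "\<And>x y. \<lbrakk>x \<in> carrier M; y \<in> carrier M\<rbrakk> \<Longrightarrow> h (x \<oplus>\<^bsub>M\<^esub> y) = h x \<oplus>\<^bsub>N\<^esub> h y"
  shows "h \<in> additive_maps M N"
  using assms by (simp add: additive_maps_def)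

lemma additive_closed: "\<lbrakk>h \<in> additive_maps M N; x \<in> carrier M\<rbrakk> \<Longrightarrow> h x \<in> carrier N"
  by (auto simp: additive_maps_def)

lemma additive_add:
  "\<lbrakk>h \<in> additive_maps M N; x \<in> carrier M; y \<in> carrier M\<rbrakk> \<Longrightarrow> h (x \<oplus>\<^bsub>M\<^esub> y) = h x \<oplus>\<^bsub>N\<^esub> h y"
  by (auto simp: additive_maps_def)

lemma additive_iff_hom:
  assumes "carrier G = carrier M" "mult G = add M"
  shows "h \<in> additive_maps M N \<longleftrightarrow> h \<in> hom G (add_monoid N)"
  by (auto simp: additive_maps_def hom_def assms)

lemma additive_zero:
  assumes "abelian_group M" "abelian_group N" "h \<in> additive_maps M N"
  shows "h \<zero>\<^bsub>M\<^esub> = \<zero>\<^bsub>N\<^esub>"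
proof -
  have "h \<in> hom (add_monoid M) (add_monoid N)"
    using assms(3) by (subst additive_iff_hom[symmetric]) auto
  from hom_one[OF this abelian_group.a_group[OF assms(1)] abelian_group.a_group[OF assms(2)]]
  show ?thesis by simp
qed

lemma additive_finsum:
  assumes M: "abelian_group M" and N: "abelian_group N" and h: "h \<in> additive_maps M N"
    and f: "\<And>i. i \<in> I \<Longrightarrow> f i \<in> carrier M"
  shows "h (\<Oplus>\<^bsub>M\<^esub>i\<in>I. f i) = (\<Oplus>\<^bsub>N\<^esub>i\<in>I. h (f i))"
proof -
  interpret M: abelian_group M by (rule M)
  interpret N: abelian_group N by (rule N)
  show ?thesis
    using f
  proof (induction I rule: infinite_finite_induct)
    case (insert i I)
    then have "f \<in> I \<rightarrow> carrier M" "(\<lambda>i. h (f i)) \<in> I \<rightarrow> carrier N"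
      using additive_closed[OF h] by auto
    then show ?case
      using insert additive_closed[OF h] by (simp add: additive_add[OF h])
  qed (simp_all add: additive_zero[OF M N h])
qed

lemma additive_comp:
  "\<lbrakk>h \<in> additive_maps M N; g \<in> additive_maps N L\<rbrakk> \<Longrightarrow> (\<lambda>x. g (h x)) \<in> additive_maps M L"
  by (auto simp: additive_maps_def Pi_iff)

lemma additive_plus:
  assumes "abelian_group N" "h \<in> additive_maps M N" "g \<in> additive_maps M N"
  shows "(\<lambda>x. h x \<oplus>\<^bsub>N\<^esub> g x) \<in> additive_maps M N"
proof -
  interpret N: abelian_group N by fact
  show ?thesis
    using assms(2,3) by (auto intro!: additiveI simp: additive_closed additive_add N.a_ac)
qed

lemma (in abelian_monoid) finsum_lessThan_add:
  fixes m n :: nat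
  assumes "f \<in> {..<m + n} \<rightarrow> carrier G"
  shows "(\<Oplus>i\<in>{..<m + n}. f i) = (\<Oplus>i\<in>{..<m}. f i) \<oplus> (\<Oplus>i\<in>{..<n}. f (m + i))"
  using assms
proof (induction n)
  case (Suc n)
  then have "f \<in> {..<m + n} \<rightarrow> carrier G" "(\<lambda>i. f (m + i)) \<in> {..<n} \<rightarrow> carrier G" "f (m + n) \<in> carrier G"
    "f \<in> {..<m} \<rightarrow> carrier G"
    by auto
  then show ?case
    using Suc.IH by (simp add: lessThan_Suc a_lcomm)
qed simp

lemma (in abelian_monoid) finsum_swap:
  assumes "\<And>i j. \<lbrakk>i \<in> A; j \<in> B\<rbrakk> \<Longrightarrow> f i j \<in> carrier G" "finite B"
  shows "(\<Oplus>i\<in>A. \<Oplus>j\<in>B. f i j) = (\<Oplus>j\<in>B. \<Oplus>i\<in>A. f i j)"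
  using assms(1)
proof (induction A rule: infinite_finite_induct)
  case (insert a A)
  then have "(\<lambda>i. \<Oplus>j\<in>B. f i j) \<in> A \<rightarrow> carrier G" "f a \<in> B \<rightarrow> carrier G"
    "(\<lambda>j. \<Oplus>i\<in>A. f i j) \<in> B \<rightarrow> carrier G"
    by (auto intro!: finsum_closed)
  then have "(\<Oplus>i\<in>insert a A. \<Oplus>j\<in>B. f i j) = (\<Oplus>j\<in>B. f a j \<oplus> (\<Oplus>i\<in>A. f i j))"
    using insert by (simp add: finsum_addf)
  also have "\<dots> = (\<Oplus>j\<in>B. \<Oplus>i\<in>insert a A. f i j)"
    using insert by (intro finsum_cong'[OF refl, symmetric]) (auto simp: Pi_iff intro!: finsum_closed)
  finally show ?case .
qed simp_all

lemma abelian_group_of_comm_group: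
  assumes "comm_group G" "carrier M = carrier G" "add M = mult G" "zero M = one G"
  shows "abelian_group M"
proof -
  interpret G: comm_group G by fact
  show ?thesis
  proof (rule abelian_groupI)
    show "\<exists>y\<in>carrier M. y \<oplus>\<^bsub>M\<^esub> x = \<zero>\<^bsub>M\<^esub>" if "x \<in> carrier M" for x
      using that by (intro bexI[of _ "inv\<^bsub>G\<^esub> x"]) (auto simp: assms)
  qed (auto simp: assms G.m_assoc intro: G.m_comm)
qed

section \<open>Tensor products of two modules\<close>

locale tensor_product = M: abelian_group M + N: abelian_group N
  for A :: "('a, 'x) ring_scheme" and M :: "('m, 'y) ring_scheme" and \<rho> :: "'m \<Rightarrow> 'a \<Rightarrow> 'm"
    and N :: "('n, 'z) ring_scheme" and \<mu> :: "'a \<Rightarrow> 'n \<Rightarrow> 'n" +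
  assumes right_closed: "\<lbrakk>m \<in> carrier M; a \<in> carrier A\<rbrakk> \<Longrightarrow> \<rho> m a \<in> carrier M"
    and left_closed: "\<lbrakk>a \<in> carrier A; n \<in> carrier N\<rbrakk> \<Longrightarrow> \<mu> a n \<in> carrier N"
begin

sublocale presentation "carrier M \<times> carrier N"
  "{((m \<oplus>\<^bsub>M\<^esub> m', n), (m, n), (m', n)) | m m' n.
       m \<in> carrier M \<and> m' \<in> carrier M \<and> n \<in> carrier N} \<union>
    {((m, n \<oplus>\<^bsub>N\<^esub> n'), (m, n), (m, n')) | m n n'.
       m \<in> carrier M \<and> n \<in> carrier N \<and> n' \<in> carrier N}"
  "{((\<rho> m a, n), (m, \<mu> a n)) | m a n. m \<in> carrier M \<and> a \<in> carrier A \<and> n \<in> carrier N}"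
  "tensor_rels A M \<rho> N \<mu>"
proof (unfold_locales, goal_cases)
  case 1
  show ?case unfolding tensor_rels_def by auto
qed (auto simp: right_closed left_closed)

abbreviation tens where "tens \<equiv> pure_tensor A M \<rho> N \<mu>"

lemma tensor_group_eq: "tensor_group A M \<rho> N \<mu> = G"
  by (simp add: tensor_group_def)

lemma pure_closed: "\<lbrakk>m \<in> carrier M; n \<in> carrier N\<rbrakk> \<Longrightarrow> tens m n \<in> carrier G"
  unfolding pure_tensor_def by (rule gen_closed) simp

lemma pure_add_left:
  "\<lbrakk>m \<in> carrier M; m' \<in> carrier M; n \<in> carrier N\<rbrakk> \<Longrightarrow>
    tens (m \<oplus>\<^bsub>M\<^esub> m') n = tens m n \<otimes>\<^bsub>G\<^esub> tens m' n"
  unfolding pure_tensor_def by (rule gen_sum) blast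

lemma pure_add_right:
  "\<lbrakk>m \<in> carrier M; n \<in> carrier N; n' \<in> carrier N\<rbrakk> \<Longrightarrow>
    tens m (n \<oplus>\<^bsub>N\<^esub> n') = tens m n \<otimes>\<^bsub>G\<^esub> tens m n'"
  unfolding pure_tensor_def by (rule gen_sum) blast

lemma pure_balance:
  "\<lbrakk>m \<in> carrier M; a \<in> carrier A; n \<in> carrier N\<rbrakk> \<Longrightarrow> tens (\<rho> m a) n = tens m (\<mu> a n)"
  unfolding pure_tensor_def by (rule gen_eq) blast

lemma tensor_ext:
  assumes "group H" "h \<in> hom G H" "g \<in> hom G H"
    and "\<And>m n. \<lbrakk>m \<in> carrier M; n \<in> carrier N\<rbrakk> \<Longrightarrow> h (tens m n) = g (tens m n)"
    and "X \<in> carrier G"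
  shows "h X = g X"
  by (rule hom_eqI[OF assms(1-3) _ assms(5)]) (use assms(4) in \<open>auto simp: pure_tensor_def\<close>)

lemma tensor_lift:
  assumes L: "abelian_group L"
    and left: "\<And>n. n \<in> carrier N \<Longrightarrow> (\<lambda>m. f m n) \<in> additive_maps M L"
    and right: "\<And>m. m \<in> carrier M \<Longrightarrow> f m \<in> additive_maps N L"
    and bal: "\<And>m a n. \<lbrakk>m \<in> carrier M; a \<in> carrier A; n \<in> carrier N\<rbrakk> \<Longrightarrow> f (\<rho> m a) n = f m (\<mu> a n)"
  shows "induced (add_monoid L) (\<lambda>(m, n). f m n) \<in> hom G (add_monoid L)"
    and "\<lbrakk>m \<in> carrier M; n \<in> carrier N\<rbrakk> \<Longrightarrow> induced (add_monoid L) (\<lambda>(m, n). f m n) (tens m n) = f m n"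
proof -
  have c: "comm_group (add_monoid L)"
    using L by (rule abelian_group.a_comm_group)
  note lift = induced_lift[OF c, of "\<lambda>(m, n). f m n"]
  show "induced (add_monoid L) (\<lambda>(m, n). f m n) \<in> hom G (add_monoid L)"
    by (rule lift) (auto simp: additive_closed[OF left] additive_add[OF left] additive_add[OF right] bal)
  show "induced (add_monoid L) (\<lambda>(m, n). f m n) (tens m n) = f m n"
    if "m \<in> carrier M" "n \<in> carrier N"
    unfolding pure_tensor_def using that
    by (subst lift) (auto simp: additive_closed[OF left] additive_add[OF left] additive_add[OF right] bal)
qed

end

section \<open>Bimodules as modules over the enveloping algebra\<close>

definition env_pure ::
    "('k, 'x) ring_scheme \<Rightarrow> ('k, 'r, 'y) module_scheme \<Rightarrow> 'r \<Rightarrow> 'r \<Rightarrow> 'r env"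
  where "env_pure K R =
    pure_tensor K R (\<lambda>x k. k \<odot>\<^bsub>R\<^esub> x) (op_algebra R) (smult (op_algebra R))"

lemma op_algebra_simps [simp]:
  "carrier (op_algebra R) = carrier R" "add (op_algebra R) = add R"
  "zero (op_algebra R) = zero R" "smult (op_algebra R) = smult R"
  by (simp_all add: op_algebra_def)

context field_algebra
begin

lemma op_abelian_group: "abelian_group (op_algebra R)"
  by (rule comm_group_abelian_groupI) (simp add: R.a_comm_group)

sublocale env: tensor_product K R "\<lambda>x k. k \<odot>\<^bsub>R\<^esub> x" "op_algebra R" "smult (op_algebra R)"
  by (intro tensor_product.intro tensor_product_axioms.intro op_abelian_group R.abelian_group_axioms)
    auto

lemma carrier_env: "carrier (env_algebra K R) = carrier env.G"
  and add_env: "add (env_algebra K R) = mult env.G"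
  unfolding env_algebra_def algebra_tensor_def Let_def env.tensor_group_eq by simp_all

lemma env_pure_closed: "\<lbrakk>r \<in> carrier R; s \<in> carrier R\<rbrakk> \<Longrightarrow> env_pure K R r s \<in> carrier (env_algebra K R)"
  unfolding carrier_env env_pure_def by (rule env.pure_closed) simp_all

text \<open>The elements \<open>r \<otimes> s\<close> generate \<open>R\<^sup>e\<close> additively.\<close>

lemma env_ext:
  assumes "abelian_group L" "h \<in> additive_maps (env_algebra K R) L" "g \<in> additive_maps (env_algebra K R) L"
    and "\<And>r s. \<lbrakk>r \<in> carrier R; s \<in> carrier R\<rbrakk> \<Longrightarrow> h (env_pure K R r s) = g (env_pure K R r s)"
    and "X \<in> carrier (env_algebra K R)"
  shows "h X = g X"
proof (rule env.tensor_ext)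
  show "group (add_monoid L)"
    using assms(1) by (rule abelian_group.a_group)
qed (use assms in \<open>auto simp: carrier_env env_pure_def add_env additive_iff_hom[symmetric]
      additive_iff_hom[of env.G "env_algebra K R"]\<close>)

lemma env_lift:
  assumes L: "abelian_group L"
    and left: "\<And>s. s \<in> carrier R \<Longrightarrow> (\<lambda>r. f r s) \<in> additive_maps R L"
    and right: "\<And>r. r \<in> carrier R \<Longrightarrow> f r \<in> additive_maps R L"
    and bal: "\<And>k r s. \<lbrakk>k \<in> carrier K; r \<in> carrier R; s \<in> carrier R\<rbrakk> \<Longrightarrow>
      f (k \<odot>\<^bsub>R\<^esub> r) s = f r (k \<odot>\<^bsub>R\<^esub> s)"
  shows "induced (add_monoid L) (\<lambda>(r, s). f r s) \<in> additive_maps (env_algebra K R) L"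
    and "\<lbrakk>r \<in> carrier R; s \<in> carrier R\<rbrakk> \<Longrightarrow> induced (add_monoid L) (\<lambda>(r, s). f r s) (env_pure K R r s) = f r s"
proof -
  have op: "additive_maps (op_algebra R) L = additive_maps R L"
    by (simp add: additive_maps_def)
  note lift = env.tensor_lift[OF L, of f, unfolded op op_algebra_simps, OF left right bal]
  show "induced (add_monoid L) (\<lambda>(r, s). f r s) \<in> additive_maps (env_algebra K R) L"
    unfolding additive_iff_hom[OF carrier_env[symmetric] add_env[symmetric]] op_algebra_simps by (rule lift(1))
  show "\<lbrakk>r \<in> carrier R; s \<in> carrier R\<rbrakk> \<Longrightarrow> induced (add_monoid L) (\<lambda>(r, s). f r s) (env_pure K R r s) = f r s"
    unfolding env_pure_def op_algebra_simps by (rule lift(2))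
qed

end

context algebra_bimodule
begin

lemma lact_additive: "r \<in> carrier R \<Longrightarrow> (\<lambda>c. r \<odot>\<^bsub>C\<^esub> c) \<in> additive_maps C C"
  by (rule additiveI) (auto simp: lact_closed lact_add)

lemma ract_additive: "r \<in> carrier R \<Longrightarrow> (\<lambda>c. c \<odot>\<^sub>r\<^bsub>C\<^esub> r) \<in> additive_maps C C"
  by (rule additiveI) (auto simp: ract_closed ract_add)

lemma ground_closed: "k \<in> carrier K \<Longrightarrow> k \<odot>\<^bsub>R\<^esub> \<one>\<^bsub>R\<^esub> \<in> carrier R"
  by simp

lemma ground_mult_left: "\<lbrakk>k \<in> carrier K; r \<in> carrier R\<rbrakk> \<Longrightarrow> k \<odot>\<^bsub>R\<^esub> \<one>\<^bsub>R\<^esub> \<otimes>\<^bsub>R\<^esub> r = k \<odot>\<^bsub>R\<^esub> r"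
  by (simp add: smult_mult_left)

lemma ground_mult_right: "\<lbrakk>k \<in> carrier K; r \<in> carrier R\<rbrakk> \<Longrightarrow> r \<otimes>\<^bsub>R\<^esub> (k \<odot>\<^bsub>R\<^esub> \<one>\<^bsub>R\<^esub>) = k \<odot>\<^bsub>R\<^esub> r"
  by (simp add: smult_mult_right)

text \<open>The two sides of \<open>K\<close>-balancedness of \<open>(r, s) \<mapsto> r c s\<close>; this is where the agreement of
  the two actions of the ground field on the bimodule enters.\<close>

lemma ground_twosided:
  assumes "k \<in> carrier K" "r \<in> carrier R" "s \<in> carrier R" "c \<in> carrier C"
  shows "((k \<odot>\<^bsub>R\<^esub> r) \<odot>\<^bsub>C\<^esub> c) \<odot>\<^sub>r\<^bsub>C\<^esub> s = (r \<odot>\<^bsub>C\<^esub> c) \<odot>\<^sub>r\<^bsub>C\<^esub> (k \<odot>\<^bsub>R\<^esub> s)"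
proof -
  have "((k \<odot>\<^bsub>R\<^esub> r) \<odot>\<^bsub>C\<^esub> c) \<odot>\<^sub>r\<^bsub>C\<^esub> s = ((k \<odot>\<^bsub>R\<^esub> \<one>\<^bsub>R\<^esub>) \<odot>\<^bsub>C\<^esub> (r \<odot>\<^bsub>C\<^esub> c)) \<odot>\<^sub>r\<^bsub>C\<^esub> s"
    using assms by (subst ground_mult_left[symmetric]) (auto simp: mult_lact ground_closed)
  also have "\<dots> = ((r \<odot>\<^bsub>C\<^esub> c) \<odot>\<^sub>r\<^bsub>C\<^esub> (k \<odot>\<^bsub>R\<^esub> \<one>\<^bsub>R\<^esub>)) \<odot>\<^sub>r\<^bsub>C\<^esub> s"
    using assms by (simp add: ground_central lact_closed)
  also have "\<dots> = (r \<odot>\<^bsub>C\<^esub> c) \<odot>\<^sub>r\<^bsub>C\<^esub> (k \<odot>\<^bsub>R\<^esub> \<one>\<^bsub>R\<^esub> \<otimes>\<^bsub>R\<^esub> s)"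
    using assms by (simp add: mult_ract ground_closed lact_closed)
  finally show ?thesis
    using assms by (simp add: ground_mult_left)
qed

text \<open>A bimodule is a left \<open>R\<^sup>e\<close>-module by \<open>(r \<otimes> s) c = r c s\<close>, since \<open>(r, s) \<mapsto> r c s\<close> is biadditive
  and \<open>K\<close>-balanced.\<close>

lemma env_lact:
  assumes c: "c \<in> carrier C"
  shows env_lact_additive: "(\<lambda>X. env_lact C X c) \<in> additive_maps (env_algebra K R) C"
    and env_lact_pure: "\<lbrakk>r \<in> carrier R; s \<in> carrier R\<rbrakk> \<Longrightarrow> env_lact C (env_pure K R r s) c = (r \<odot>\<^bsub>C\<^esub> c) \<odot>\<^sub>r\<^bsub>C\<^esub> s"
  using env_lift[OF C.abelian_group_axioms, of "\<lambda>r s. (r \<odot>\<^bsub>C\<^esub> c) \<odot>\<^sub>r\<^bsub>C\<^esub> s"] c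
  by (auto simp: env_lact_def additive_maps_def lact_closed ract_closed add_lact ract_add add_ract lact_add
      ground_twosided)

lemma env_ract:
  assumes c: "c \<in> carrier C"
  shows env_ract_additive: "(\<lambda>X. env_ract C c X) \<in> additive_maps (env_algebra K R) C"
    and env_ract_pure: "\<lbrakk>r \<in> carrier R; s \<in> carrier R\<rbrakk> \<Longrightarrow> env_ract C c (env_pure K R r s) = (s \<odot>\<^bsub>C\<^esub> c) \<odot>\<^sub>r\<^bsub>C\<^esub> r"
  using env_lift[OF C.abelian_group_axioms, of "\<lambda>r s. (s \<odot>\<^bsub>C\<^esub> c) \<odot>\<^sub>r\<^bsub>C\<^esub> r"] c
  by (auto simp: env_ract_def additive_maps_def lact_closed ract_closed add_lact ract_add add_ract lact_add
      ground_twosided)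

end

locale env_tensor = left: algebra_bimodule K R C + right: algebra_bimodule K R M
  for K :: "('k, 'x) ring_scheme" and R :: "('k, 'r, 'y) module_scheme"
    and C :: "('r, 'c, 'z) bimodule_scheme" and M :: "('r, 'm, 'w) bimodule_scheme"
begin

sublocale tensor_product "env_algebra K R" C "env_ract C" M "env_lact M"
  by (intro tensor_product.intro tensor_product_axioms.intro
      left.C.abelian_group_axioms right.C.abelian_group_axioms)
    (auto intro: additive_closed[OF left.env_ract_additive] additive_closed[OF right.env_lact_additive])

lemma pure_twosided:
  assumes "r \<in> carrier R" "s \<in> carrier R" "c \<in> carrier C" "x \<in> carrier M"
  shows "tens ((s \<odot>\<^bsub>C\<^esub> c) \<odot>\<^sub>r\<^bsub>C\<^esub> r) x = tens c ((r \<odot>\<^bsub>M\<^esub> x) \<odot>\<^sub>r\<^bsub>M\<^esub> s)"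
  using pure_balance[OF assms(3) left.env_pure_closed assms(4), OF assms(1,2)] assms
  by (simp add: left.env_ract_pure right.env_lact_pure)

text \<open>Balancedness over \<open>R\<^sup>e\<close> needs to be checked on the elements \<open>r \<otimes> s\<close> only, because both
  sides are additive in the element of \<open>R\<^sup>e\<close>.\<close>

lemma env_tensor_lift:
  assumes L: "abelian_group L"
    and left: "\<And>x. x \<in> carrier M \<Longrightarrow> (\<lambda>c. f c x) \<in> additive_maps C L"
    and right: "\<And>c. c \<in> carrier C \<Longrightarrow> f c \<in> additive_maps M L"
    and bal: "\<And>r s c x. \<lbrakk>r \<in> carrier R; s \<in> carrier R; c \<in> carrier C; x \<in> carrier M\<rbrakk> \<Longrightarrow>
      f ((s \<odot>\<^bsub>C\<^esub> c) \<odot>\<^sub>r\<^bsub>C\<^esub> r) x = f c ((r \<odot>\<^bsub>M\<^esub> x) \<odot>\<^sub>r\<^bsub>M\<^esub> s)"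
  shows "induced (add_monoid L) (\<lambda>(c, x). f c x) \<in> hom G (add_monoid L)"
    and "\<lbrakk>c \<in> carrier C; x \<in> carrier M\<rbrakk> \<Longrightarrow> induced (add_monoid L) (\<lambda>(c, x). f c x) (tens c x) = f c x"
proof -
  have bal': "f (env_ract C c X) x = f c (env_lact M X x)"
    if "c \<in> carrier C" "X \<in> carrier (env_algebra K R)" "x \<in> carrier M" for c X x
    using L additive_comp[OF left.env_ract_additive[OF that(1)] left[OF that(3)]]
      additive_comp[OF right.env_lact_additive[OF that(3)] right[OF that(1)]] _ that(2)
    by (rule left.env_ext) (use that in \<open>auto simp: left.env_ract_pure right.env_lact_pure bal\<close>)
  show "induced (add_monoid L) (\<lambda>(c, x). f c x) \<in> hom G (add_monoid L)"
    by (rule tensor_lift[OF L left right bal'])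
  show "\<lbrakk>c \<in> carrier C; x \<in> carrier M\<rbrakk> \<Longrightarrow> induced (add_monoid L) (\<lambda>(c, x). f c x) (tens c x) = f c x"
    by (rule tensor_lift[OF L left right bal'])
qed

end

section \<open>Tensor powers of a bimodule\<close>

definition balanced ::
    "('r, 'x) ring_scheme \<Rightarrow> ('r, 'c, 'z) bimodule_scheme \<Rightarrow> ('n, 'w) ring_scheme \<Rightarrow> nat \<Rightarrow>
     ('c list \<Rightarrow> 'n) \<Rightarrow> bool"
  where "balanced R C N n f \<longleftrightarrow>
    (\<forall>cs\<in>tpow_gens C n. f cs \<in> carrier N) \<and>
    (\<forall>us x y vs. us @ x # vs \<in> tpow_gens C n \<longrightarrow> y \<in> carrier C \<longrightarrow>
       f (us @ (x \<oplus>\<^bsub>C\<^esub> y) # vs) = f (us @ x # vs) \<oplus>\<^bsub>N\<^esub> f (us @ y # vs)) \<and>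
    (\<forall>us x r y vs. us @ x # y # vs \<in> tpow_gens C n \<longrightarrow> r \<in> carrier R \<longrightarrow>
       f (us @ (x \<odot>\<^sub>r\<^bsub>C\<^esub> r) # y # vs) = f (us @ x # (r \<odot>\<^bsub>C\<^esub> y) # vs))"

lemma tpow_gens_Cons [simp]:
  "c # cs \<in> tpow_gens C (Suc n) \<longleftrightarrow> c \<in> carrier C \<and> cs \<in> tpow_gens C n"
  by (auto simp: tpow_gens_def)

lemma tpow_gens_Nil [simp]: "[] \<in> tpow_gens C n \<longleftrightarrow> n = 0"
  by (auto simp: tpow_gens_def)

lemma tpow_gens_0 [simp]: "cs \<in> tpow_gens C 0 \<longleftrightarrow> cs = []"
  by (auto simp: tpow_gens_def)

lemma tpow_gens_append:
  "us @ vs \<in> tpow_gens C n \<longleftrightarrow>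
    length us + length vs = n \<and> set us \<subseteq> carrier C \<and> set vs \<subseteq> carrier C"
  by (auto simp: tpow_gens_def)

lemma balanced_closed: "\<lbrakk>balanced R C N n f; cs \<in> tpow_gens C n\<rbrakk> \<Longrightarrow> f cs \<in> carrier N"
  by (simp add: balanced_def)

lemma balanced_add:
  "\<lbrakk>balanced R C N n f; us @ x # vs \<in> tpow_gens C n; y \<in> carrier C\<rbrakk> \<Longrightarrow>
    f (us @ (x \<oplus>\<^bsub>C\<^esub> y) # vs) = f (us @ x # vs) \<oplus>\<^bsub>N\<^esub> f (us @ y # vs)"
  by (simp add: balanced_def)

lemma balanced_swap:
  "\<lbrakk>balanced R C N n f; us @ x # y # vs \<in> tpow_gens C n; r \<in> carrier R\<rbrakk> \<Longrightarrow>
    f (us @ (x \<odot>\<^sub>r\<^bsub>C\<^esub> r) # y # vs) = f (us @ x # (r \<odot>\<^bsub>C\<^esub> y) # vs)"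
  by (simp add: balanced_def)

lemma balancedI:
  assumes "\<And>cs. cs \<in> tpow_gens C n \<Longrightarrow> f cs \<in> carrier N"
    and "\<And>us x y vs. \<lbrakk>us @ x # vs \<in> tpow_gens C n; us @ y # vs \<in> tpow_gens C n; y \<in> carrier C\<rbrakk> \<Longrightarrow>
       f (us @ (x \<oplus>\<^bsub>C\<^esub> y) # vs) = f (us @ x # vs) \<oplus>\<^bsub>N\<^esub> f (us @ y # vs)"
    and "\<And>us x r y vs. \<lbrakk>us @ x # y # vs \<in> tpow_gens C n; r \<in> carrier R\<rbrakk> \<Longrightarrow>
       f (us @ (x \<odot>\<^sub>r\<^bsub>C\<^esub> r) # y # vs) = f (us @ x # (r \<odot>\<^bsub>C\<^esub> y) # vs)"
  shows "balanced R C N n f"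
proof -
  have "us @ y # vs \<in> tpow_gens C n" if "us @ x # vs \<in> tpow_gens C n" "y \<in> carrier C"
    for us x y vs
    using that by (auto simp: tpow_gens_append)
  then show ?thesis
    unfolding balanced_def using assms by blast
qed

text \<open>For a fixed first letter balancedness is a statement about shorter lists, which can be taken
  from known functions; only the relations at the first letter have to be checked by hand.\<close>

lemma balanced_ConsI:
  assumes tail: "\<And>c. c \<in> carrier C \<Longrightarrow> balanced R C N n (\<lambda>cs. f (c # cs))"
    and add: "\<And>x y vs. \<lbrakk>x \<in> carrier C; y \<in> carrier C; vs \<in> tpow_gens C n\<rbrakk> \<Longrightarrow>
      f ((x \<oplus>\<^bsub>C\<^esub> y) # vs) = f (x # vs) \<oplus>\<^bsub>N\<^esub> f (y # vs)"
    and swap: "\<And>x r y vs. \<lbrakk>x \<in> carrier C; y # vs \<in> tpow_gens C n; r \<in> carrier R\<rbrakk> \<Longrightarrow>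
      f ((x \<odot>\<^sub>r\<^bsub>C\<^esub> r) # y # vs) = f (x # (r \<odot>\<^bsub>C\<^esub> y) # vs)"
  shows "balanced R C N (Suc n) f"
proof (rule balancedI)
  show "f cs \<in> carrier N" if "cs \<in> tpow_gens C (Suc n)" for cs
    using that balanced_closed[OF tail] by (cases cs) auto
  show "f (us @ (x \<oplus>\<^bsub>C\<^esub> y) # vs) = f (us @ x # vs) \<oplus>\<^bsub>N\<^esub> f (us @ y # vs)"
    if "us @ x # vs \<in> tpow_gens C (Suc n)" "y \<in> carrier C" for us x y vs
    using that add balanced_add[OF tail] by (cases us) auto
  show "f (us @ (x \<odot>\<^sub>r\<^bsub>C\<^esub> r) # y # vs) = f (us @ x # (r \<odot>\<^bsub>C\<^esub> y) # vs)"
    if "us @ x # y # vs \<in> tpow_gens C (Suc n)" "r \<in> carrier R" for us x r y vs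
    using that swap balanced_swap[OF tail] by (cases us) auto
qed

lemma balanced_comp:
  assumes h: "h \<in> additive_maps M N" and f: "balanced R C M n f"
  shows "balanced R C N n (\<lambda>cs. h (f cs))"
  by (rule balancedI)
    (simp_all add: balanced_add[OF f] balanced_swap[OF f] balanced_closed[OF f]
      additive_add[OF h] additive_closed[OF h])

text \<open>Fixing some of the outer factors of a balanced function leaves a balanced function
  of the others.  With two or three free factors this feeds \<open>\<Delta>(c)\<close> and its iterates into a word.\<close>

lemma balanced_context:
  assumes f: "balanced R C N n f" and "length ws + m + length zs = n"
    and "set ws \<subseteq> carrier C" "set zs \<subseteq> carrier C"
  shows "balanced R C N m (\<lambda>cs. f (ws @ cs @ zs))"
proof (rule balancedI)
  show "f (ws @ cs @ zs) \<in> carrier N" if "cs \<in> tpow_gens C m" for cs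
    using that assms by (intro balanced_closed[OF f]) (auto simp: tpow_gens_def)
  show "f (ws @ (us @ (x \<oplus>\<^bsub>C\<^esub> y) # vs) @ zs) = f (ws @ (us @ x # vs) @ zs) \<oplus>\<^bsub>N\<^esub> f (ws @ (us @ y # vs) @ zs)"
    if "us @ x # vs \<in> tpow_gens C m" "y \<in> carrier C" for us x y vs
    using that assms balanced_add[OF f, of "ws @ us" x "vs @ zs" y] by (simp add: tpow_gens_def)
  show "f (ws @ (us @ (x \<odot>\<^sub>r\<^bsub>C\<^esub> r) # y # vs) @ zs) = f (ws @ (us @ x # (r \<odot>\<^bsub>C\<^esub> y) # vs) @ zs)"
    if "us @ x # y # vs \<in> tpow_gens C m" "r \<in> carrier R" for us x r y vs
    using that assms balanced_swap[OF f, of "ws @ us" x y "vs @ zs" r] by (simp add: tpow_gens_def)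
qed

text \<open>The locale only fixes notation, which is kept apart from other bimodules over \<open>R\<close>, such as
  the tensor powers.\<close>

locale word_bimodule = algebra_bimodule K R C
  for K :: "('k, 'x) ring_scheme"
    and R :: "('k, 'r, 'y) module_scheme"
    and C :: "('r, 'c, 'z) bimodule_scheme"
begin

abbreviation left_action (infixl \<open>\<bullet>\<close> 70) where "r \<bullet> c \<equiv> r \<odot>\<^bsub>C\<^esub> c"
abbreviation right_action (infixl \<open>\<star>\<close> 70) where "c \<star> r \<equiv> c \<odot>\<^sub>r\<^bsub>C\<^esub> r"
abbreviation gens where "gens \<equiv> tpow_gens C"
abbreviation Ch where "Ch \<equiv> cochains K R C"
abbreviation tensor where "tensor \<equiv> cochain_tensor K R C"

abbreviation tpow_sums where
  "tpow_sums n \<equiv> {(us @ [x \<oplus>\<^bsub>C\<^esub> y] @ vs, us @ [x] @ vs, us @ [y] @ vs) | us x y vs.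
     us @ [x] @ vs \<in> gens n \<and> y \<in> carrier C}"

abbreviation tpow_eqs where
  "tpow_eqs n \<equiv> {(us @ [x \<star> r, y] @ vs, us @ [x, r \<bullet> y] @ vs) | us x r y vs.
     us @ [x, y] @ vs \<in> gens n \<and> r \<in> carrier R}"

lemma tpow_presentation:
  "presentation (gens n) (tpow_sums n) (tpow_eqs n) (tpow_rels R C n)"
proof (unfold_locales, goal_cases)
  case 1
  show ?case unfolding tpow_rels_def by auto
qed (auto simp: tpow_gens_def lact_closed ract_closed)

lemma tpow_simps:
  "carrier (tpow R C n) = carrier (pres_group (gens n) (tpow_rels R C n))"
  "add (tpow R C n) = mult (pres_group (gens n) (tpow_rels R C n))"
  "zero (tpow R C n) = one (pres_group (gens n) (tpow_rels R C n))"
  by (simp_all add: tpow_def Let_def)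

lemma tpow_abelian_group: "abelian_group (tpow R C n)"
proof -
  interpret presentation "gens n" "tpow_sums n" "tpow_eqs n" "tpow_rels R C n"
    by (rule tpow_presentation)
  show ?thesis
    by (rule abelian_group_of_comm_group[OF G.comm_group_axioms]) (simp_all add: tpow_simps)
qed

lemma tprod_eq: "cs \<in> gens n \<Longrightarrow> tprod R C cs = gen_class (gens n) (tpow_rels R C n) cs"
  by (simp add: tprod_def tpow_gens_def)

lemma tprod_closed: "cs \<in> gens n \<Longrightarrow> tprod R C cs \<in> carrier (tpow R C n)"
  by (simp add: tprod_eq tpow_simps presentation.gen_closed[OF tpow_presentation])

lemma tprod_balanced: "balanced R C (tpow R C n) n (tprod R C)"
proof -
  interpret presentation "gens n" "tpow_sums n" "tpow_eqs n" "tpow_rels R C n"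
    by (rule tpow_presentation)
  show ?thesis
  proof (rule balancedI)
    fix us x y vs
    assume xy: "us @ x # vs \<in> gens n" "us @ y # vs \<in> gens n" "y \<in> carrier C"
    then have xy': "us @ (x \<oplus>\<^bsub>C\<^esub> y) # vs \<in> gens n"
      by (auto simp: tpow_gens_def)
    have "gen (us @ [x \<oplus>\<^bsub>C\<^esub> y] @ vs) = gen (us @ [x] @ vs) \<otimes>\<^bsub>G\<^esub> gen (us @ [y] @ vs)"
      by (rule gen_sum) (use xy in fastforce)
    then show "tprod R C (us @ (x \<oplus>\<^bsub>C\<^esub> y) # vs) =
        tprod R C (us @ x # vs) \<oplus>\<^bsub>tpow R C n\<^esub> tprod R C (us @ y # vs)"
      using xy xy' by (simp add: tprod_eq tpow_simps)
  next
    fix us x r y vs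
    assume xy: "us @ x # y # vs \<in> gens n" "r \<in> carrier R"
    then have xy': "us @ (x \<star> r) # y # vs \<in> gens n" "us @ x # (r \<bullet> y) # vs \<in> gens n"
      by (auto simp: tpow_gens_def lact_closed ract_closed)
    have "gen (us @ [x \<star> r, y] @ vs) = gen (us @ [x, r \<bullet> y] @ vs)"
      by (rule gen_eq) (use xy in fastforce)
    then show "tprod R C (us @ (x \<star> r) # y # vs) = tprod R C (us @ x # (r \<bullet> y) # vs)"
      using xy' by (simp add: tprod_eq)
  qed (rule tprod_closed)
qed

text \<open>Pure tensors generate the tensor power.\<close>

lemma tpow_ext:
  assumes "abelian_group N" "h \<in> additive_maps (tpow R C n) N" "g \<in> additive_maps (tpow R C n) N"
    and "\<And>cs. cs \<in> gens n \<Longrightarrow> h (tprod R C cs) = g (tprod R C cs)"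
    and "X \<in> carrier (tpow R C n)"
  shows "h X = g X"
  by (rule presentation.hom_eqI[OF tpow_presentation, of "add_monoid N" _ n])
    (use assms in \<open>auto simp: tprod_eq tpow_simps abelian_group.a_group additive_iff_hom[symmetric]
        additive_iff_hom[of "pres_group (gens n) (tpow_rels R C n)" "tpow R C n"]\<close>)

lemma tpow_lift:
  assumes N: "abelian_group N" and f: "balanced R C N n f"
  shows tpow_lift_additive: "induced (add_monoid N) f \<in> additive_maps (tpow R C n) N"
    and tpow_lift_tprod: "cs \<in> gens n \<Longrightarrow> induced (add_monoid N) f (tprod R C cs) = f cs"
proof -
  note lift = presentation.induced_lift[OF tpow_presentation[of n] abelian_group.a_comm_group[OF N], of f]
  show "induced (add_monoid N) f \<in> additive_maps (tpow R C n) N"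
    unfolding additive_iff_hom[OF tpow_simps(1,2)[symmetric]]
    by (rule lift) (auto simp: balanced_closed[OF f] balanced_add[OF f] balanced_swap[OF f])
  show "induced (add_monoid N) f (tprod R C cs) = f cs" if "cs \<in> gens n"
    unfolding tprod_eq[OF that]
    by (rule lift) (auto simp: that balanced_closed[OF f] balanced_add[OF f] balanced_swap[OF f])
qed

lemma balanced_cong:
  assumes g: "balanced R C N n g" and eq: "\<And>cs. cs \<in> gens n \<Longrightarrow> f cs = g cs"
  shows "balanced R C N n f"
proof (rule balancedI)
  show "f cs \<in> carrier N" if "cs \<in> gens n" for cs
    using that balanced_closed[OF g] eq by simp
next
  fix us x y vs
  assume xy: "us @ x # vs \<in> gens n" "us @ y # vs \<in> gens n" "y \<in> carrier C"
  then have "us @ (x \<oplus>\<^bsub>C\<^esub> y) # vs \<in> gens n"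
    by (auto simp: tpow_gens_def)
  then show "f (us @ (x \<oplus>\<^bsub>C\<^esub> y) # vs) = f (us @ x # vs) \<oplus>\<^bsub>N\<^esub> f (us @ y # vs)"
    using xy by (simp add: eq balanced_add[OF g])
next
  fix us x r y vs
  assume xy: "us @ x # y # vs \<in> gens n" and r: "r \<in> carrier R"
  then have "us @ (x \<star> r) # y # vs \<in> gens n" "us @ x # (r \<bullet> y) # vs \<in> gens n"
    by (auto simp: tpow_gens_def lact_closed ract_closed)
  then show "f (us @ (x \<star> r) # y # vs) = f (us @ x # (r \<bullet> y) # vs)"
    using xy r by (simp add: eq balanced_swap[OF g])
qed

lemma balanced_finsum:
  assumes "abelian_group N" and f: "\<And>i. i \<in> I \<Longrightarrow> balanced R C N n (f i)"
  shows "balanced R C N n (\<lambda>cs. \<Oplus>\<^bsub>N\<^esub>i\<in>I. f i cs)"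
proof -
  interpret N: abelian_group N by fact
  show ?thesis
  proof (rule balancedI)
    show "(\<Oplus>\<^bsub>N\<^esub>i\<in>I. f i cs) \<in> carrier N" if "cs \<in> gens n" for cs
      using balanced_closed[OF f that] by (intro N.finsum_closed) simp
  next
    fix us x y vs
    assume xy: "us @ x # vs \<in> gens n" "us @ y # vs \<in> gens n" "y \<in> carrier C"
    have "(\<Oplus>\<^bsub>N\<^esub>i\<in>I. f i (us @ (x \<oplus>\<^bsub>C\<^esub> y) # vs)) = (\<Oplus>\<^bsub>N\<^esub>i\<in>I. f i (us @ x # vs) \<oplus>\<^bsub>N\<^esub> f i (us @ y # vs))"
      using xy balanced_closed[OF f] by (intro N.finsum_cong') (simp_all add: balanced_add[OF f])
    then show "(\<Oplus>\<^bsub>N\<^esub>i\<in>I. f i (us @ (x \<oplus>\<^bsub>C\<^esub> y) # vs)) =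
        (\<Oplus>\<^bsub>N\<^esub>i\<in>I. f i (us @ x # vs)) \<oplus>\<^bsub>N\<^esub> (\<Oplus>\<^bsub>N\<^esub>i\<in>I. f i (us @ y # vs))"
      using xy balanced_closed[OF f] by (simp add: N.finsum_addf)
  next
    fix us x r y vs
    assume xy: "us @ x # y # vs \<in> gens n" and r: "r \<in> carrier R"
    have "us @ x # (r \<bullet> y) # vs \<in> gens n"
      using xy r by (auto simp: tpow_gens_def lact_closed)
    then show "(\<Oplus>\<^bsub>N\<^esub>i\<in>I. f i (us @ (x \<star> r) # y # vs)) = (\<Oplus>\<^bsub>N\<^esub>i\<in>I. f i (us @ x # (r \<bullet> y) # vs))"
      using xy r balanced_closed[OF f] by (intro N.finsum_cong') (simp_all add: balanced_swap[OF f])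
  qed
qed

text \<open>Acting on the first factor from the left does not interfere with the balancing, by the
  compatibility of left and right action; so the action descends to the tensor power.\<close>

lemma balanced_lact:
  assumes f: "balanced R C N (Suc n) f" and r: "r \<in> carrier R"
  shows "balanced R C N (Suc n) (\<lambda>cs. f ((r \<bullet> hd cs) # tl cs))"
proof (rule balanced_ConsI)
  show "balanced R C N n (\<lambda>cs. f ((r \<bullet> hd (c # cs)) # tl (c # cs)))" if "c \<in> carrier C" for c
    using balanced_context[OF f, of "[r \<bullet> c]" n "[]"] that r by (simp add: lact_closed)
qed (use r balanced_add[OF f, of "[]"] balanced_swap[OF f, of "[]"] in
    \<open>simp_all add: lact_closed ract_closed lact_add lact_ract[symmetric]\<close>)

lemma balanced_ract:
  assumes f: "balanced R C N (Suc n) f" and r: "r \<in> carrier R"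
  shows "balanced R C N (Suc n) (\<lambda>cs. f (butlast cs @ [last cs \<star> r]))"
proof (rule balancedI)
  show "f (butlast cs @ [last cs \<star> r]) \<in> carrier N" if "cs \<in> gens (Suc n)" for cs
    using that r by (cases cs rule: rev_cases) (auto simp: tpow_gens_append intro!: balanced_closed[OF f] ract_closed)
next
  fix us x y vs
  assume xy: "us @ x # vs \<in> gens (Suc n)" "y \<in> carrier C"
  show "f (butlast (us @ (x \<oplus>\<^bsub>C\<^esub> y) # vs) @ [last (us @ (x \<oplus>\<^bsub>C\<^esub> y) # vs) \<star> r]) =
      f (butlast (us @ x # vs) @ [last (us @ x # vs) \<star> r]) \<oplus>\<^bsub>N\<^esub>
      f (butlast (us @ y # vs) @ [last (us @ y # vs) \<star> r])"
  proof (cases vs rule: rev_cases)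
    case Nil
    then show ?thesis
      using xy r balanced_add[OF f, of us "x \<star> r" "[]" "y \<star> r"]
      by (simp add: ract_closed ract_add tpow_gens_append butlast_append)
  next
    case (snoc vs' v)
    then show ?thesis
      using xy r balanced_add[OF f, of us x "vs' @ [v \<star> r]" y]
      by (simp add: ract_closed tpow_gens_append butlast_append)
  qed
next
  fix us x s y vs
  assume xy: "us @ x # y # vs \<in> gens (Suc n)" and s: "s \<in> carrier R"
  show "f (butlast (us @ (x \<star> s) # y # vs) @ [last (us @ (x \<star> s) # y # vs) \<star> r]) =
      f (butlast (us @ x # (s \<bullet> y) # vs) @ [last (us @ x # (s \<bullet> y) # vs) \<star> r])"
  proof (cases vs rule: rev_cases)
    case Nil
    then show ?thesis
      using xy r s balanced_swap[OF f, of us x "y \<star> r" "[]" s]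
      by (simp add: ract_closed lact_ract tpow_gens_append butlast_append)
  next
    case (snoc vs' v)
    then show ?thesis
      using xy r s balanced_swap[OF f, of us x y "vs' @ [v \<star> r]" s]
      by (simp add: ract_closed tpow_gens_append butlast_append)
  qed
qed

lemma tpow_smult_eq:
  "smult (tpow R C n) r = induced (add_monoid (tpow R C n)) (\<lambda>cs. tprod R C ((r \<bullet> hd cs) # tl cs))"
  "(\<lambda>X. rsmult (tpow R C n) X r) =
    induced (add_monoid (tpow R C n)) (\<lambda>cs. tprod R C (butlast cs @ [last cs \<star> r]))"
  by (simp_all add: tpow_def Let_def cong: induced_cong)

lemma tpow_lact:
  assumes r: "r \<in> carrier R"
  shows tpow_lact_additive: "smult (tpow R C (Suc n)) r \<in> additive_maps (tpow R C (Suc n)) (tpow R C (Suc n))"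
    and tprod_lact: "c # cs \<in> gens (Suc n) \<Longrightarrow>
      r \<odot>\<^bsub>tpow R C (Suc n)\<^esub> tprod R C (c # cs) = tprod R C ((r \<bullet> c) # cs)"
  using tpow_lift[OF tpow_abelian_group balanced_lact[OF tprod_balanced r, of n]]
  by (fastforce simp: tpow_smult_eq)+

lemma tpow_ract:
  assumes r: "r \<in> carrier R"
  shows tpow_ract_additive:
      "(\<lambda>X. rsmult (tpow R C (Suc n)) X r) \<in> additive_maps (tpow R C (Suc n)) (tpow R C (Suc n))"
    and tprod_ract: "cs @ [c] \<in> gens (Suc n) \<Longrightarrow>
      tprod R C (cs @ [c]) \<odot>\<^sub>r\<^bsub>tpow R C (Suc n)\<^esub> r = tprod R C (cs @ [c \<star> r])"
proof -
  note lift = tpow_lift[OF tpow_abelian_group balanced_ract[OF tprod_balanced r, of n]]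
  show "(\<lambda>X. rsmult (tpow R C (Suc n)) X r) \<in> additive_maps (tpow R C (Suc n)) (tpow R C (Suc n))"
    unfolding tpow_smult_eq by (rule lift)
  show "tprod R C (cs @ [c]) \<odot>\<^sub>r\<^bsub>tpow R C (Suc n)\<^esub> r = tprod R C (cs @ [c \<star> r])"
    if "cs @ [c] \<in> gens (Suc n)"
    using lift(2)[OF that] by (simp flip: tpow_smult_eq(2))
qed

text \<open>Scalars from the ground field move freely along a tensor: such a scalar is central in
  \<open>R\<close> and acts on either side of a factor in the same way.\<close>

lemma balanced_ground_shift:
  assumes f: "balanced R C N n f" and k: "k \<in> carrier K" and cs: "c # us @ d # vs \<in> gens n"
  shows "f (((k \<odot>\<^bsub>R\<^esub> \<one>\<^bsub>R\<^esub>) \<bullet> c) # us @ d # vs) = f (c # us @ ((k \<odot>\<^bsub>R\<^esub> \<one>\<^bsub>R\<^esub>) \<bullet> d) # vs)"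
  using cs
proof (induction us arbitrary: d vs rule: rev_induct)
  case Nil
  then show ?case
    using balanced_swap[OF f, of "[]" c d vs "k \<odot>\<^bsub>R\<^esub> \<one>\<^bsub>R\<^esub>"] k
    by (cases n) (auto simp: ground_central)
next
  case (snoc u us)
  then have "u \<in> carrier C"
    by (auto simp: tpow_gens_def)
  then show ?case
    using snoc.prems snoc.IH[of u "d # vs"] k
      balanced_swap[OF f, of "c # us" u d vs "k \<odot>\<^bsub>R\<^esub> \<one>\<^bsub>R\<^esub>"]
    by (simp add: ground_central)
qed

text \<open>Each bimodule law is an equation of additive maps, hence can be checked on pure
  tensors, where it reduces to the same law in the first or the last factor.  The commutation of the
  two actions distinguishes whether these factors coincide.\<close>

lemma tpow_bimodule: "algebra_bimodule K R (tpow R C (Suc n))"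
proof -
  let ?T = "tpow R C (Suc n)"
  interpret T: abelian_group ?T by (rule tpow_abelian_group)
  note lact = tpow_lact_additive[of _ n] and ract = tpow_ract_additive[of _ n]
  note T = tpow_abelian_group[of "Suc n"]
  have id: "(\<lambda>X. X) \<in> additive_maps ?T ?T"
    by (rule additiveI) simp_all
  have gens_cases: "\<exists>c ds. cs = c # ds \<and> c \<in> carrier C \<and> ds \<in> gens n" 
    if "cs \<in> gens (Suc n)" for cs
    using that by (cases cs) auto
  have gens_rcases: "\<exists>c ds. cs = ds @ [c] \<and> c \<in> carrier C \<and> ds \<in> gens n" 
    if "cs \<in> gens (Suc n)" for cs
    using that by (cases cs rule: rev_cases) (auto simp: tpow_gens_def)
  have snoc: "ds @ [c] \<in> gens (Suc n) \<longleftrightarrow> c \<in> carrier C \<and> ds \<in> gens n" for ds c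
    by (auto simp: tpow_gens_def)
  show ?thesis
  proof (unfold_locales, goal_cases)
    case (1 r X)
    then show ?case by (intro additive_closed[OF lact])
  next
    case (2 r X)
    then show ?case by (intro additive_closed[OF ract])
  next
    case (3 r X Y)
    then show ?case by (intro additive_add[OF lact])
  next
    case (4 r s X)
    have rs: "r \<oplus>\<^bsub>R\<^esub> s \<in> carrier R" using 4 by simp
    show ?case
      by (rule tpow_ext[OF T lact[OF rs] additive_plus[OF T lact[OF 4(1)] lact[OF 4(2)]] _ 4(3)])
        (use 4 rs balanced_add[OF tprod_balanced, of "[]" _ _ "Suc n"] in
          \<open>auto dest!: gens_cases simp: tprod_lact add_lact lact_closed\<close>)
  next
    case (5 r s X)
    have rs: "r \<otimes>\<^bsub>R\<^esub> s \<in> carrier R" using 5 by simp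
    show ?case
      by (rule tpow_ext[OF T lact[OF rs] additive_comp[OF lact[OF 5(2)] lact[OF 5(1)]] _ 5(3)])
        (use 5 rs in \<open>auto dest!: gens_cases simp: tprod_lact mult_lact lact_closed\<close>)
  next
    case (6 X)
    show ?case
      by (rule tpow_ext[OF T lact[OF R.one_closed] id _ 6])
        (auto dest!: gens_cases simp: tprod_lact one_lact)
  next
    case (7 r X Y)
    then show ?case by (intro additive_add[OF ract])
  next
    case (8 r s X)
    have rs: "r \<oplus>\<^bsub>R\<^esub> s \<in> carrier R" using 8 by simp
    show ?case
      by (rule tpow_ext[OF T ract[OF rs] additive_plus[OF T ract[OF 8(1)] ract[OF 8(2)]] _ 8(3)])
        (use 8 rs balanced_add[OF tprod_balanced, of _ _ "[]" "Suc n"] in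
          \<open>auto dest!: gens_rcases simp: tprod_ract add_ract ract_closed snoc\<close>)
  next
    case (9 r s X)
    have rs: "r \<otimes>\<^bsub>R\<^esub> s \<in> carrier R" using 9 by simp
    show ?case
      by (rule tpow_ext[OF T ract[OF rs] additive_comp[OF ract[OF 9(1)] ract[OF 9(2)]] _ 9(3)])
        (use 9 rs in \<open>auto dest!: gens_rcases simp: tprod_ract mult_ract ract_closed snoc\<close>)
  next
    case (10 X)
    show ?case
      by (rule tpow_ext[OF T ract[OF R.one_closed] id _ 10])
        (auto dest!: gens_rcases simp: tprod_ract one_ract snoc)
  next
    case (11 r s X)
    show ?case
    proof (rule tpow_ext[OF T additive_comp[OF lact[OF 11(1)] ract[OF 11(2)]]
          additive_comp[OF ract[OF 11(2)] lact[OF 11(1)]] _ 11(3)])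
      fix cs assume "cs \<in> gens (Suc n)"
      then obtain c ds where cs: "cs = c # ds" "c \<in> carrier C" "ds \<in> gens n"
        using gens_cases by blast
      show "(r \<odot>\<^bsub>?T\<^esub> tprod R C cs) \<odot>\<^sub>r\<^bsub>?T\<^esub> s = r \<odot>\<^bsub>?T\<^esub> (tprod R C cs \<odot>\<^sub>r\<^bsub>?T\<^esub> s)"
      proof (cases ds rule: rev_cases)
        case Nil
        then show ?thesis
          using cs 11 tprod_ract[OF 11(2), of "[]" "r \<bullet> c" n] tprod_ract[OF 11(2), of "[]" c n]
          by (simp add: tprod_lact lact_closed ract_closed lact_ract)
      next
        case (snoc es d)
        then have "es @ [d] \<in> gens n" "es @ [d \<star> s] \<in> gens n"
          using cs 11 by (auto simp: tpow_gens_def ract_closed)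
        then show ?thesis
          using snoc cs 11 tprod_ract[OF 11(2), of "(r \<bullet> c) # es" d n]
            tprod_ract[OF 11(2), of "c # es" d n]
          by (simp add: tprod_lact lact_closed)
      qed
    qed
  next
    case (12 k X)
    note k1 = ground_closed[OF 12(1)]
    show ?case
    proof (rule tpow_ext[OF T lact[OF k1] ract[OF k1] _ 12(2)])
      fix cs assume "cs \<in> gens (Suc n)"
      then obtain c ds where cs: "cs = c # ds" "c \<in> carrier C" "ds \<in> gens n"
        using gens_cases by blast
      show "(k \<odot>\<^bsub>R\<^esub> \<one>\<^bsub>R\<^esub>) \<odot>\<^bsub>?T\<^esub> tprod R C cs = tprod R C cs \<odot>\<^sub>r\<^bsub>?T\<^esub> (k \<odot>\<^bsub>R\<^esub> \<one>\<^bsub>R\<^esub>)"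
      proof (cases ds rule: rev_cases)
        case Nil
        then show ?thesis
          using cs k1 12(1) tprod_ract[OF k1, of "[]" c n]
          by (simp add: tprod_lact ground_central)
      next
        case (snoc es d)
        then have d: "d \<in> carrier C"
          using cs by (auto simp: tpow_gens_def)
        show ?thesis
          using snoc cs k1 12(1) d tprod_ract[OF k1, of "c # es" d n]
            balanced_ground_shift[OF tprod_balanced 12(1), of c es d "[]" "Suc n"]
          by (simp add: tprod_lact ground_central)
      qed
    qed
  qed
qed

end

section \<open>Cochains as cyclic words\<close>

lemma relabel_simps [simp]:
  "carrier (relabel f g M) = f ` carrier M" "\<zero>\<^bsub>relabel f g M\<^esub> = f \<zero>\<^bsub>M\<^esub>"
  "x \<oplus>\<^bsub>relabel f g M\<^esub> y = f (g x \<oplus>\<^bsub>M\<^esub> g y)"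
  "r \<odot>\<^bsub>relabel f g M\<^esub> x = f (r \<odot>\<^bsub>M\<^esub> g x)" "x \<odot>\<^sub>r\<^bsub>relabel f g M\<^esub> r = f (g x \<odot>\<^sub>r\<^bsub>M\<^esub> r)"
  by (simp_all add: relabel_def)

lemma algebra_bimodule_relabel:
  assumes "algebra_bimodule K R M" and gf: "\<And>x. g (f x) = x"
  shows "algebra_bimodule K R (relabel f g M)"
proof -
  interpret M: algebra_bimodule K R M by fact
  have "abelian_group (relabel f g M)"
  proof (rule abelian_groupI)
    show "\<exists>y\<in>carrier (relabel f g M). y \<oplus>\<^bsub>relabel f g M\<^esub> x = \<zero>\<^bsub>relabel f g M\<^esub>"
      if "x \<in> carrier (relabel f g M)" for x
      using that by (auto simp: gf M.C.l_neg intro!: bexI[of _ "\<ominus>\<^bsub>M\<^esub> g x"])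
  qed (auto simp: gf M.C.a_assoc M.C.a_comm M.C.a_lcomm)
  then show ?thesis
    by (intro algebra_bimodule.intro M.field_algebra_axioms algebra_bimodule_axioms.intro)
      (auto simp: gf M.lact_closed M.ract_closed M.lact_add M.add_lact M.mult_lact M.one_lact
        M.ract_add M.add_ract M.mult_ract M.one_ract M.lact_ract M.ground_central)
qed

lemma (in field_algebra) self_bimodule: "algebra_bimodule K R (self_bimodule R)"
proof -
  have "abelian_group (self_bimodule R)"
    by (rule abelian_group_of_comm_group[OF R.a_comm_group]) (simp_all add: self_bimodule_def)
  then show ?thesis
    by (intro algebra_bimodule.intro field_algebra_axioms algebra_bimodule_axioms.intro)
      (auto simp: self_bimodule_def R.m_assoc R.l_distr R.r_distr smult_mult_left smult_mult_right)
qed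

text \<open>The word \<open>c\<close> of one letter means \<open>c \<otimes> 1\<close>.  Since \<open>c \<otimes> r = c r \<otimes> 1 = r c \<otimes> 1\<close>, words
  generate \<open>C\<^sup>0\<close> as well, and degree \<open>0\<close> needs no separate treatment later on.\<close>

definition cyclic_word ::
    "('k, 'x) ring_scheme \<Rightarrow> ('k, 'r, 'y) module_scheme \<Rightarrow> ('r, 'c, 'z) bimodule_scheme \<Rightarrow>
     'c list \<Rightarrow> ('r, 'c) cochain"
  where "cyclic_word K R C cs =
    (if tl cs = [] then elt0 K R C (hd cs) \<one>\<^bsub>R\<^esub> else elt K R C (hd cs) (tl cs))"

text \<open>The last letter and the first one are neighbours.  In a word of one letter they
  are the same letter, which therefore commutes with \<open>R\<close>; this is the quotient \<open>C / [R, C]\<close> and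
  accounts for the separate clause.\<close>

definition cyclically_balanced ::
    "('r, 'x) ring_scheme \<Rightarrow> ('r, 'c, 'z) bimodule_scheme \<Rightarrow> ('n, 'w) ring_scheme \<Rightarrow> nat \<Rightarrow>
     ('c list \<Rightarrow> 'n) \<Rightarrow> bool"
  where "cyclically_balanced R C N n f \<longleftrightarrow> balanced R C N n f \<and>
    (\<forall>x r. [x] \<in> tpow_gens C n \<longrightarrow> r \<in> carrier R \<longrightarrow> f [r \<odot>\<^bsub>C\<^esub> x] = f [x \<odot>\<^sub>r\<^bsub>C\<^esub> r]) \<and>
    (\<forall>x us y r. x # us @ [y] \<in> tpow_gens C n \<longrightarrow> r \<in> carrier R \<longrightarrow>
       f ((r \<odot>\<^bsub>C\<^esub> x) # us @ [y]) = f (x # us @ [y \<odot>\<^sub>r\<^bsub>C\<^esub> r]))"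

lemma cyclically_balancedI:
  assumes "balanced R C N n f"
    and "\<And>x r. \<lbrakk>[x] \<in> tpow_gens C n; r \<in> carrier R\<rbrakk> \<Longrightarrow> f [r \<odot>\<^bsub>C\<^esub> x] = f [x \<odot>\<^sub>r\<^bsub>C\<^esub> r]"
    and "\<And>x us y r. \<lbrakk>x # us @ [y] \<in> tpow_gens C n; r \<in> carrier R\<rbrakk> \<Longrightarrow>
       f ((r \<odot>\<^bsub>C\<^esub> x) # us @ [y]) = f (x # us @ [y \<odot>\<^sub>r\<^bsub>C\<^esub> r])"
  shows "cyclically_balanced R C N n f"
  using assms by (simp add: cyclically_balanced_def)

lemma cyclically_balancedD:
  "cyclically_balanced R C N n f \<Longrightarrow> balanced R C N n f"
  "\<lbrakk>cyclically_balanced R C N n f; [x] \<in> tpow_gens C n; r \<in> carrier R\<rbrakk> \<Longrightarrow> f [r \<odot>\<^bsub>C\<^esub> x] = f [x \<odot>\<^sub>r\<^bsub>C\<^esub> r]"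
  "\<lbrakk>cyclically_balanced R C N n f; x # us @ [y] \<in> tpow_gens C n; r \<in> carrier R\<rbrakk> \<Longrightarrow>
    f ((r \<odot>\<^bsub>C\<^esub> x) # us @ [y]) = f (x # us @ [y \<odot>\<^sub>r\<^bsub>C\<^esub> r])"
  by (simp_all add: cyclically_balanced_def)

context word_bimodule
begin

lemma coeff_bimodule: "algebra_bimodule K R (coeff R C n)"
proof (cases n)
  case 0
  then show ?thesis
    by (simp add: coeff_def algebra_bimodule_relabel self_bimodule)
next
  case (Suc m)
  then show ?thesis
    by (simp add: coeff_def algebra_bimodule_relabel tpow_bimodule)
qed

lemma coeff_tensor: "env_tensor K R C (coeff R C n)"
  by (intro env_tensor.intro algebra_bimodule_axioms coeff_bimodule)

abbreviation cochain_pres where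
  "cochain_pres n \<equiv> pres_group (carrier C \<times> carrier (coeff R C n))
    (tensor_rels (env_algebra K R) C (env_ract C) (coeff R C n) (env_lact (coeff R C n)))"

lemma cochains_simps:
  "carrier (Ch n) = carrier (cochain_pres n)"
  "add (Ch n) = mult (cochain_pres n)"
  "zero (Ch n) = one (cochain_pres n)"
  by (simp_all add: cochains_def tensor_group_def Let_def)

lemma cochains_abelian_group: "abelian_group (Ch n)"
proof -
  interpret env_tensor K R C "coeff R C n" by (rule coeff_tensor)
  show ?thesis
    by (rule abelian_group_of_comm_group[OF G.comm_group_axioms]) (simp_all only: cochains_simps)
qed

lemma cochain_tensor_left_additive:
  assumes "x \<in> carrier (coeff R C n)"
  shows "(\<lambda>c. tensor n c x) \<in> additive_maps C (Ch n)"
proof -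
  interpret env_tensor K R C "coeff R C n" by (rule coeff_tensor)
  show ?thesis
    unfolding cochain_tensor_def
    by (rule additiveI) (simp_all only: cochains_simps pure_closed pure_add_left assms)
qed

lemma cochain_tensor_right_additive:
  assumes "c \<in> carrier C"
  shows "tensor n c \<in> additive_maps (coeff R C n) (Ch n)"
proof -
  interpret env_tensor K R C "coeff R C n" by (rule coeff_tensor)
  show ?thesis
    unfolding cochain_tensor_def
    by (rule additiveI) (simp_all only: cochains_simps pure_closed pure_add_right assms)
qed

lemma cochain_tensor_twosided:
  assumes "r \<in> carrier R" "s \<in> carrier R" "c \<in> carrier C" "x \<in> carrier (coeff R C n)"
  shows "tensor n ((s \<bullet> c) \<star> r) x =
    tensor n c ((r \<odot>\<^bsub>coeff R C n\<^esub> x) \<odot>\<^sub>r\<^bsub>coeff R C n\<^esub> s)"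
proof -
  interpret env_tensor K R C "coeff R C n" by (rule coeff_tensor)
  show ?thesis
    unfolding cochain_tensor_def by (rule pure_twosided[OF assms])
qed

lemma cochain_tensor_swap:
  assumes "r \<in> carrier R" "c \<in> carrier C" "x \<in> carrier (coeff R C n)"
  shows "tensor n (c \<star> r) x = tensor n c (r \<odot>\<^bsub>coeff R C n\<^esub> x)"
    and "tensor n (r \<bullet> c) x = tensor n c (x \<odot>\<^sub>r\<^bsub>coeff R C n\<^esub> r)"
proof -
  interpret M: algebra_bimodule K R "coeff R C n" by (rule coeff_bimodule)
  show "tensor n (c \<star> r) x = tensor n c (r \<odot>\<^bsub>coeff R C n\<^esub> x)"
    using cochain_tensor_twosided[OF assms(1) R.one_closed assms(2,3)] assms
    by (simp add: one_lact M.one_ract M.lact_closed)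
  show "tensor n (r \<bullet> c) x = tensor n c (x \<odot>\<^sub>r\<^bsub>coeff R C n\<^esub> r)"
    using cochain_tensor_twosided[OF R.one_closed assms] assms
    by (simp add: one_ract M.one_lact lact_closed)
qed

text \<open>Pure tensors generate \<open>C\<^sup>n\<close>.\<close>

lemma cochains_ext:
  assumes "abelian_group N"
    "h \<in> additive_maps (Ch n) N" "g \<in> additive_maps (Ch n) N"
    and "\<And>c x. \<lbrakk>c \<in> carrier C; x \<in> carrier (coeff R C n)\<rbrakk> \<Longrightarrow>
      h (tensor n c x) = g (tensor n c x)"
    and "X \<in> carrier (Ch n)"
  shows "h X = g X"
proof -
  interpret env_tensor K R C "coeff R C n" by (rule coeff_tensor)
  show ?thesis
    by (rule tensor_ext[of "add_monoid N"])
      (use assms in \<open>auto simp: cochain_tensor_def cochains_simps abelian_group.a_group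
          additive_iff_hom[OF cochains_simps(1,2)[symmetric]]\<close>)
qed

lemma cochains_lift:
  assumes L: "abelian_group L"
    and left: "\<And>x. x \<in> carrier (coeff R C n) \<Longrightarrow> (\<lambda>c. f c x) \<in> additive_maps C L"
    and right: "\<And>c. c \<in> carrier C \<Longrightarrow> f c \<in> additive_maps (coeff R C n) L"
    and bal: "\<And>r s c x. \<lbrakk>r \<in> carrier R; s \<in> carrier R; c \<in> carrier C; x \<in> carrier (coeff R C n)\<rbrakk> \<Longrightarrow>
      f ((s \<bullet> c) \<star> r) x = f c ((r \<odot>\<^bsub>coeff R C n\<^esub> x) \<odot>\<^sub>r\<^bsub>coeff R C n\<^esub> s)"
  shows "induced (add_monoid L) (\<lambda>(c, x). f c x) \<in> additive_maps (Ch n) L"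
    and "\<lbrakk>c \<in> carrier C; x \<in> carrier (coeff R C n)\<rbrakk> \<Longrightarrow>
      induced (add_monoid L) (\<lambda>(c, x). f c x) (tensor n c x) = f c x"
proof -
  interpret env_tensor K R C "coeff R C n" by (rule coeff_tensor)
  show "induced (add_monoid L) (\<lambda>(c, x). f c x) \<in> additive_maps (Ch n) L"
    unfolding additive_iff_hom[OF cochains_simps(1,2)[symmetric]]
    by (rule env_tensor_lift[OF L left right bal])
  show "\<lbrakk>c \<in> carrier C; x \<in> carrier (coeff R C n)\<rbrakk> \<Longrightarrow>
      induced (add_monoid L) (\<lambda>(c, x). f c x) (tensor n c x) = f c x"
    unfolding cochain_tensor_def by (rule env_tensor_lift[OF L left right bal])
qed

lemma ground_lact_commute:
  assumes "k \<in> carrier K" "r \<in> carrier R" "c \<in> carrier C"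
  shows "(k \<odot>\<^bsub>R\<^esub> \<one>\<^bsub>R\<^esub>) \<bullet> (r \<bullet> c) = r \<bullet> ((k \<odot>\<^bsub>R\<^esub> \<one>\<^bsub>R\<^esub>) \<bullet> c)"
  using assms by (simp add: mult_lact[symmetric] ground_closed ground_mult_left ground_mult_right del: mult_lact)

text \<open>The scalar acts on the coring factor; as it is central in \<open>R\<close>, this commutes with the
  two actions of \<open>R\<close> and is therefore compatible with the balancing over \<open>R\<^sup>e\<close>.\<close>

lemma cochains_smult:
  assumes k: "k \<in> carrier K"
  shows cochains_smult_additive: "smult (Ch n) k \<in> additive_maps (Ch n) (Ch n)"
    and smult_cochain_tensor: "\<lbrakk>c \<in> carrier C; x \<in> carrier (coeff R C n)\<rbrakk> \<Longrightarrow>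
      k \<odot>\<^bsub>Ch n\<^esub> tensor n c x =
      tensor n ((k \<odot>\<^bsub>R\<^esub> \<one>\<^bsub>R\<^esub>) \<bullet> c) x"
proof -
  let ?f = "\<lambda>c x. tensor n ((k \<odot>\<^bsub>R\<^esub> \<one>\<^bsub>R\<^esub>) \<bullet> c) x"
  have eq: "smult (Ch n) k = induced (add_monoid (Ch n)) (\<lambda>(c, x). ?f c x)"
    by (simp add: cochains_def Let_def cong: induced_cong)
  note k1 = ground_closed[OF k]
  note lift = cochains_lift[OF cochains_abelian_group, of n ?f,
      OF additive_comp[OF lact_additive[OF k1] cochain_tensor_left_additive]
      cochain_tensor_right_additive[OF lact_closed[OF k1]]]
  have bal: "?f ((s \<bullet> c) \<star> r) x = ?f c ((r \<odot>\<^bsub>coeff R C n\<^esub> x) \<odot>\<^sub>r\<^bsub>coeff R C n\<^esub> s)"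
    if "r \<in> carrier R" "s \<in> carrier R" "c \<in> carrier C" "x \<in> carrier (coeff R C n)" for r s c x
    using that k k1 cochain_tensor_twosided[OF that(1,2) lact_closed[OF k1 that(3)] that(4)]
    by (simp add: lact_ract[symmetric] lact_closed ground_lact_commute del: lact_ract)
  show "smult (Ch n) k \<in> additive_maps (Ch n) (Ch n)"
    unfolding eq by (rule lift) (use bal in auto)
  show "\<lbrakk>c \<in> carrier C; x \<in> carrier (coeff R C n)\<rbrakk> \<Longrightarrow>
      k \<odot>\<^bsub>Ch n\<^esub> tensor n c x = ?f c x"
    unfolding eq by (rule lift) (use bal in auto)
qed

lemma cochains_module: "module K (Ch n)"
proof -
  let ?X = "Ch n"
  interpret X: abelian_group ?X by (rule cochains_abelian_group)
  note A = cochains_abelian_group[of n]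
  note sm = cochains_smult_additive[of _ n]
  have id: "(\<lambda>X. X) \<in> additive_maps ?X ?X"
    by (rule additiveI) simp_all
  show ?thesis
  proof (rule moduleI[OF K.is_cring A], goal_cases)
    case (1 k x)
    then show ?case by (intro additive_closed[OF sm])
  next
    case (2 k l x)
    have kl: "k \<oplus>\<^bsub>K\<^esub> l \<in> carrier K" using 2 by simp
    show ?case
      by (rule cochains_ext[OF A sm[OF kl] additive_plus[OF A sm[OF 2(1)] sm[OF 2(2)]] _ 2(3)])
        (use 2 kl in \<open>simp add: smult_cochain_tensor smult_l_distr add_lact ground_closed lact_closed
          additive_add[OF cochain_tensor_left_additive]\<close>)
  next
    case (3 k x y)
    then show ?case by (intro additive_add[OF sm])
  next
    case (4 k l x)
    have kl: "k \<otimes>\<^bsub>K\<^esub> l \<in> carrier K" using 4 by simp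
    have eq: "(k \<otimes>\<^bsub>K\<^esub> l) \<odot>\<^bsub>R\<^esub> \<one>\<^bsub>R\<^esub> = (k \<odot>\<^bsub>R\<^esub> \<one>\<^bsub>R\<^esub>) \<otimes>\<^bsub>R\<^esub> (l \<odot>\<^bsub>R\<^esub> \<one>\<^bsub>R\<^esub>)"
      using 4 by (simp add: ground_mult_left smult_assoc1)
    show ?case
      by (rule cochains_ext[OF A sm[OF kl] additive_comp[OF sm[OF 4(2)] sm[OF 4(1)]] _ 4(3)])
        (use 4 kl in \<open>simp add: smult_cochain_tensor eq mult_lact ground_closed lact_closed\<close>)
  next
    case (5 x)
    show ?case
      by (rule cochains_ext[OF A sm[OF K.one_closed] id _ 5])
        (simp add: smult_cochain_tensor one_lact)
  qed
qed

abbreviation word where "word \<equiv> cyclic_word K R C"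

lemma word_single: "word [c] = tensor 0 c (Inl \<one>\<^bsub>R\<^esub>)"
  by (simp add: cyclic_word_def elt0_def)

lemma word_Cons:
  "\<lbrakk>cs \<in> gens (Suc n)\<rbrakk> \<Longrightarrow> word (c # cs) = tensor (Suc n) c (Inr (tprod R C cs))"
  by (auto simp: cyclic_word_def elt_def tpow_gens_def)

text \<open>Both forms are needed: the first coface in degree \<open>0\<close> is expressed with \<open>c r\<close>, the second
  one with \<open>r c\<close>.\<close>

lemma elt0_eq_word:
  assumes "c \<in> carrier C" "r \<in> carrier R"
  shows "elt0 K R C c r = word [c \<star> r]" and "elt0 K R C c r = word [r \<bullet> c]"
  using assms cochain_tensor_swap[of r c "Inl \<one>\<^bsub>R\<^esub>" 0]
  by (simp_all add: word_single elt0_def coeff_def self_bimodule_def)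

lemma elt_eq_word: "cs \<noteq> [] \<Longrightarrow> elt K R C c cs = word (c # cs)"
  by (simp add: cyclic_word_def)

lemma coeff_0_simps:
  "carrier (coeff R C 0) = Inl ` carrier R"
  "x \<oplus>\<^bsub>coeff R C 0\<^esub> y = Inl (projl x \<oplus>\<^bsub>R\<^esub> projl y)"
  "r \<odot>\<^bsub>coeff R C 0\<^esub> x = Inl (r \<otimes>\<^bsub>R\<^esub> projl x)"
  "x \<odot>\<^sub>r\<^bsub>coeff R C 0\<^esub> r = Inl (projl x \<otimes>\<^bsub>R\<^esub> r)"
  by (simp_all add: coeff_def self_bimodule_def)

lemma coeff_Suc_simps:
  "carrier (coeff R C (Suc n)) = Inr ` carrier (tpow R C (Suc n))"
  "x \<oplus>\<^bsub>coeff R C (Suc n)\<^esub> y = Inr (projr x \<oplus>\<^bsub>tpow R C (Suc n)\<^esub> projr y)"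
  "r \<odot>\<^bsub>coeff R C (Suc n)\<^esub> x = Inr (r \<odot>\<^bsub>tpow R C (Suc n)\<^esub> projr x)"
  "x \<odot>\<^sub>r\<^bsub>coeff R C (Suc n)\<^esub> r = Inr (projr x \<odot>\<^sub>r\<^bsub>tpow R C (Suc n)\<^esub> r)"
  by (simp_all add: coeff_def)

text \<open>Balancing between the letters \<open>0\<close> and \<open>1\<close>, and between the last letter and
  letter \<open>0\<close>, comes from the tensor product over \<open>R\<^sup>e\<close>; all other relations come from the tensor
  power.\<close>

lemma word_cyclically_balanced: "cyclically_balanced R C (Ch n) (Suc n) word"
proof (cases n)
  case 0
  have one: "Inl \<one>\<^bsub>R\<^esub> \<in> carrier (coeff R C 0)"
    by (simp add: coeff_0_simps)
  have "balanced R C (Ch 0) (Suc 0) word"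
  proof (rule balanced_ConsI)
    show "balanced R C (Ch 0) 0 (\<lambda>cs. word (c # cs))" if "c \<in> carrier C" for c
      using additive_closed[OF cochain_tensor_left_additive[OF one] that]
      by (intro balancedI) (auto simp: word_single)
  qed (use additive_add[OF cochain_tensor_left_additive[OF one]] in \<open>auto simp: word_single\<close>)
  moreover have "word [r \<bullet> x] = word [x \<star> r]" if "[x] \<in> gens (Suc 0)" "r \<in> carrier R" for x r
    using that elt0_eq_word[of x r] by simp
  ultimately show ?thesis
    by (intro cyclically_balancedI) (auto simp: 0 tpow_gens_def)
next
  case (Suc m)
  let ?X = "Ch (Suc m)" and ?T = "tpow R C (Suc m)"
  have Inr: "Inr \<in> additive_maps ?T (coeff R C (Suc m))"
    by (rule additiveI) (simp_all add: coeff_Suc_simps)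
  note tp = additive_closed[OF Inr tprod_closed]
  have "balanced R C ?X (Suc (Suc m)) word"
  proof (rule balanced_ConsI)
    fix c assume c: "c \<in> carrier C"
    show "balanced R C ?X (Suc m) (\<lambda>cs. word (c # cs))"
      by (rule balanced_cong[OF balanced_comp[OF additive_comp[OF Inr cochain_tensor_right_additive[OF c]]
            tprod_balanced] word_Cons])
  next
    show "word ((x \<oplus>\<^bsub>C\<^esub> y) # vs) = word (x # vs) \<oplus>\<^bsub>?X\<^esub> word (y # vs)"
      if "x \<in> carrier C" "y \<in> carrier C" "vs \<in> gens (Suc m)" for x y vs
      using that additive_add[OF cochain_tensor_left_additive[OF tp]] by (simp add: word_Cons[of _ m])
    show "word ((x \<star> r) # y # vs) = word (x # (r \<bullet> y) # vs)"
      if "x \<in> carrier C" "y # vs \<in> gens (Suc m)" and r: "r \<in> carrier R" for x r y vs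
      using that cochain_tensor_swap(1)[OF r _ tp, of x "y # vs"]
      by (simp add: word_Cons[of _ m] lact_closed coeff_Suc_simps tprod_lact)
  qed
  moreover have "word ((r \<bullet> x) # us @ [y]) = word (x # us @ [y \<star> r])"
    if "x # us @ [y] \<in> gens (Suc (Suc m))" and r: "r \<in> carrier R" for x us y r
  proof -
    have "us @ [y] \<in> gens (Suc m)" "us @ [y \<star> r] \<in> gens (Suc m)" "x \<in> carrier C"
      using that by (auto simp: tpow_gens_append ract_closed)
    then show ?thesis
      using r cochain_tensor_swap(2)[OF r _ tp, of x "us @ [y]"]
      by (simp add: word_Cons[of _ m] coeff_Suc_simps tprod_ract)
  qed
  ultimately show ?thesis
    unfolding Suc by (intro cyclically_balancedI) auto
qed

lemmas word_balanced = cyclically_balancedD(1)[OF word_cyclically_balanced]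
lemmas word_closed = balanced_closed[OF word_balanced]

lemma smult_word:
  assumes "k \<in> carrier K" "c # cs \<in> gens (Suc n)"
  shows "k \<odot>\<^bsub>Ch n\<^esub> word (c # cs) = word (((k \<odot>\<^bsub>R\<^esub> \<one>\<^bsub>R\<^esub>) \<bullet> c) # cs)"
proof (cases n)
  case 0
  then show ?thesis
    using assms by (simp add: word_single smult_cochain_tensor coeff_0_simps)
next
  case (Suc m)
  then show ?thesis
    using assms tprod_closed[of cs "Suc m"] by (simp add: word_Cons[of _ m] smult_cochain_tensor coeff_Suc_simps)
qed

text \<open>Words generate \<open>C\<^sup>n\<close>: in positive degree pure tensors of pure tensors do, and in degree \<open>0\<close>
  the tensor \<open>c \<otimes> r\<close> is the word \<open>c r\<close>.\<close>

lemma words_ext: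
  assumes N: "abelian_group N"
    and h: "h \<in> additive_maps (Ch n) N" and g: "g \<in> additive_maps (Ch n) N"
    and eq: "\<And>cs. cs \<in> gens (Suc n) \<Longrightarrow> h (word cs) = g (word cs)"
    and X: "X \<in> carrier (Ch n)"
  shows "h X = g X"
proof (rule cochains_ext[OF N h g _ X])
  fix c x
  assume c: "c \<in> carrier C" and x: "x \<in> carrier (coeff R C n)"
  show "h (tensor n c x) = g (tensor n c x)"
  proof (cases n)
    case 0
    with x obtain r where r: "x = Inl r" "r \<in> carrier R"
      by (auto simp: coeff_0_simps)
    then have "tensor n c x = word [c \<star> r]"
      using elt0_eq_word(1)[OF c r(2)] by (simp add: elt0_def 0)
    then show ?thesis
      using eq[of "[c \<star> r]"] c r by (simp add: 0 ract_closed)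
  next
    case (Suc m)
    have "Inr \<in> additive_maps (tpow R C (Suc m)) (coeff R C (Suc m))"
      by (rule additiveI) (simp_all add: coeff_Suc_simps)
    note ct = additive_comp[OF this cochain_tensor_right_additive[OF c]]
    obtain X where X: "x = Inr X" "X \<in> carrier (tpow R C (Suc m))"
      using x by (auto simp: Suc coeff_Suc_simps)
    have "h (tensor (Suc m) c (Inr X)) = g (tensor (Suc m) c (Inr X))"
    proof (rule tpow_ext[OF N additive_comp[OF ct h[unfolded Suc]] additive_comp[OF ct g[unfolded Suc]] _ X(2)])
      show "h (tensor (Suc m) c (Inr (tprod R C cs))) =
          g (tensor (Suc m) c (Inr (tprod R C cs)))"
        if "cs \<in> gens (Suc m)" for cs
        using eq[of "c # cs"] that c by (simp add: Suc word_Cons[of _ m])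
    qed
    then show ?thesis by (simp add: Suc X)
  qed
qed

text \<open>Together with \<open>words_ext\<close> this says that \<open>C\<^sup>n\<close> is presented by cyclic words.  The map
  is built in two stages: first the coring factor \<open>c\<close> is fixed and the remaining letters are
  lifted to the tensor power; the result is then biadditive in \<open>c\<close> and the tensor, and it is
  \<open>R\<^sup>e\<close>-balanced by the balance conditions at letter \<open>0\<close>.  In degree \<open>0\<close> the tensor \<open>c \<otimes> r\<close> has
  to go to \<open>f(c r)\<close>.\<close>

lemma words_lift_additive:
  assumes N: "abelian_group N" and f: "cyclically_balanced R C N (Suc n) f"
  shows "\<exists>h\<in>additive_maps (Ch n) N. \<forall>cs\<in>gens (Suc n). h (word cs) = f cs"
proof (cases n)
  case 0
  interpret N: abelian_group N by (rule N)
  have bal: "balanced R C N (Suc 0) f"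
    and cyc: "\<And>x r. \<lbrakk>[x] \<in> gens (Suc 0); r \<in> carrier R\<rbrakk> \<Longrightarrow> f [r \<bullet> x] = f [x \<star> r]"
    using f cyclically_balancedD[OF f] unfolding 0 by blast+
  have f1: "(\<lambda>c. f [c]) \<in> additive_maps C N"
    using balanced_closed[OF bal] balanced_add[OF bal, of "[]" _ "[]"] by (intro additiveI) auto
  let ?F = "\<lambda>c x. f [c \<star> projl x]"
  have left: "(\<lambda>c. ?F c x) \<in> additive_maps C N" if "x \<in> carrier (coeff R C 0)" for x
    using that by (intro additive_comp[OF ract_additive f1]) (auto simp: coeff_0_simps)
  have right: "?F c \<in> additive_maps (coeff R C 0) N" if "c \<in> carrier C" for c
    using that by (intro additive_comp[OF _ f1] additiveI) (auto simp: coeff_0_simps ract_closed add_ract)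
  have bal: "?F ((s \<bullet> c) \<star> r) x = ?F c ((r \<odot>\<^bsub>coeff R C 0\<^esub> x) \<odot>\<^sub>r\<^bsub>coeff R C 0\<^esub> s)"
    if "r \<in> carrier R" "s \<in> carrier R" "c \<in> carrier C" "x \<in> carrier (coeff R C 0)" for r s c x
    using that cyc[of "(c \<star> r) \<star> projl x" s]
    by (auto simp: coeff_0_simps mult_ract lact_ract ract_closed)
  note lift = cochains_lift[OF N left right bal]
  show ?thesis
    unfolding 0
  proof (intro bexI ballI)
    show "induced (add_monoid N) (\<lambda>(c, x). ?F c x) \<in> additive_maps (Ch 0) N"
      by (rule lift)
    show "induced (add_monoid N) (\<lambda>(c, x). ?F c x) (word cs) = f cs"
      if "cs \<in> gens (Suc 0)" for cs
      using that lift(2)[of "hd cs" "Inl \<one>\<^bsub>R\<^esub>"]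
      by (cases cs) (auto simp: word_single coeff_0_simps one_ract)
  qed
next
  case (Suc m)
  note f = f[unfolded Suc]
  note bal = cyclically_balancedD(1)[OF f]
  let ?T = "tpow R C (Suc m)"
  let ?I = "\<lambda>c. induced (add_monoid N) (\<lambda>cs. f (c # cs))"
  have balc: "balanced R C N (Suc m) (\<lambda>cs. f (c # cs))" if "c \<in> carrier C" for c
    using balanced_context[OF bal, of "[c]" "Suc m" "[]"] that by simp
  note I = tpow_lift_additive[OF N balc] and I_tprod = tpow_lift_tprod[OF N balc]
  interpret T: algebra_bimodule K R ?T by (rule tpow_bimodule)
  have projr: "projr \<in> additive_maps (coeff R C (Suc m)) ?T"
    by (rule additiveI) (auto simp: coeff_Suc_simps)
  have I_add: "?I (c \<oplus>\<^bsub>C\<^esub> d) X = ?I c X \<oplus>\<^bsub>N\<^esub> ?I d X"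
    if "c \<in> carrier C" "d \<in> carrier C" "X \<in> carrier ?T" for c d X
    by (rule tpow_ext[OF N I additive_plus[OF N I I] _ that(3)])
      (use that balanced_add[OF bal, of "[]"] in \<open>auto simp: I_tprod\<close>)
  have I_bal: "?I ((s \<bullet> c) \<star> r) X = ?I c ((r \<odot>\<^bsub>?T\<^esub> X) \<odot>\<^sub>r\<^bsub>?T\<^esub> s)"
    if rsc: "r \<in> carrier R" "s \<in> carrier R" "c \<in> carrier C" and X: "X \<in> carrier ?T" for r s c X
  proof (rule tpow_ext[OF N I additive_comp[OF additive_comp[OF T.lact_additive T.ract_additive] I] _ X])
    fix cs assume cs: "cs \<in> gens (Suc m)"
    then obtain d ds where d: "cs = d # ds" "d \<in> carrier C" "ds \<in> gens m"
      by (cases cs) auto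
    have src: "(s \<bullet> c) \<star> r \<in> carrier C"
      using rsc by (simp add: lact_closed ract_closed)
    have rd: "(r \<bullet> d) # ds \<in> gens (Suc m)"
      using d rsc by (simp add: lact_closed)
    \<comment> \<open>If \<open>ds\<close> is empty, then \<open>e\<close> is \<open>r d\<close> itself; this naming covers both cases.\<close>
    obtain es e where e: "(r \<bullet> d) # ds = es @ [e]"
      by (cases "(r \<bullet> d) # ds" rule: rev_cases) auto
    then have e': "es @ [e] \<in> gens (Suc m)" "es @ [e \<star> s] \<in> gens (Suc m)"
      using rd rsc unfolding e by (auto simp: tpow_gens_append ract_closed)
    have "?I ((s \<bullet> c) \<star> r) (tprod R C cs) = f (((s \<bullet> c) \<star> r) # d # ds)"
      using src cs d by (simp add: I_tprod)
    also have "\<dots> = f ((s \<bullet> c) # es @ [e])"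
      using rsc d balanced_swap[OF bal, of "[]" "s \<bullet> c" d ds r] by (simp add: lact_closed e)
    also have "\<dots> = f (c # es @ [e \<star> s])"
      using rsc e' by (intro cyclically_balancedD(3)[OF f]) auto
    also have "\<dots> = ?I c (tprod R C (es @ [e]) \<odot>\<^sub>r\<^bsub>?T\<^esub> s)"
      using rsc e' by (simp add: I_tprod tprod_ract)
    also have "tprod R C (es @ [e]) = r \<odot>\<^bsub>?T\<^esub> tprod R C cs"
      using rsc d by (simp add: tprod_lact e)
    finally show "?I ((s \<bullet> c) \<star> r) (tprod R C cs) = ?I c ((r \<odot>\<^bsub>?T\<^esub> tprod R C cs) \<odot>\<^sub>r\<^bsub>?T\<^esub> s)" .
  qed (use rsc in \<open>auto simp: lact_closed ract_closed\<close>)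
  let ?F = "\<lambda>c x. ?I c (projr x)"
  have left: "(\<lambda>c. ?F c x) \<in> additive_maps C N" if "x \<in> carrier (coeff R C (Suc m))" for x
    using that by (intro additiveI) (auto simp: coeff_Suc_simps I_add intro: additive_closed[OF I])
  have right: "?F c \<in> additive_maps (coeff R C (Suc m)) N" if "c \<in> carrier C" for c
    by (rule additive_comp[OF projr I[OF that]])
  have bal: "?F ((s \<bullet> c) \<star> r) x = ?F c ((r \<odot>\<^bsub>coeff R C (Suc m)\<^esub> x) \<odot>\<^sub>r\<^bsub>coeff R C (Suc m)\<^esub> s)"
    if "r \<in> carrier R" "s \<in> carrier R" "c \<in> carrier C" "x \<in> carrier (coeff R C (Suc m))" for r s c x
    using that by (auto simp: coeff_Suc_simps I_bal)
  note lift = cochains_lift[OF N left right bal]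
  show ?thesis
    unfolding Suc
  proof (intro bexI ballI)
    show "induced (add_monoid N) (\<lambda>(c, x). ?F c x) \<in> additive_maps (Ch (Suc m)) N"
      by (rule lift)
    show "induced (add_monoid N) (\<lambda>(c, x). ?F c x) (word cs) = f cs"
      if cs: "cs \<in> gens (Suc (Suc m))" for cs
    proof (cases cs)
      case (Cons c ds)
      then show ?thesis
        using cs lift(2)[of c "Inr (tprod R C ds)"]
        by (simp add: word_Cons[of _ m] coeff_Suc_simps tprod_closed I_tprod)
    qed (use cs in auto)
  qed
qed

end

section \<open>Linear maps on cochains\<close>

lemma linear_additive: "h \<in> linear_maps K M N \<Longrightarrow> h \<in> additive_maps M N"
  by (auto simp: linear_maps_def additive_maps_def PiE_def)

lemma linear_smult:
  "\<lbrakk>h \<in> linear_maps K M N; k \<in> carrier K; x \<in> carrier M\<rbrakk> \<Longrightarrow> h (k \<odot>\<^bsub>M\<^esub> x) = k \<odot>\<^bsub>N\<^esub> h x"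
  by (auto simp: linear_maps_def)

lemma linear_mapsI:
  assumes h: "h \<in> additive_maps M N" and M: "module K M"
    and smult: "\<And>k x. \<lbrakk>k \<in> carrier K; x \<in> carrier M\<rbrakk> \<Longrightarrow> h (k \<odot>\<^bsub>M\<^esub> x) = k \<odot>\<^bsub>N\<^esub> h x"
  shows "restrict h (carrier M) \<in> linear_maps K M N"
proof -
  interpret M: module K M by (rule M)
  show ?thesis
    using smult by (auto simp: linear_maps_def additive_closed[OF h] additive_add[OF h])
qed

lemma linear_comp:
  assumes "module K M" "h \<in> linear_maps K M N" "g \<in> linear_maps K N L"
  shows "restrict (\<lambda>x. g (h x)) (carrier M) \<in> linear_maps K M L"
  by (rule linear_mapsI[OF additive_comp[OF linear_additive linear_additive]])
    (use assms in \<open>auto simp: linear_smult additive_closed[OF linear_additive]\<close>)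

lemma (in module) smult_additive: "a \<in> carrier R \<Longrightarrow> (\<lambda>x. a \<odot>\<^bsub>M\<^esub> x) \<in> additive_maps M M"
  by (rule additiveI) (auto simp: smult_r_distr)

context word_bimodule
begin

lemma linear_words_ext:
  assumes N: "abelian_group N"
    and h: "h \<in> linear_maps K (Ch n) N" and g: "g \<in> linear_maps K (Ch n) N"
    and eq: "\<And>cs. cs \<in> gens (Suc n) \<Longrightarrow> h (word cs) = g (word cs)"
  shows "h = g"
proof (rule extensionalityI)
  show "h X = g X" if "X \<in> carrier (Ch n)" for X
    by (rule words_ext[OF N linear_additive[OF h] linear_additive[OF g] eq that])
qed (use h g in \<open>auto simp: linear_maps_def PiE_def\<close>)

lemma words_lift:
  assumes N: "module K N" and f: "cyclically_balanced R C N (Suc n) f"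
    and smult: "\<And>k c cs. \<lbrakk>k \<in> carrier K; c # cs \<in> gens (Suc n)\<rbrakk> \<Longrightarrow>
      f (((k \<odot>\<^bsub>R\<^esub> \<one>\<^bsub>R\<^esub>) \<bullet> c) # cs) = k \<odot>\<^bsub>N\<^esub> f (c # cs)"
  shows "\<exists>h\<in>linear_maps K (Ch n) N. \<forall>cs\<in>gens (Suc n). h (word cs) = f cs"
proof -
  interpret N: module K N by (rule N)
  obtain h where h: "h \<in> additive_maps (Ch n) N"
    and hw: "\<And>cs. cs \<in> gens (Suc n) \<Longrightarrow> h (word cs) = f cs"
    using words_lift_additive[OF N.M.abelian_group_axioms f] by blast
  have lin: "h (k \<odot>\<^bsub>Ch n\<^esub> x) = k \<odot>\<^bsub>N\<^esub> h x"
    if k: "k \<in> carrier K" and x: "x \<in> carrier (Ch n)" for k x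
  proof (rule words_ext[OF N.M.abelian_group_axioms additive_comp[OF cochains_smult_additive[OF k] h]
        additive_comp[OF h N.smult_additive[OF k]] _ x])
    fix cs assume cs: "cs \<in> gens (Suc n)"
    show "h (k \<odot>\<^bsub>Ch n\<^esub> word cs) = k \<odot>\<^bsub>N\<^esub> h (word cs)"
    proof (cases cs)
      case (Cons c ds)
      have "((k \<odot>\<^bsub>R\<^esub> \<one>\<^bsub>R\<^esub>) \<bullet> c) # ds \<in> gens (Suc n)"
        using cs Cons k by (simp add: lact_closed)
      then show ?thesis
        using cs Cons k hw smult[OF k, of c ds] by (simp add: smult_word)
    qed (use cs in auto)
  qed
  show ?thesis
  proof (intro bexI ballI)
    show "restrict h (carrier (Ch n)) \<in> linear_maps K (Ch n) N"
      by (rule linear_mapsI[OF h cochains_module lin])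
    show "restrict h (carrier (Ch n)) (word cs) = f cs" if "cs \<in> gens (Suc n)" for cs
      using that by (simp add: word_closed hw)
  qed
qed

text \<open>Scalars may be attached to any letter, not only to letter \<open>0\<close>.  This makes the rotation
  linear.\<close>

lemma smult_word_at:
  assumes k: "k \<in> carrier K" and cs: "us @ c # vs \<in> gens (Suc n)"
  shows "k \<odot>\<^bsub>Ch n\<^esub> word (us @ c # vs) = word (us @ ((k \<odot>\<^bsub>R\<^esub> \<one>\<^bsub>R\<^esub>) \<bullet> c) # vs)"
proof (cases us)
  case Nil
  then show ?thesis
    using smult_word k cs by simp
next
  case (Cons u us')
  then show ?thesis
    using smult_word[OF k, of u "us' @ c # vs" n] cs
      balanced_ground_shift[OF word_balanced k, of u us' c vs n] by simp
qed

section \<open>Rotation\<close>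

text \<open>Rotation only permutes the relations: the condition between the last and the
  first letter becomes one between neighbours, and vice versa.\<close>

lemma cyclically_balanced_rotate1:
  assumes f: "cyclically_balanced R C N n f"
  shows "cyclically_balanced R C N n (\<lambda>cs. f (rotate1 cs))"
proof (intro cyclically_balancedI balancedI)
  note bal = cyclically_balancedD(1)[OF f]
  show "f (rotate1 cs) \<in> carrier N" if "cs \<in> gens n" for cs
    using that by (intro balanced_closed[OF bal]) (simp add: tpow_gens_def)
  show "f (rotate1 (us @ (x \<oplus>\<^bsub>C\<^esub> y) # vs)) = f (rotate1 (us @ x # vs)) \<oplus>\<^bsub>N\<^esub> f (rotate1 (us @ y # vs))"
    if "us @ x # vs \<in> gens n" "y \<in> carrier C" for us x y vs
  proof (cases us)
    case Nil
    then show ?thesis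
      using that balanced_add[OF bal, of vs x "[]" y] by (simp add: tpow_gens_def)
  next
    case (Cons u us')
    then show ?thesis
      using that balanced_add[OF bal, of us' x "vs @ [u]" y] by (simp add: tpow_gens_def)
  qed
  show "f (rotate1 (us @ (x \<star> r) # y # vs)) = f (rotate1 (us @ x # (r \<bullet> y) # vs))"
    if "us @ x # y # vs \<in> gens n" "r \<in> carrier R" for us x r y vs
  proof (cases us)
    case Nil
    then show ?thesis
      using that cyclically_balancedD(3)[OF f, of y vs x r] by (simp add: tpow_gens_def)
  next
    case (Cons u us')
    then show ?thesis
      using that balanced_swap[OF bal, of us' x y "vs @ [u]" r] by (simp add: tpow_gens_def)
  qed
  show "f (rotate1 [r \<bullet> x]) = f (rotate1 [x \<star> r])"
    if "[x] \<in> gens n" "r \<in> carrier R" for x r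
    using cyclically_balancedD(2)[OF f that] by simp
  show "f (rotate1 ((r \<bullet> x) # us @ [y])) = f (rotate1 (x # us @ [y \<star> r]))"
    if "x # us @ [y] \<in> gens n" "r \<in> carrier R" for x us y r
    using that balanced_swap[OF bal, of us y x "[]" r] by (simp add: tpow_gens_def)
qed

text \<open>Rotation by \<open>i\<close> letters, that is \<open>\<tau>\<^bsup>i\<^esup>\<close>, as a linear map in its own right, so that the
  conjugates of \<open>\<delta>\<^sub>0\<close> and \<open>\<sigma>\<^sub>0\<close> can be formed by composition.\<close>

definition rotation_map where
  "rotation_map n i t \<longleftrightarrow> t \<in> linear_maps K (Ch n) (Ch n) \<and>
    (\<forall>cs\<in>gens (Suc n). t (word cs) = word (rotate i cs))"

lemma rotation_map_exists: "\<exists>t. rotation_map n i t"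
proof (induction i)
  case 0
  interpret X: module K "Ch n" by (rule cochains_module)
  have "(\<lambda>x. x) \<in> additive_maps (Ch n) (Ch n)"
    by (rule additiveI) simp_all
  from linear_mapsI[OF this cochains_module]
  have "rotation_map n 0 (restrict (\<lambda>x. x) (carrier (Ch n)))"
    by (simp add: rotation_map_def word_closed)
  then show ?case by blast
next
  case (Suc i)
  then obtain t where t: "rotation_map n i t" ..
  have sm: "word (rotate1 (((k \<odot>\<^bsub>R\<^esub> \<one>\<^bsub>R\<^esub>) \<bullet> c) # cs)) = k \<odot>\<^bsub>Ch n\<^esub> word (rotate1 (c # cs))"
    if "k \<in> carrier K" "c # cs \<in> gens (Suc n)" for k c cs
    using that smult_word_at[of k cs c "[]" n] by (simp add: tpow_gens_def)
  obtain t1 where t1: "t1 \<in> linear_maps K (Ch n) (Ch n)"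
    "\<And>cs. cs \<in> gens (Suc n) \<Longrightarrow> t1 (word cs) = word (rotate1 cs)"
    using words_lift[OF cochains_module cyclically_balanced_rotate1[OF word_cyclically_balanced] sm]
    by blast
  have "rotation_map n (Suc i) (restrict (\<lambda>x. t1 (t x)) (carrier (Ch n)))"
    unfolding rotation_map_def
    using t t1 linear_comp[OF cochains_module, of t n _ t1]
    by (auto simp: rotation_map_def word_closed tpow_gens_def)
  then show ?case by blast
qed

end

section \<open>Sums over the coproduct\<close>

sublocale coring \<subseteq> word_bimodule
  by unfold_locales

context coring
begin

abbreviation splits where "splits \<equiv> sweedler R C \<Delta>"
abbreviation word_sum where "word_sum n m w \<equiv> \<Oplus>\<^bsub>Ch n\<^esub>l\<in>{..<m::nat}. word (w l)"

text \<open>Sums of pure tensors form a subgroup, because \<open>- (x \<otimes> y) = (- x) \<otimes> y\<close>; and pure tensors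
  generate.\<close>

lemma tpow_2_sum:
  assumes "Z \<in> carrier (tpow R C 2)"
  shows "\<exists>m a b. a \<in> {..<m::nat} \<rightarrow> carrier C \<and> b \<in> {..<m} \<rightarrow> carrier C \<and>
    Z = (\<Oplus>\<^bsub>tpow R C 2\<^esub>i\<in>{..<m}. tprod R C [a i, b i])"
proof -
  interpret P: presentation "gens 2" "tpow_sums 2" "tpow_eqs 2" "tpow_rels R C 2"
    by (rule tpow_presentation)
  interpret T: abelian_group "tpow R C 2" by (rule tpow_abelian_group)
  let ?T = "tpow R C 2"
  have gens2: "[x, y] \<in> gens 2 \<longleftrightarrow> x \<in> carrier C \<and> y \<in> carrier C" for x y
    by (auto simp: tpow_gens_def)
  have gen_pair: "\<exists>x y. x \<in> carrier C \<and> y \<in> carrier C \<and> h = tprod R C [x, y]"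
    if "h \<in> P.gen ` gens 2" for h
  proof -
    obtain cs where cs: "cs \<in> gens 2" "h = tprod R C cs"
      using \<open>h \<in> _\<close> by (auto simp: tprod_eq)
    then obtain x y where "cs = [x, y]"
      by (auto simp: tpow_gens_def length_Suc_conv numeral_2_eq_2)
    then show ?thesis
      using cs by (auto simp: gens2)
  qed
  have single: "\<exists>m a b. a \<in> {..<m::nat} \<rightarrow> carrier C \<and> b \<in> {..<m} \<rightarrow> carrier C \<and>
      tprod R C [x, y] = (\<Oplus>\<^bsub>?T\<^esub>i\<in>{..<m}. tprod R C [a i, b i])"
    if "x \<in> carrier C" "y \<in> carrier C" for x y
    using that tprod_closed[of "[x, y]" 2]
    by (intro exI[of _ "1::nat"] exI[of _ "\<lambda>_. x"] exI[of _ "\<lambda>_. y"]) (simp add: gens2 lessThan_Suc)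
  from assms have "Z \<in> generate P.G (P.gen ` gens 2)"
    by (simp add: tpow_simps P.carrier_generated)
  then show ?thesis
  proof induction
    case one
    show ?case
      by (intro exI[of _ "0::nat"]) (simp add: tpow_simps)
  next
    case (incl h)
    then obtain x y where "x \<in> carrier C" "y \<in> carrier C" "h = tprod R C [x, y]"
      using gen_pair by blast
    then show ?case
      using single by simp
  next
    case (inv h)
    then obtain x y where xy: "x \<in> carrier C" "y \<in> carrier C" "h = tprod R C [x, y]"
      using gen_pair by blast
    have "(\<lambda>x. tprod R C [x, y]) \<in> additive_maps C ?T"
      using xy by (intro additiveI)
        (auto simp: gens2 tprod_closed balanced_add[OF tprod_balanced, of "[]" _ _ 2, simplified])
    note h = this
    have "tprod R C [\<ominus>\<^bsub>C\<^esub> x, y] \<oplus>\<^bsub>?T\<^esub> tprod R C [x, y] = \<zero>\<^bsub>?T\<^esub>"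
      using xy additive_add[OF h, of "\<ominus>\<^bsub>C\<^esub> x" x]
        additive_zero[OF C.abelian_group_axioms tpow_abelian_group h]
      by (simp add: gens2 C.l_neg)
    then have "inv\<^bsub>P.G\<^esub> h = tprod R C [\<ominus>\<^bsub>C\<^esub> x, y]"
      using xy tprod_closed[of "[\<ominus>\<^bsub>C\<^esub> x, y]" 2] tprod_closed[of "[x, y]" 2]
      by (intro P.G.inv_equality) (auto simp: tpow_simps gens2)
    then show ?case
      using xy single by (simp add: gens2)
  next
    case (eng U V)
    then obtain m a b m' a' b' where
      U: "a \<in> {..<m::nat} \<rightarrow> carrier C" "b \<in> {..<m} \<rightarrow> carrier C"
        "U = (\<Oplus>\<^bsub>?T\<^esub>i\<in>{..<m}. tprod R C [a i, b i])" and
      V: "a' \<in> {..<m'::nat} \<rightarrow> carrier C" "b' \<in> {..<m'} \<rightarrow> carrier C"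
        "V = (\<Oplus>\<^bsub>?T\<^esub>i\<in>{..<m'}. tprod R C [a' i, b' i])"
      by blast
    define a'' where "a'' i = (if i < m then a i else a' (i - m))" for i
    define b'' where "b'' i = (if i < m then b i else b' (i - m))" for i
    have ab: "a'' \<in> {..<m + m'} \<rightarrow> carrier C" "b'' \<in> {..<m + m'} \<rightarrow> carrier C"
      using U V by (auto simp: a''_def b''_def Pi_iff)
    have "(\<Oplus>\<^bsub>?T\<^esub>i\<in>{..<m + m'}. tprod R C [a'' i, b'' i]) =
        (\<Oplus>\<^bsub>?T\<^esub>i\<in>{..<m}. tprod R C [a'' i, b'' i]) \<oplus>\<^bsub>?T\<^esub> (\<Oplus>\<^bsub>?T\<^esub>i\<in>{..<m'}. tprod R C [a'' (m + i), b'' (m + i)])"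
      by (rule T.finsum_lessThan_add) (use ab in \<open>auto simp: gens2 Pi_iff intro!: tprod_closed\<close>)
    also have "(\<Oplus>\<^bsub>?T\<^esub>i\<in>{..<m}. tprod R C [a'' i, b'' i]) = U"
      unfolding U(3) by (rule T.finsum_cong') (use U in \<open>auto simp: a''_def b''_def gens2 Pi_iff intro!: tprod_closed\<close>)
    also have "(\<Oplus>\<^bsub>?T\<^esub>i\<in>{..<m'}. tprod R C [a'' (m + i), b'' (m + i)]) = V"
      unfolding V(3) by (rule T.finsum_cong') (use V in \<open>auto simp: a''_def b''_def gens2 Pi_iff intro!: tprod_closed\<close>)
    finally show ?case
      using ab by (intro exI[of _ "m + m'"] exI[of _ a''] exI[of _ b'']) (simp add: tpow_simps)
  qed
qed

lemma coproduct_additive: "\<Delta> \<in> additive_maps C (tpow R C 2)"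
  using coproduct_hom by (auto simp: bimodule_hom_def additive_maps_def)

lemma sweedler_exists:
  assumes "c \<in> carrier C"
  obtains m a b where "splits c m a b"
  using tpow_2_sum[OF additive_closed[OF coproduct_additive assms]] unfolding sweedler_def by blast

lemma sweedler_closed:
  "\<lbrakk>splits c m a b; l < m\<rbrakk> \<Longrightarrow> a l \<in> carrier C"
  "\<lbrakk>splits c m a b; l < m\<rbrakk> \<Longrightarrow> b l \<in> carrier C"
  by (auto simp: sweedler_def)

lemma tpow_gens_2: "[x, y] \<in> gens 2 \<longleftrightarrow> x \<in> carrier C \<and> y \<in> carrier C"
  by (auto simp: tpow_gens_def)

text \<open>This yields decompositions of \<open>\<Delta>(r c)\<close> and \<open>\<Delta>(c r)\<close> from one of \<open>\<Delta>(c)\<close>, with \<open>h\<close> the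
  action of \<open>r\<close> from either side.\<close>

lemma sweedler_map:
  assumes s: "splits c m a b" and h: "h \<in> additive_maps (tpow R C 2) (tpow R C 2)"
    and eq: "\<And>l. l < m \<Longrightarrow> a' l \<in> carrier C \<and> b' l \<in> carrier C \<and> h (tprod R C [a l, b l]) = tprod R C [a' l, b' l]"
    and d: "\<Delta> d = h (\<Delta> c)"
  shows "splits d m a' b'"
proof -
  interpret T: abelian_group "tpow R C 2" by (rule tpow_abelian_group)
  have "\<Delta> d = h (\<Oplus>\<^bsub>tpow R C 2\<^esub>l\<in>{..<m}. tprod R C [a l, b l])"
    using s d by (simp add: sweedler_def)
  also have "\<dots> = (\<Oplus>\<^bsub>tpow R C 2\<^esub>l\<in>{..<m}. h (tprod R C [a l, b l]))"
    using sweedler_closed[OF s]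
    by (intro additive_finsum[OF tpow_abelian_group tpow_abelian_group h] tprod_closed) (simp add: tpow_gens_2)
  also have "\<dots> = (\<Oplus>\<^bsub>tpow R C 2\<^esub>l\<in>{..<m}. tprod R C [a' l, b' l])"
    by (intro T.finsum_cong' refl funcsetI tprod_closed) (simp_all add: eq tpow_gens_2)
  finally show ?thesis
    using eq by (auto simp: sweedler_def)
qed

lemma sweedler_lact:
  assumes "splits c m a b" "c \<in> carrier C" "r \<in> carrier R"
  shows "splits (r \<bullet> c) m (\<lambda>l. r \<bullet> a l) b"
  by (rule sweedler_map[OF assms(1) tpow_lact_additive[OF assms(3), of "Suc 0", folded numeral_2_eq_2]])
    (use assms coproduct_hom sweedler_closed[OF assms(1)] tprod_lact[OF assms(3), of _ "[_]" "Suc 0"] in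
      \<open>simp_all add: bimodule_hom_def lact_closed numeral_2_eq_2\<close>)

lemma sweedler_ract:
  assumes "splits c m a b" "c \<in> carrier C" "r \<in> carrier R"
  shows "splits (c \<star> r) m a (\<lambda>l. b l \<star> r)"
  by (rule sweedler_map[OF assms(1) tpow_ract_additive[OF assms(3), of "Suc 0", folded numeral_2_eq_2]])
    (use assms coproduct_hom sweedler_closed[OF assms(1)] tprod_ract[OF assms(3), of "[_]" _ "Suc 0"] in
      \<open>simp_all add: bimodule_hom_def ract_closed numeral_2_eq_2\<close>)

text \<open>A sum over Sweedler components does not depend on the decomposition of \<open>\<Delta>(c)\<close>,
  because it is the value at \<open>\<Delta>(c)\<close> of a homomorphism on \<open>C \<otimes> C\<close>.\<close>

lemma induced_coproduct_sum:
  assumes N: "abelian_group N" and f: "balanced R C N 2 f" and s: "splits c m a b"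
  shows "induced (add_monoid N) f (\<Delta> c) = (\<Oplus>\<^bsub>N\<^esub>l\<in>{..<m}. f [a l, b l])"
proof -
  interpret N: abelian_group N by (rule N)
  have "\<Delta> c = (\<Oplus>\<^bsub>tpow R C 2\<^esub>l\<in>{..<m}. tprod R C [a l, b l])"
    using s by (simp add: sweedler_def)
  also have "induced (add_monoid N) f \<dots> = (\<Oplus>\<^bsub>N\<^esub>l\<in>{..<m}. induced (add_monoid N) f (tprod R C [a l, b l]))"
    using sweedler_closed[OF s]
    by (intro additive_finsum[OF tpow_abelian_group N tpow_lift_additive[OF N f]] tprod_closed)
      (simp add: tpow_gens_2)
  also have "\<dots> = (\<Oplus>\<^bsub>N\<^esub>l\<in>{..<m}. f [a l, b l])"
    using sweedler_closed[OF s] balanced_closed[OF f]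
    by (intro N.finsum_cong') (auto simp: tpow_lift_tprod[OF N f] tpow_gens_2)
  finally show ?thesis .
qed

text \<open>Coassociativity, pushed forward along the homomorphism on the triple tensor power that
  \<open>f\<close> induces.\<close>

lemma coassoc_sum:
  assumes N: "abelian_group N" and f: "balanced R C N 3 f"
    and c: "c \<in> carrier C" and s: "splits c m a b"
    and sa: "\<And>i. i < m \<Longrightarrow> splits (a i) (p i) (a1 i) (a2 i)"
    and sb: "\<And>i. i < m \<Longrightarrow> splits (b i) (q i) (b1 i) (b2 i)"
  shows "(\<Oplus>\<^bsub>N\<^esub>i\<in>{..<m}. \<Oplus>\<^bsub>N\<^esub>j\<in>{..<p i}. f [a1 i j, a2 i j, b i]) =
    (\<Oplus>\<^bsub>N\<^esub>i\<in>{..<m}. \<Oplus>\<^bsub>N\<^esub>j\<in>{..<q i}. f [a i, b1 i j, b2 i j])"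
proof -
  interpret N: abelian_group N by (rule N)
  let ?T = "tpow R C 3"
  interpret T: abelian_group ?T by (rule tpow_abelian_group)
  have gens3: "[x, y, z] \<in> gens 3 \<longleftrightarrow> x \<in> carrier C \<and> y \<in> carrier C \<and> z \<in> carrier C" for x y z
    by (auto simp: tpow_gens_def)
  have sum: "induced (add_monoid N) f (\<Oplus>\<^bsub>?T\<^esub>i\<in>{..<m}. \<Oplus>\<^bsub>?T\<^esub>j\<in>{..<w i}. tprod R C [x i j, y i j, z i j]) =
      (\<Oplus>\<^bsub>N\<^esub>i\<in>{..<m}. \<Oplus>\<^bsub>N\<^esub>j\<in>{..<w i}. f [x i j, y i j, z i j])"
    if xyz: "\<And>i j. \<lbrakk>i < m; j < w i\<rbrakk> \<Longrightarrow> x i j \<in> carrier C \<and> y i j \<in> carrier C \<and> z i j \<in> carrier C"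
    for w :: "nat \<Rightarrow> nat" and x y z
  proof -
    note sums = additive_finsum[OF tpow_abelian_group N tpow_lift_additive[OF N f]]
    have inner: "induced (add_monoid N) f (\<Oplus>\<^bsub>?T\<^esub>j\<in>{..<w i}. tprod R C [x i j, y i j, z i j]) =
        (\<Oplus>\<^bsub>N\<^esub>j\<in>{..<w i}. f [x i j, y i j, z i j])" if i: "i < m" for i
    proof -
      have "induced (add_monoid N) f (\<Oplus>\<^bsub>?T\<^esub>j\<in>{..<w i}. tprod R C [x i j, y i j, z i j]) =
          (\<Oplus>\<^bsub>N\<^esub>j\<in>{..<w i}. induced (add_monoid N) f (tprod R C [x i j, y i j, z i j]))"
        by (rule sums) (use xyz i in \<open>auto simp: gens3 intro!: tprod_closed\<close>)
      also have "\<dots> = (\<Oplus>\<^bsub>N\<^esub>j\<in>{..<w i}. f [x i j, y i j, z i j])"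
        by (rule N.finsum_cong')
          (use xyz i in \<open>auto simp: gens3 tpow_lift_tprod[OF N f] intro!: balanced_closed[OF f]\<close>)
      finally show ?thesis .
    qed
    have "induced (add_monoid N) f (\<Oplus>\<^bsub>?T\<^esub>i\<in>{..<m}. \<Oplus>\<^bsub>?T\<^esub>j\<in>{..<w i}. tprod R C [x i j, y i j, z i j]) =
        (\<Oplus>\<^bsub>N\<^esub>i\<in>{..<m}. induced (add_monoid N) f (\<Oplus>\<^bsub>?T\<^esub>j\<in>{..<w i}. tprod R C [x i j, y i j, z i j]))"
      by (rule sums) (use xyz in \<open>auto simp: gens3 intro!: tprod_closed T.finsum_closed\<close>)
    also have "\<dots> = (\<Oplus>\<^bsub>N\<^esub>i\<in>{..<m}. \<Oplus>\<^bsub>N\<^esub>j\<in>{..<w i}. f [x i j, y i j, z i j])"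
      by (rule N.finsum_cong')
        (use xyz in \<open>auto simp: gens3 inner intro!: N.finsum_closed balanced_closed[OF f]\<close>)
    finally show ?thesis .
  qed
  have "(\<Oplus>\<^bsub>N\<^esub>i\<in>{..<m}. \<Oplus>\<^bsub>N\<^esub>j\<in>{..<p i}. f [a1 i j, a2 i j, b i]) = induced (add_monoid N) f
      (\<Oplus>\<^bsub>?T\<^esub>i\<in>{..<m}. \<Oplus>\<^bsub>?T\<^esub>j\<in>{..<p i}. tprod R C [a1 i j, a2 i j, b i])"
    using sweedler_closed[OF s] sweedler_closed[OF sa] by (intro sum[symmetric]) simp
  also have "\<dots> = induced (add_monoid N) f
      (\<Oplus>\<^bsub>?T\<^esub>i\<in>{..<m}. \<Oplus>\<^bsub>?T\<^esub>j\<in>{..<q i}. tprod R C [a i, b1 i j, b2 i j])"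
    by (simp only: coassoc[OF c s sa sb])
  also have "\<dots> = (\<Oplus>\<^bsub>N\<^esub>i\<in>{..<m}. \<Oplus>\<^bsub>N\<^esub>j\<in>{..<q i}. f [a i, b1 i j, b2 i j])"
    using sweedler_closed[OF s] sweedler_closed[OF sb] by (intro sum) simp
  finally show ?thesis .
qed

section \<open>Construction of the operators on words\<close>

text \<open>This is the well-definedness of \<open>\<delta>\<^sub>0\<close>.  Each relation at letter \<open>0\<close> is transferred to
  the two new letters by bilinearity of \<open>\<Delta>\<close>: a scalar on the left of \<open>c\<close> passes to \<open>c\<^bsup>(1)\<^esup>\<close>, one
  on the right passes to \<open>c\<^bsup>(2)\<^esup>\<close>.  Relations that do not involve letter \<open>0\<close> hold summand by
  summand, for a fixed decomposition of \<open>\<Delta>(c)\<close>.\<close>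

lemma cyclically_balanced_coproduct:
  assumes N: "abelian_group N" and g: "cyclically_balanced R C N (Suc (Suc n)) g"
  defines "f \<equiv> \<lambda>cs. induced (add_monoid N) (\<lambda>ps. g (ps @ tl cs)) (\<Delta> (hd cs))"
  shows "cyclically_balanced R C N (Suc n) f"
    and "\<lbrakk>c # cs \<in> gens (Suc n); splits c m a b\<rbrakk> \<Longrightarrow>
      f (c # cs) = (\<Oplus>\<^bsub>N\<^esub>l\<in>{..<m}. g (a l # b l # cs))"
proof -
  interpret N: abelian_group N by (rule N)
  note bal = cyclically_balancedD(1)[OF g]
  have bal2: "balanced R C N 2 (\<lambda>ps. g (ps @ cs))" if "cs \<in> gens n" for cs
    using balanced_context[OF bal, of "[]" 2 cs] that by (auto simp: tpow_gens_def)
  show f_sum: "f (c # cs) = (\<Oplus>\<^bsub>N\<^esub>l\<in>{..<m}. g (a l # b l # cs))"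
    if "c # cs \<in> gens (Suc n)" "splits c m a b" for c cs m a b
    using that induced_coproduct_sum[OF N bal2, of cs c m a b] by (simp add: f_def)
  have closed: "g (a l # b l # cs) \<in> carrier N"
    if "cs \<in> gens n" "splits c m a b" "l < m" for cs c m a b l
    using that sweedler_closed[OF that(2,3)] by (intro balanced_closed[OF bal]) simp
  show "cyclically_balanced R C N (Suc n) f"
  proof (intro cyclically_balancedI balanced_ConsI)
    fix c assume c: "c \<in> carrier C"
    obtain m a b where s: "splits c m a b"
      using sweedler_exists[OF c] .
    have "balanced R C N n (\<lambda>cs. g ([a l, b l] @ cs @ []))" if "l \<in> {..<m}" for l
      using that sweedler_closed[OF s] by (intro balanced_context[OF bal]) auto
    then have "balanced R C N n (\<lambda>cs. \<Oplus>\<^bsub>N\<^esub>l\<in>{..<m}. g ([a l, b l] @ cs @ []))"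
      by (rule balanced_finsum[OF N])
    then show "balanced R C N n (\<lambda>cs. f (c # cs))"
      by (rule balanced_cong) (simp add: f_sum[OF _ s] c)
  next
    show "f ((x \<oplus>\<^bsub>C\<^esub> y) # vs) = f (x # vs) \<oplus>\<^bsub>N\<^esub> f (y # vs)"
      if "x \<in> carrier C" "y \<in> carrier C" "vs \<in> gens n" for x y vs
      using that additive_add[OF additive_comp[OF coproduct_additive tpow_lift_additive[OF N bal2]]]
      by (simp add: f_def)
  next
    fix x r y vs
    assume x: "x \<in> carrier C" and y: "y # vs \<in> gens n" and r: "r \<in> carrier R"
    then have ry: "(r \<bullet> y) # vs \<in> gens n"
      by (auto simp: tpow_gens_def lact_closed)
    obtain m a b where s: "splits x m a b"
      using sweedler_exists[OF x] .
    have "(\<Oplus>\<^bsub>N\<^esub>l\<in>{..<m}. g (a l # (b l \<star> r) # y # vs)) = (\<Oplus>\<^bsub>N\<^esub>l\<in>{..<m}. g (a l # b l # (r \<bullet> y) # vs))"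
      using y ry r s sweedler_closed[OF s] balanced_swap[OF bal, of "[a _]" "b _" y vs r]
      by (intro N.finsum_cong') (auto simp: closed)
    then show "f ((x \<star> r) # y # vs) = f (x # (r \<bullet> y) # vs)"
      using x y ry r s sweedler_ract[OF s x r] by (simp add: f_sum ract_closed)
  next
    fix x r assume "[x] \<in> gens (Suc n)" and r: "r \<in> carrier R"
    then have x: "x \<in> carrier C" and n: "n = 0"
      by auto
    obtain m a b where s: "splits x m a b"
      using sweedler_exists[OF x] .
    have "(\<Oplus>\<^bsub>N\<^esub>l\<in>{..<m}. g [r \<bullet> a l, b l]) = (\<Oplus>\<^bsub>N\<^esub>l\<in>{..<m}. g [a l, b l \<star> r])"
      using n r sweedler_closed[OF s] cyclically_balancedD(3)[OF g, of "a _" "[]" "b _" r]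
        balanced_closed[OF bal, of "[a _, b _ \<star> r]"]
      by (intro N.finsum_cong') (auto simp: ract_closed)
    then show "f [r \<bullet> x] = f [x \<star> r]"
      using n x r f_sum[OF _ sweedler_lact[OF s x r], of "[]"] f_sum[OF _ sweedler_ract[OF s x r], of "[]"]
      by (simp add: lact_closed ract_closed)
  next
    fix x us y r assume xy: "x # us @ [y] \<in> gens (Suc n)" and r: "r \<in> carrier R"
    then have x: "x \<in> carrier C" and t: "us @ [y] \<in> gens n" "us @ [y \<star> r] \<in> gens n"
      by (auto simp: tpow_gens_def ract_closed)
    obtain m a b where s: "splits x m a b"
      using sweedler_exists[OF x] .
    have "(\<Oplus>\<^bsub>N\<^esub>l\<in>{..<m}. g ((r \<bullet> a l) # b l # us @ [y])) = (\<Oplus>\<^bsub>N\<^esub>l\<in>{..<m}. g (a l # b l # us @ [y \<star> r]))"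
      using t r s sweedler_closed[OF s] cyclically_balancedD(3)[OF g, of "a _" "b _ # us" y r]
      by (intro N.finsum_cong') (auto simp: closed)
    then show "f ((r \<bullet> x) # us @ [y]) = f (x # us @ [y \<star> r])"
      using x t r s f_sum[OF _ sweedler_lact[OF s x r]] by (simp add: f_sum lact_closed)
  qed
qed

lemma counit:
  shows counit_closed: "c \<in> carrier C \<Longrightarrow> \<epsilon> c \<in> carrier R"
    and counit_add: "\<lbrakk>c \<in> carrier C; d \<in> carrier C\<rbrakk> \<Longrightarrow> \<epsilon> (c \<oplus>\<^bsub>C\<^esub> d) = \<epsilon> c \<oplus>\<^bsub>R\<^esub> \<epsilon> d"
    and counit_lact: "\<lbrakk>r \<in> carrier R; c \<in> carrier C\<rbrakk> \<Longrightarrow> \<epsilon> (r \<bullet> c) = r \<otimes>\<^bsub>R\<^esub> \<epsilon> c"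
    and counit_ract: "\<lbrakk>r \<in> carrier R; c \<in> carrier C\<rbrakk> \<Longrightarrow> \<epsilon> (c \<star> r) = \<epsilon> c \<otimes>\<^bsub>R\<^esub> r"
  using counit_hom by (auto simp: bimodule_hom_def self_bimodule_def)

text \<open>This is the well-definedness of \<open>\<sigma>\<^sub>0\<close>: the bilinearity of \<open>\<epsilon>\<close> makes scalars pass
  through \<open>x \<epsilon>(y)\<close> from either side.\<close>

lemma cyclically_balanced_counit:
  assumes g: "cyclically_balanced R C N (Suc n) g"
  shows "cyclically_balanced R C N (Suc (Suc n))
    (\<lambda>cs. g ((hd cs \<star> \<epsilon> (hd (tl cs))) # tl (tl cs)))" (is "cyclically_balanced R C N _ ?f")
proof -
  note bal = cyclically_balancedD(1)[OF g]
  note closed = lact_closed ract_closed counit_closed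
  show ?thesis
  proof (intro cyclically_balancedI balanced_ConsI)
    fix u v assume u: "u \<in> carrier C" and v: "v \<in> carrier C"
    show "balanced R C N n (\<lambda>cs. ?f (u # v # cs))"
      using balanced_context[OF bal, of "[u \<star> \<epsilon> v]" n "[]"] u v by (simp add: closed)
  next
    show "?f (u # (x \<oplus>\<^bsub>C\<^esub> y) # vs) = ?f (u # x # vs) \<oplus>\<^bsub>N\<^esub> ?f (u # y # vs)"
      if "u \<in> carrier C" "x \<in> carrier C" "y \<in> carrier C" "vs \<in> gens n" for u x y vs
      using that balanced_add[OF bal, of "[]" "u \<star> \<epsilon> x" vs "u \<star> \<epsilon> y"]
      by (simp add: closed counit_add add_ract)
    show "?f (u # (x \<star> r) # y # vs) = ?f (u # x # (r \<bullet> y) # vs)"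
      if "u \<in> carrier C" "x \<in> carrier C" "y # vs \<in> gens n" "r \<in> carrier R" for u x r y vs
      using that balanced_swap[OF bal, of "[]" "u \<star> \<epsilon> x" y vs r]
      by (simp add: closed counit_ract mult_ract)
  next
    show "?f ((x \<oplus>\<^bsub>C\<^esub> y) # vs) = ?f (x # vs) \<oplus>\<^bsub>N\<^esub> ?f (y # vs)"
      if "x \<in> carrier C" "y \<in> carrier C" "vs \<in> gens (Suc n)" for x y vs
      using that balanced_add[OF bal, of "[]" "x \<star> \<epsilon> (hd vs)" "tl vs" "y \<star> \<epsilon> (hd vs)"]
      by (cases vs) (simp_all add: closed ract_add)
    show "?f ((x \<star> r) # y # vs) = ?f (x # (r \<bullet> y) # vs)"
      if "x \<in> carrier C" "y # vs \<in> gens (Suc n)" "r \<in> carrier R" for x r y vs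
      using that by (simp add: closed counit_lact mult_ract)
  next
    show "?f [r \<bullet> x] = ?f [x \<star> r]" if "[x] \<in> gens (Suc (Suc n))" for x r
      using that by simp
  next
    fix x us y r assume xy: "x # us @ [y] \<in> gens (Suc (Suc n))" and r: "r \<in> carrier R"
    show "?f ((r \<bullet> x) # us @ [y]) = ?f (x # us @ [y \<star> r])"
    proof (cases us)
      case Nil
      then show ?thesis
        using xy r cyclically_balancedD(2)[OF g, of "x \<star> \<epsilon> y" r]
        by (simp add: closed lact_ract counit_ract mult_ract)
    next
      case (Cons v us')
      then show ?thesis
        using xy r cyclically_balancedD(3)[OF g, of "x \<star> \<epsilon> v" us' y r]
        by (simp add: closed lact_ract)
    qed
  qed
qed

definition coface_on_words where
  "coface_on_words n i d \<longleftrightarrow> d \<in> linear_maps K (Ch n) (Ch (Suc n)) \<and>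
    (\<forall>us c vs m a b. length us = i \<longrightarrow> us @ c # vs \<in> gens (Suc n) \<longrightarrow> splits c m a b \<longrightarrow>
      d (word (us @ c # vs)) = word_sum (Suc n) m (\<lambda>l. us @ a l # b l # vs))"

text \<open>There is no letter of index \<open>n + 1\<close> to be split, so the last coface needs a formula of its
  own, that of \<open>\<tau> \<delta>\<^sub>0\<close>.\<close>

definition last_coface_on_words where
  "last_coface_on_words n d \<longleftrightarrow> d \<in> linear_maps K (Ch n) (Ch (Suc n)) \<and>
    (\<forall>c vs m a b. c # vs \<in> gens (Suc n) \<longrightarrow> splits c m a b \<longrightarrow>
      d (word (c # vs)) = word_sum (Suc n) m (\<lambda>l. b l # vs @ [a l]))"

text \<open>The scalar \<open>\<epsilon>(y)\<close> is absorbed by the letter on its left.  Such a letter always exists,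
  since letter \<open>0\<close> is never contracted itself; so one formula covers all degrees and positions.\<close>

definition codegeneracy_on_words where
  "codegeneracy_on_words n j s \<longleftrightarrow> s \<in> linear_maps K (Ch (Suc n)) (Ch n) \<and>
    (\<forall>us x y vs. length us = j \<longrightarrow> us @ x # y # vs \<in> gens (Suc (Suc n)) \<longrightarrow>
      s (word (us @ x # y # vs)) = word (us @ (x \<star> \<epsilon> y) # vs))"

lemma coface_on_words_sum:
  "\<lbrakk>coface_on_words n i d; length us = i; us @ c # vs \<in> gens (Suc n); splits c m a b\<rbrakk> \<Longrightarrow>
    d (word (us @ c # vs)) = word_sum (Suc n) m (\<lambda>l. us @ a l # b l # vs)"
  by (simp add: coface_on_words_def)

lemma last_coface_on_words_sum:
  "\<lbrakk>last_coface_on_words n d; c # vs \<in> gens (Suc n); splits c m a b\<rbrakk> \<Longrightarrow>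
    d (word (c # vs)) = word_sum (Suc n) m (\<lambda>l. b l # vs @ [a l])"
  by (simp add: last_coface_on_words_def)

lemma codegeneracy_on_words_word:
  "\<lbrakk>codegeneracy_on_words n j s; length us = j; us @ x # y # vs \<in> gens (Suc (Suc n))\<rbrakk> \<Longrightarrow>
    s (word (us @ x # y # vs)) = word (us @ (x \<star> \<epsilon> y) # vs)"
  by (simp add: codegeneracy_on_words_def)

lemma Ch_abelian: "abelian_group (Ch n)"
  by (rule cochains_abelian_group)

lemma coface_0_exists: "\<exists>d. coface_on_words n 0 d"
proof -
  interpret X: module K "Ch (Suc n)" by (rule cochains_module)
  note cb = cyclically_balanced_coproduct[OF Ch_abelian word_cyclically_balanced[of "Suc n"]]
  let ?f = "\<lambda>cs. induced (add_monoid (Ch (Suc n))) (\<lambda>ps. word (ps @ tl cs)) (\<Delta> (hd cs))"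
  have "?f (((k \<odot>\<^bsub>R\<^esub> \<one>\<^bsub>R\<^esub>) \<bullet> c) # cs) = k \<odot>\<^bsub>Ch (Suc n)\<^esub> ?f (c # cs)"
    if k: "k \<in> carrier K" and cs: "c # cs \<in> gens (Suc n)" for k c cs
  proof -
    have c: "c \<in> carrier C"
      using cs by simp
    obtain m a b where s: "splits c m a b"
      using sweedler_exists[OF c] .
    note k1 = ground_closed[OF k]
    have t: "a l # b l # cs \<in> gens (Suc (Suc n))" if "l < m" for l
      using sweedler_closed[OF s that] cs by simp
    have "?f (((k \<odot>\<^bsub>R\<^esub> \<one>\<^bsub>R\<^esub>) \<bullet> c) # cs) = word_sum (Suc n) m (\<lambda>l. ((k \<odot>\<^bsub>R\<^esub> \<one>\<^bsub>R\<^esub>) \<bullet> a l) # b l # cs)"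
      using cs lact_closed[OF k1 c] by (intro cb(2) sweedler_lact[OF s c k1]) simp
    also have "\<dots> = (\<Oplus>\<^bsub>Ch (Suc n)\<^esub>l\<in>{..<m}. k \<odot>\<^bsub>Ch (Suc n)\<^esub> word (a l # b l # cs))"
      by (rule X.M.finsum_cong') (use t k smult_word[OF k t] word_closed[OF t] in auto)
    also have "\<dots> = k \<odot>\<^bsub>Ch (Suc n)\<^esub> (word_sum (Suc n) m (\<lambda>l. a l # b l # cs))"
      by (rule additive_finsum[OF Ch_abelian Ch_abelian X.smult_additive[OF k], symmetric])
        (use word_closed[OF t] in auto)
    also have "(word_sum (Suc n) m (\<lambda>l. a l # b l # cs)) = ?f (c # cs)"
      by (rule cb(2)[OF cs s, symmetric])
    finally show ?thesis .
  qed
  from words_lift[OF cochains_module cb(1) this]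
  obtain d where d: "d \<in> linear_maps K (Ch n) (Ch (Suc n))"
    "\<And>cs. cs \<in> gens (Suc n) \<Longrightarrow> d (word cs) = ?f cs"
    by blast
  have "coface_on_words n 0 d"
    unfolding coface_on_words_def using d cb(2) by simp
  then show ?thesis by blast
qed

lemma codegeneracy_0_exists: "\<exists>s. codegeneracy_on_words n 0 s"
proof -
  let ?f = "\<lambda>cs. word ((hd cs \<star> \<epsilon> (hd (tl cs))) # tl (tl cs))"
  have "?f (((k \<odot>\<^bsub>R\<^esub> \<one>\<^bsub>R\<^esub>) \<bullet> c) # cs) = k \<odot>\<^bsub>Ch n\<^esub> ?f (c # cs)"
    if k: "k \<in> carrier K" and cs: "c # cs \<in> gens (Suc (Suc n))" for k c cs
  proof -
    obtain y ds where "cs = y # ds" "y \<in> carrier C" "ds \<in> gens n" "c \<in> carrier C"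
      using cs by (cases cs) auto
    then show ?thesis
      using k by (simp add: lact_ract ract_closed counit_closed ground_closed smult_word)
  qed
  from words_lift[OF cochains_module cyclically_balanced_counit[OF word_cyclically_balanced] this]
  obtain s where s: "s \<in> linear_maps K (Ch (Suc n)) (Ch n)"
    "\<And>cs. cs \<in> gens (Suc (Suc n)) \<Longrightarrow> s (word cs) = ?f cs"
    by blast
  then have "codegeneracy_on_words n 0 s"
    unfolding codegeneracy_on_words_def by simp
  then show ?thesis by blast
qed

lemma rotate_prefix: "length us = i \<Longrightarrow> rotate i (us @ vs) = vs @ us"
  using rotate_append[of us vs] by simp

lemma rotation_map_sum:
  assumes t: "rotation_map n i t" and w: "\<And>l. l < m \<Longrightarrow> w l \<in> gens (Suc n)"
  shows "t (word_sum n m (\<lambda>l. w l)) = (\<Oplus>\<^bsub>Ch n\<^esub>l\<in>{..<m::nat}. word (rotate i (w l)))"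
proof -
  interpret X: abelian_group "Ch n" by (rule Ch_abelian)
  have lin: "t \<in> linear_maps K (Ch n) (Ch n)"
    using t by (simp add: rotation_map_def)
  have "t (word_sum n m (\<lambda>l. w l)) = (\<Oplus>\<^bsub>Ch n\<^esub>l\<in>{..<m}. t (word (w l)))"
    by (rule additive_finsum[OF Ch_abelian Ch_abelian linear_additive[OF lin]]) (use w word_closed in auto)
  also have "\<dots> = (\<Oplus>\<^bsub>Ch n\<^esub>l\<in>{..<m::nat}. word (rotate i (w l)))"
  proof (rule X.finsum_cong'[OF refl])
    have "rotate i (w l) \<in> gens (Suc n)" if "l < m" for l
      using w[OF that] by (simp add: tpow_gens_def)
    then show "(\<lambda>l. word (rotate i (w l))) \<in> {..<m} \<rightarrow> carrier (Ch n)"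
      by (auto intro: word_closed)
  qed (use t w in \<open>simp add: rotation_map_def\<close>)
  finally show ?thesis .
qed

text \<open>The letter \<open>c\<^sub>i\<close> is rotated to the front, split there, and the word is rotated back.  The
  word has \<open>n + 2\<close> letters by then, of which \<open>n + 2 - i\<close> precede the original first letter.\<close>

lemma coface_exists:
  assumes "i \<le> n"
  shows "\<exists>d. coface_on_words n i d"
proof -
  obtain t d t' where t: "rotation_map n i t" and d: "coface_on_words n 0 d"
    and t': "rotation_map (Suc n) (n + 2 - i) t'"
    using rotation_map_exists coface_0_exists by metis
  have lin: "t \<in> linear_maps K (Ch n) (Ch n)" "d \<in> linear_maps K (Ch n) (Ch (Suc n))"
    "t' \<in> linear_maps K (Ch (Suc n)) (Ch (Suc n))"
    using t d t' by (auto simp: rotation_map_def coface_on_words_def)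
  let ?d = "restrict (\<lambda>x. t' (restrict (\<lambda>x. d (t x)) (carrier (Ch n)) x)) (carrier (Ch n))"
  have "?d (word (us @ c # vs)) = word_sum (Suc n) m (\<lambda>l. us @ a l # b l # vs)"
    if us: "length us = i" and cs: "us @ c # vs \<in> gens (Suc n)"
      and s: "splits c m a b" for us c vs m a b
  proof -
    have cs': "c # vs @ us \<in> gens (Suc n)"
      using cs by (auto simp: tpow_gens_def)
    have w: "a l # b l # vs @ us \<in> gens (Suc (Suc n))" if "l < m" for l
      using cs' sweedler_closed[OF s that] by simp
    have len: "length (a l # b l # vs) = n + 2 - i" for l
      using cs us by (auto simp: tpow_gens_def)
    have "?d (word (us @ c # vs)) = t' (d (t (word (us @ c # vs))))"
      using word_closed[OF cs] by simp
    also have "t (word (us @ c # vs)) = word (c # vs @ us)"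
      using t cs us by (simp add: rotation_map_def rotate_prefix)
    also have "d \<dots> = word_sum (Suc n) m (\<lambda>l. a l # b l # vs @ us)"
      using coface_on_words_sum[OF d, of "[]"] cs' s by simp
    also have "t' \<dots> = word_sum (Suc n) m (\<lambda>l. rotate (n + 2 - i) ((a l # b l # vs) @ us))"
      using rotation_map_sum[OF t' w] by simp
    also have "\<dots> = word_sum (Suc n) m (\<lambda>l. us @ a l # b l # vs)"
      by (simp only: rotate_prefix[OF len])
    finally show ?thesis .
  qed
  moreover have "?d \<in> linear_maps K (Ch n) (Ch (Suc n))"
    by (rule linear_comp[OF cochains_module linear_comp[OF cochains_module lin(1,2)] lin(3)])
  ultimately have "coface_on_words n i ?d"
    by (simp add: coface_on_words_def)
  then show ?thesis by blast
qed

lemma last_coface_exists: "\<exists>d. last_coface_on_words n d"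
proof -
  obtain d t where d: "coface_on_words n 0 d" and t: "rotation_map (Suc n) 1 t"
    using rotation_map_exists coface_0_exists by metis
  have lin: "d \<in> linear_maps K (Ch n) (Ch (Suc n))" "t \<in> linear_maps K (Ch (Suc n)) (Ch (Suc n))"
    using d t by (auto simp: rotation_map_def coface_on_words_def)
  let ?d = "restrict (\<lambda>x. t (d x)) (carrier (Ch n))"
  have "?d (word (c # vs)) = word_sum (Suc n) m (\<lambda>l. b l # vs @ [a l])"
    if cs: "c # vs \<in> gens (Suc n)" and s: "splits c m a b" for c vs m a b
  proof -
    have w: "a l # b l # vs \<in> gens (Suc (Suc n))" if "l < m" for l
      using cs sweedler_closed[OF s that] by simp
    have "?d (word (c # vs)) = t (d (word (c # vs)))"
      using word_closed[OF cs] by simp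
    also have "d (word (c # vs)) = word_sum (Suc n) m (\<lambda>l. a l # b l # vs)"
      using coface_on_words_sum[OF d, of "[]"] cs s by simp
    also have "t \<dots> = word_sum (Suc n) m (\<lambda>l. b l # vs @ [a l])"
      using rotation_map_sum[OF t w] by simp
    finally show ?thesis .
  qed
  moreover have "?d \<in> linear_maps K (Ch n) (Ch (Suc n))"
    by (rule linear_comp[OF cochains_module lin])
  ultimately have "last_coface_on_words n ?d"
    by (simp add: last_coface_on_words_def)
  then show ?thesis by blast
qed

text \<open>The same conjugation as for the cofaces; after the contraction the word has \<open>n + 1\<close>
  letters, of which \<open>n + 1 - j\<close> have to return behind the original first \<open>j\<close> letters.\<close>

lemma codegeneracy_exists:
  assumes "j \<le> n"
  shows "\<exists>s. codegeneracy_on_words n j s"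
proof -
  obtain t s t' where t: "rotation_map (Suc n) j t" and s: "codegeneracy_on_words n 0 s"
    and t': "rotation_map n (Suc n - j) t'"
    using rotation_map_exists codegeneracy_0_exists by metis
  have lin: "t \<in> linear_maps K (Ch (Suc n)) (Ch (Suc n))" "s \<in> linear_maps K (Ch (Suc n)) (Ch n)"
    "t' \<in> linear_maps K (Ch n) (Ch n)"
    using t s t' by (auto simp: rotation_map_def codegeneracy_on_words_def)
  let ?s = "restrict (\<lambda>x. t' (restrict (\<lambda>x. s (t x)) (carrier (Ch (Suc n))) x)) (carrier (Ch (Suc n)))"
  have "?s (word (us @ x # y # vs)) = word (us @ (x \<star> \<epsilon> y) # vs)"
    if us: "length us = j" and cs: "us @ x # y # vs \<in> gens (Suc (Suc n))" for us x y vs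
  proof -
    have cs': "x # y # vs @ us \<in> gens (Suc (Suc n))"
      and cs'': "(x \<star> \<epsilon> y) # vs @ us \<in> gens (Suc n)"
      using cs by (auto simp: tpow_gens_def ract_closed counit_closed)
    have len: "length ((x \<star> \<epsilon> y) # vs) = Suc n - j"
      using cs us by (auto simp: tpow_gens_def)
    have "?s (word (us @ x # y # vs)) = t' (s (t (word (us @ x # y # vs))))"
      using word_closed[OF cs] by simp
    also have "t (word (us @ x # y # vs)) = word (x # y # vs @ us)"
      using t cs us by (simp add: rotation_map_def rotate_prefix)
    also have "s \<dots> = word ((x \<star> \<epsilon> y) # vs @ us)"
      using codegeneracy_on_words_word[OF s, of "[]"] cs' by simp
    also have "t' \<dots> = word (rotate (Suc n - j) (((x \<star> \<epsilon> y) # vs) @ us))"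
      using t' cs'' unfolding rotation_map_def by (metis append_Cons)
    also have "\<dots> = word (us @ (x \<star> \<epsilon> y) # vs)"
      by (simp only: rotate_prefix[OF len])
    finally show ?thesis .
  qed
  moreover have "?s \<in> linear_maps K (Ch (Suc n)) (Ch n)"
    by (rule linear_comp[OF cochains_module linear_comp[OF cochains_module lin(1,2)] lin(3)])
  ultimately have "codegeneracy_on_words n j ?s"
    by (simp add: codegeneracy_on_words_def)
  then show ?thesis by blast
qed

end

section \<open>The cocyclic identities\<close>

lemma split_word:
  assumes "cs \<in> tpow_gens C (Suc n)" "i \<le> n"
  obtains us c vs where "cs = us @ c # vs" "length us = i"
  using assms id_take_nth_drop[of i cs] by (auto simp: tpow_gens_def)

lemma split_word2:
  assumes "cs \<in> tpow_gens C (Suc n)" "i < j" "j \<le> n"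
  obtains us c ws d vs where "cs = us @ c # ws @ d # vs" "length us = i" "i + 1 + length ws = j"
proof -
  obtain us c zs where 1: "cs = us @ c # zs" "length us = i"
    using split_word[OF assms(1), of i] assms by auto
  then have "j - i - 1 < length zs"
    using assms by (auto simp: tpow_gens_def)
  from id_take_nth_drop[OF this] show thesis
    using that[of us c "take (j - i - 1) zs" "zs ! (j - i - 1)" "drop (Suc (j - i - 1)) zs"] 1 assms
      \<open>j - i - 1 < length zs\<close> by auto
qed

text \<open>Families of operators with the expected values on words.  Everything about them follows
  from these values, independently of how they were constructed.\<close>

locale word_operators = coring K R C \<Delta> \<epsilon>
  for K :: "('k, 'x) ring_scheme"
    and R :: "('k, 'r, 'y) module_scheme"
    and C :: "('r, 'c, 'z) bimodule_scheme"
    and \<Delta> :: "'c \<Rightarrow> 'c tp"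
    and \<epsilon> :: "'c \<Rightarrow> 'r" +
  fixes \<delta> \<sigma> :: "nat \<Rightarrow> nat \<Rightarrow> ('r, 'c) cochain \<Rightarrow> ('r, 'c) cochain"
    and \<tau> :: "nat \<Rightarrow> ('r, 'c) cochain \<Rightarrow> ('r, 'c) cochain"
  assumes coface: "i \<le> n \<Longrightarrow> coface_on_words n i (\<delta> n i)"
    and last_coface: "last_coface_on_words n (\<delta> n (Suc n))"
    and codegeneracy: "j \<le> n \<Longrightarrow> codegeneracy_on_words n j (\<sigma> (Suc n) j)"
    and rotation: "rotation_map n 1 (\<tau> n)"
begin

lemma \<delta>_linear: "i \<le> Suc n \<Longrightarrow> \<delta> n i \<in> linear_maps K (Ch n) (Ch (Suc n))"
  using coface[of i n] last_coface[of n]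
  by (auto simp: coface_on_words_def last_coface_on_words_def le_Suc_eq)

lemma \<sigma>_linear: "j \<le> n \<Longrightarrow> \<sigma> (Suc n) j \<in> linear_maps K (Ch (Suc n)) (Ch n)"
  using codegeneracy by (auto simp: codegeneracy_on_words_def)

lemma \<tau>_linear: "\<tau> n \<in> linear_maps K (Ch n) (Ch n)"
  using rotation by (auto simp: rotation_map_def)

lemmas \<delta>_additive = linear_additive[OF \<delta>_linear]
lemmas \<sigma>_additive = linear_additive[OF \<sigma>_linear]
lemmas \<tau>_additive = linear_additive[OF \<tau>_linear]
lemmas \<delta>_closed = additive_closed[OF \<delta>_additive]
lemmas \<sigma>_closed = additive_closed[OF \<sigma>_additive]

lemma \<delta>_word:
  assumes "length us = i" "us @ c # vs \<in> gens (Suc n)" "splits c m a b"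
  shows "\<delta> n i (word (us @ c # vs)) = word_sum (Suc n) m (\<lambda>l. us @ a l # b l # vs)"
proof -
  have "i \<le> n"
    using assms by (auto simp: tpow_gens_def)
  from coface_on_words_sum[OF coface[OF this] assms] show ?thesis .
qed

lemma \<delta>_last_word:
  assumes "c # vs \<in> gens (Suc n)" "splits c m a b"
  shows "\<delta> n (Suc n) (word (c # vs)) = word_sum (Suc n) m (\<lambda>l. b l # vs @ [a l])"
  by (rule last_coface_on_words_sum[OF last_coface assms])

lemma \<sigma>_word:
  assumes "length us = j" "us @ x # y # vs \<in> gens (Suc (Suc n))"
  shows "\<sigma> (Suc n) j (word (us @ x # y # vs)) = word (us @ (x \<star> \<epsilon> y) # vs)"
proof -
  have "j \<le> n"
    using assms by (auto simp: tpow_gens_def)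
  from codegeneracy_on_words_word[OF codegeneracy[OF this] assms] show ?thesis .
qed

lemma \<tau>_word: "c # cs \<in> gens (Suc n) \<Longrightarrow> \<tau> n (word (c # cs)) = word (cs @ [c])"
  using rotation[of n] by (auto simp: rotation_map_def)

lemma map_sum:
  assumes F: "F \<in> additive_maps (Ch n) (Ch p)"
    and w: "\<And>l. l < m \<Longrightarrow> w l \<in> gens (Suc n)"
    and eq: "\<And>l. l < m \<Longrightarrow> F (word (w l)) = g l"
  shows "F (\<Oplus>\<^bsub>Ch n\<^esub>l\<in>{..<m::nat}. word (w l)) = (\<Oplus>\<^bsub>Ch p\<^esub>l\<in>{..<m}. g l)"
proof -
  interpret X: abelian_group "Ch p" by (rule Ch_abelian)
  have "F (word_sum n m (\<lambda>l. w l)) = (\<Oplus>\<^bsub>Ch p\<^esub>l\<in>{..<m}. F (word (w l)))"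
    by (rule additive_finsum[OF Ch_abelian Ch_abelian F]) (use word_closed[OF w] in auto)
  also have "\<dots> = (\<Oplus>\<^bsub>Ch p\<^esub>l\<in>{..<m}. g l)"
    by (rule X.finsum_cong'[OF refl])
      (use eq additive_closed[OF F word_closed[OF w]] in \<open>simp_all add: Pi_iff\<close>)
  finally show ?thesis .
qed

text \<open>An operator applied after a coface is computed summand by summand, for any decomposition of
  \<open>\<Delta>(c)\<close>.\<close>

lemma \<delta>_then:
  assumes F: "F \<in> additive_maps (Ch (Suc n)) (Ch p)" and us: "length us = i"
    and cs: "us @ c # vs \<in> gens (Suc n)" and s: "splits c m a b"
    and eq: "\<And>l. \<lbrakk>l < m; us @ a l # b l # vs \<in> gens (Suc (Suc n))\<rbrakk> \<Longrightarrow>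
      F (word (us @ a l # b l # vs)) = g l"
  shows "F (\<delta> n i (word (us @ c # vs))) = (\<Oplus>\<^bsub>Ch p\<^esub>l\<in>{..<m}. g l)"
proof -
  have w: "us @ a l # b l # vs \<in> gens (Suc (Suc n))" if "l < m" for l
    using cs sweedler_closed[OF s that] by (auto simp: tpow_gens_def)
  show ?thesis
    unfolding \<delta>_word[OF us cs s] by (rule map_sum[OF F w eq[OF _ w]])
qed

lemma \<delta>_last_then:
  assumes F: "F \<in> additive_maps (Ch (Suc n)) (Ch p)"
    and cs: "c # vs \<in> gens (Suc n)" and s: "splits c m a b"
    and eq: "\<And>l. \<lbrakk>l < m; b l # vs @ [a l] \<in> gens (Suc (Suc n))\<rbrakk> \<Longrightarrow>
      F (word (b l # vs @ [a l])) = g l"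
  shows "F (\<delta> n (Suc n) (word (c # vs))) = (\<Oplus>\<^bsub>Ch p\<^esub>l\<in>{..<m}. g l)"
proof -
  have w: "b l # vs @ [a l] \<in> gens (Suc (Suc n))" if "l < m" for l
    using cs sweedler_closed[OF s that] by (auto simp: tpow_gens_def)
  show ?thesis
    unfolding \<delta>_last_word[OF cs s] by (rule map_sum[OF F w eq[OF _ w]])
qed

lemma sum_swap_words:
  assumes "\<And>l k. \<lbrakk>l < m; k < p\<rbrakk> \<Longrightarrow> w l k \<in> gens (Suc n)"
  shows "(\<Oplus>\<^bsub>Ch n\<^esub>l\<in>{..<m::nat}. \<Oplus>\<^bsub>Ch n\<^esub>k\<in>{..<p::nat}. word (w l k)) =
    (\<Oplus>\<^bsub>Ch n\<^esub>k\<in>{..<p}. \<Oplus>\<^bsub>Ch n\<^esub>l\<in>{..<m}. word (w l k))"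
proof -
  interpret X: abelian_group "Ch n" by (rule Ch_abelian)
  show ?thesis
    by (rule X.finsum_swap) (use word_closed[OF assms] in auto)
qed

lemmas mem = tpow_gens_def lact_closed ract_closed counit_closed

lemma sweedler_family:
  assumes "\<And>l. l < m \<Longrightarrow> x l \<in> carrier C"
  obtains p a b where "\<And>l. l < (m::nat) \<Longrightarrow> splits (x l) (p l) (a l) (b l)"
proof -
  have "\<forall>l. \<exists>p a b. l < m \<longrightarrow> splits (x l) p a b"
    using sweedler_exists[OF assms] by metis
  then obtain p a b where "\<forall>l. l < m \<longrightarrow> splits (x l) (p l) (a l) (b l)"
    by metis
  then show thesis
    using that by blast
qed

text \<open>Splitting a letter and then either half of it: coassociativity.\<close>

lemma cofaces_adjacent:
  assumes i: "i \<le> n" and x: "x \<in> carrier (Ch n)"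
  shows "\<delta> (Suc n) (Suc i) (\<delta> n i x) = \<delta> (Suc n) i (\<delta> n i x)"
proof (rule words_ext[OF Ch_abelian additive_comp[OF \<delta>_additive \<delta>_additive]
      additive_comp[OF \<delta>_additive \<delta>_additive] _ x])
  fix cs assume cs: "cs \<in> gens (Suc n)"
  obtain us c vs where eq: "cs = us @ c # vs" and us: "length us = i"
    using split_word[OF cs i] .
  have c: "c \<in> carrier C"
    using cs eq by (auto simp: mem)
  obtain m a b where s: "splits c m a b"
    using sweedler_exists[OF c] .
  obtain p a1 a2 where sa: "\<And>l. l < m \<Longrightarrow> splits (a l) (p l) (a1 l) (a2 l)"
    using sweedler_family sweedler_closed(1)[OF s] by blast
  obtain q b1 b2 where sb: "\<And>l. l < m \<Longrightarrow> splits (b l) (q l) (b1 l) (b2 l)"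
    using sweedler_family sweedler_closed(2)[OF s] by blast
  note mem = cs[unfolded eq]
  have "\<delta> (Suc n) i (\<delta> n i (word cs)) =
      (\<Oplus>\<^bsub>Ch (Suc (Suc n))\<^esub>l\<in>{..<m}. \<Oplus>\<^bsub>Ch (Suc (Suc n))\<^esub>j\<in>{..<p l}. word (us @ [a1 l j, a2 l j, b l] @ vs))"
    unfolding eq by (rule \<delta>_then[OF \<delta>_additive us mem s]) (use i \<delta>_word[OF us _ sa] in simp_all)
  moreover have "\<delta> (Suc n) (Suc i) (\<delta> n i (word cs)) =
      (\<Oplus>\<^bsub>Ch (Suc (Suc n))\<^esub>l\<in>{..<m}. \<Oplus>\<^bsub>Ch (Suc (Suc n))\<^esub>j\<in>{..<q l}. word (us @ [a l, b1 l j, b2 l j] @ vs))"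
    unfolding eq by (rule \<delta>_then[OF \<delta>_additive us mem s])
      (use i us \<delta>_word[of "us @ [a _]" "Suc i" "b _" vs "Suc n", OF _ _ sb] in simp_all)
  moreover have "balanced R C (Ch (Suc (Suc n))) 3 (\<lambda>ps. word (us @ ps @ vs))"
    by (rule balanced_context[OF word_balanced]) (use mem in \<open>auto simp: tpow_gens_def\<close>)
  note coassoc_sum[OF Ch_abelian this c s sa sb]
  ultimately show "\<delta> (Suc n) (Suc i) (\<delta> n i (word cs)) = \<delta> (Suc n) i (\<delta> n i (word cs))"
    by simp
qed (use i in auto)

text \<open>Splitting two different letters: both orders give the same double sum.  The second letter
  has moved by one position when the first one is split before it.\<close>

lemma cofaces_distant:
  assumes ij: "i < j" "j \<le> n" and x: "x \<in> carrier (Ch n)"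
  shows "\<delta> (Suc n) (Suc j) (\<delta> n i x) = \<delta> (Suc n) i (\<delta> n j x)"
proof (rule words_ext[OF Ch_abelian additive_comp[OF \<delta>_additive \<delta>_additive]
      additive_comp[OF \<delta>_additive \<delta>_additive] _ x])
  fix cs assume cs: "cs \<in> gens (Suc n)"
  obtain us c ws d vs where eq: "cs = us @ c # ws @ d # vs"
    and len: "length us = i" "i + 1 + length ws = j"
    using split_word2[OF cs ij] .
  have cd: "c \<in> carrier C" "d \<in> carrier C"
    using cs eq by (auto simp: mem)
  obtain m a b where s: "splits c m a b"
    using sweedler_exists[OF cd(1)] .
  obtain p a' b' where t: "splits d p a' b'"
    using sweedler_exists[OF cd(2)] .
  note mem' = cs[unfolded eq]
  have w: "us @ a l # b l # ws @ a' k # b' k # vs \<in> gens (Suc (Suc (Suc n)))"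
    if "l < m" "k < p" for l k
    using mem' sweedler_closed[OF s that(1)] sweedler_closed[OF t that(2)] by (auto simp: tpow_gens_def)
  have "\<delta> (Suc n) (Suc j) (\<delta> n i (word cs)) = (\<Oplus>\<^bsub>Ch (Suc (Suc n))\<^esub>l\<in>{..<m}.
      \<Oplus>\<^bsub>Ch (Suc (Suc n))\<^esub>k\<in>{..<p}. word (us @ a l # b l # ws @ a' k # b' k # vs))"
    unfolding eq by (rule \<delta>_then[OF \<delta>_additive len(1) mem' s])
      (use ij len \<delta>_word[of "us @ a _ # b _ # ws" "Suc j" d vs "Suc n", OF _ _ t] in simp_all)
  also have "\<dots> = (\<Oplus>\<^bsub>Ch (Suc (Suc n))\<^esub>k\<in>{..<p}. \<Oplus>\<^bsub>Ch (Suc (Suc n))\<^esub>l\<in>{..<m}.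
      word (us @ a l # b l # ws @ a' k # b' k # vs))"
    by (rule sum_swap_words[OF w])
  also have "\<dots> = \<delta> (Suc n) i (\<delta> n j (word ((us @ c # ws) @ d # vs)))"
    by (rule \<delta>_then[OF \<delta>_additive _ _ t, symmetric])
      (use ij len mem' \<delta>_word[OF len(1) _ s] in simp_all)
  finally show "\<delta> (Suc n) (Suc j) (\<delta> n i (word cs)) = \<delta> (Suc n) i (\<delta> n j (word cs))"
    by (simp add: eq)
qed (use ij in auto)

lemma cofaces_commute:
  assumes "i < j" "j \<le> Suc n" "x \<in> carrier (Ch n)"
  shows "\<delta> (Suc n) j (\<delta> n i x) = \<delta> (Suc n) i (\<delta> n (j - 1) x)"
proof (cases "j = Suc i")
  case True
  then show ?thesis
    using cofaces_adjacent assms by simp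
next
  case False
  then obtain j' where "j = Suc j'" "i < j'"
    using assms by (cases j) auto
  then show ?thesis
    using cofaces_distant assms by simp
qed

lemma \<tau>_\<delta>_0:
  assumes x: "x \<in> carrier (Ch n)"
  shows "\<tau> (Suc n) (\<delta> n 0 x) = \<delta> n (Suc n) x"
proof (rule words_ext[OF Ch_abelian additive_comp[OF \<delta>_additive \<tau>_additive] \<delta>_additive _ x])
  fix cs assume cs: "cs \<in> gens (Suc n)"
  obtain c vs where eq: "cs = c # vs"
    using cs by (cases cs) auto
  obtain m a b where s: "splits c m a b"
    using sweedler_exists cs eq by (metis tpow_gens_Cons)
  note mem = cs[unfolded eq]
  have "\<tau> (Suc n) (\<delta> n 0 (word ([] @ c # vs))) = word_sum (Suc n) m (\<lambda>l. b l # vs @ [a l])"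
    by (rule \<delta>_then[OF \<tau>_additive _ _ s]) (use mem \<tau>_word[of "a _" "b _ # vs" "Suc n"] in simp_all)
  also have "\<dots> = \<delta> n (Suc n) (word cs)"
    using \<delta>_last_word[OF mem s] by (simp add: eq)
  finally show "\<tau> (Suc n) (\<delta> n 0 (word cs)) = \<delta> n (Suc n) (word cs)"
    by (simp add: eq)
qed auto

text \<open>For the last coface both sides send \<open>c\<^sub>0 \<dots> c\<^sub>n\<close> to \<open>c\<^sub>1 \<dots> c\<^sub>n c\<^sub>0\<^bsup>(1)\<^esup> c\<^sub>0\<^bsup>(2)\<^esup>\<close>.\<close>

lemma \<tau>_\<delta>:
  assumes i: "1 \<le> i" "i \<le> Suc n" and x: "x \<in> carrier (Ch n)"
  shows "\<tau> (Suc n) (\<delta> n i x) = \<delta> n (i - 1) (\<tau> n x)"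
proof (rule words_ext[OF Ch_abelian additive_comp[OF \<delta>_additive \<tau>_additive]
      additive_comp[OF \<tau>_additive \<delta>_additive] _ x])
  fix cs assume cs: "cs \<in> gens (Suc n)"
  show "\<tau> (Suc n) (\<delta> n i (word cs)) = \<delta> n (i - 1) (\<tau> n (word cs))"
  proof (cases "i = Suc n")
    case True
    obtain c vs where eq: "cs = c # vs"
      using cs by (cases cs) auto
    obtain m a b where s: "splits c m a b"
      using sweedler_exists cs eq by (metis tpow_gens_Cons)
    have "\<tau> (Suc n) (\<delta> n (Suc n) (word cs)) = word_sum (Suc n) m (\<lambda>l. vs @ a l # b l # [])"
      unfolding eq by (rule \<delta>_last_then[OF \<tau>_additive cs[unfolded eq] s])
        (use \<tau>_word[of "b _" "vs @ [a _]" "Suc n"] in simp_all)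
    also have "\<dots> = \<delta> n n (word (vs @ [c]))"
      by (rule \<delta>_word[OF _ _ s, symmetric]) (use cs eq in \<open>auto simp: mem\<close>)
    also have "word (vs @ [c]) = \<tau> n (word cs)"
      using \<tau>_word cs by (simp add: eq)
    finally show ?thesis
      using True by simp
  next
    case False
    then have "0 < i" "i \<le> n"
      using i by auto
    from split_word2[OF cs this] obtain us u ws c vs where
      "cs = us @ u # ws @ c # vs" "length us = 0" "0 + 1 + length ws = i" .
    then have eq: "cs = u # ws @ c # vs" and len: "Suc (length ws) = i"
      by auto
    have c: "c \<in> carrier C"
      using cs eq by (auto simp: mem)
    obtain m a b where s: "splits c m a b"
      using sweedler_exists[OF c] .
    have "\<tau> (Suc n) (\<delta> n i (word ((u # ws) @ c # vs))) =
        word_sum (Suc n) m (\<lambda>l. ws @ a l # b l # vs @ [u])"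
      by (rule \<delta>_then[OF \<tau>_additive _ _ s])
        (use cs eq len \<tau>_word[of u "ws @ a _ # b _ # vs" "Suc n"] in simp_all)
    also have "\<dots> = \<delta> n (i - 1) (word (ws @ c # vs @ [u]))"
      by (rule \<delta>_word[OF _ _ s, symmetric]) (use cs eq len in \<open>auto simp: mem\<close>)
    also have "word (ws @ c # vs @ [u]) = \<tau> n (word cs)"
      using \<tau>_word[of u "ws @ c # vs" n] cs by (simp add: eq)
    finally show ?thesis
      by (simp add: eq)
  qed
qed (use i in auto)

text \<open>With \<open>\<delta>\<^bsub>n+2\<^esub> = \<tau> \<delta>\<^sub>0\<close> the claim becomes
  \<open>\<tau> \<delta>\<^sub>0 \<delta>\<^sub>i = \<tau> \<delta>\<^bsub>i+1\<^esub> \<delta>\<^sub>0 = \<delta>\<^sub>i \<tau> \<delta>\<^sub>0 = \<delta>\<^sub>i \<delta>\<^bsub>n+1\<^esub>\<close> for \<open>i \<le> n\<close>.  The first equality would be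
  circular for \<open>i = n + 1\<close>; there both sides are \<open>\<tau> \<tau> \<delta>\<^sub>0 \<delta>\<^sub>0\<close>, by \<open>\<delta>\<^sub>1 \<delta>\<^sub>0 = \<delta>\<^sub>0 \<delta>\<^sub>0\<close>.\<close>

lemma last_cofaces_commute:
  assumes i: "i \<le> Suc n" and x: "x \<in> carrier (Ch n)"
  shows "\<delta> (Suc n) (Suc (Suc n)) (\<delta> n i x) = \<delta> (Suc n) i (\<delta> n (Suc n) x)"
proof -
  note c = \<delta>_closed[OF _ x] and c0 = \<delta>_closed[OF le0 x]
  have last: "\<delta> (Suc n) (Suc (Suc n)) (\<delta> n i x) = \<tau> (Suc (Suc n)) (\<delta> (Suc n) 0 (\<delta> n i x))"
    using \<tau>_\<delta>_0[OF c[OF i]] by simp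
  have move: "\<tau> (Suc (Suc n)) (\<delta> (Suc n) (Suc k) (\<delta> n 0 x)) = \<delta> (Suc n) k (\<delta> n (Suc n) x)"
    if "k \<le> Suc n" for k
    using \<tau>_\<delta>[of "Suc k" "Suc n", OF _ _ c0] \<tau>_\<delta>_0[OF x] that by simp
  show ?thesis
  proof (cases "i = Suc n")
    case False
    then have "\<delta> (Suc n) 0 (\<delta> n i x) = \<delta> (Suc n) (Suc i) (\<delta> n 0 x)"
      using cofaces_commute[of 0 "Suc i" n x] i x by simp
    then show ?thesis
      using last move[OF i] by simp
  next
    case True
    have "\<delta> (Suc n) 0 (\<delta> n (Suc n) x) = \<tau> (Suc (Suc n)) (\<delta> (Suc n) (Suc 0) (\<delta> n 0 x))"
      using move[of 0] by simp
    also have "\<delta> (Suc n) (Suc 0) (\<delta> n 0 x) = \<delta> (Suc n) 0 (\<delta> n 0 x)"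
      using cofaces_commute[of 0 1 n x] x by simp
    also have "\<tau> (Suc (Suc n)) (\<delta> (Suc n) 0 (\<delta> n 0 x)) = \<delta> (Suc n) (Suc (Suc n)) (\<delta> n 0 x)"
      by (rule \<tau>_\<delta>_0[OF c0])
    finally show ?thesis
      using last move[of "Suc n"] True by simp
  qed
qed

text \<open>Contracting overlapping letters \<open>x y z\<close> compares \<open>x \<epsilon>(y) \<epsilon>(z)\<close> with \<open>x \<epsilon>(y \<epsilon>(z))\<close>,
  which agree by right linearity of \<open>\<epsilon>\<close>.\<close>

lemma codegeneracies_commute:
  assumes ij: "i \<le> j" "j \<le> n" and x: "x \<in> carrier (Ch (Suc (Suc n)))"
  shows "\<sigma> (Suc n) j (\<sigma> (Suc (Suc n)) i x) = \<sigma> (Suc n) i (\<sigma> (Suc (Suc n)) (Suc j) x)"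
proof (rule words_ext[OF Ch_abelian additive_comp[OF \<sigma>_additive \<sigma>_additive]
      additive_comp[OF \<sigma>_additive \<sigma>_additive] _ x])
  fix cs assume cs: "cs \<in> gens (Suc (Suc (Suc n)))"
  show "\<sigma> (Suc n) j (\<sigma> (Suc (Suc n)) i (word cs)) = \<sigma> (Suc n) i (\<sigma> (Suc (Suc n)) (Suc j) (word cs))"
  proof (cases "i = j")
    case True
    obtain us x ws z vs where eq: "cs = us @ x # ws @ z # vs" "length us = i" "i + 1 + length ws = Suc (Suc i)"
      by (rule split_word2[OF cs, of i "Suc (Suc i)"]) (use ij True in auto)
    then obtain y where ws: "ws = [y]"
      by (auto simp: length_Suc_conv)
    have mems: "x \<in> carrier C" "y \<in> carrier C" "z \<in> carrier C"
      using cs eq ws by (auto simp: mem)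
    have "\<sigma> (Suc n) j (\<sigma> (Suc (Suc n)) i (word cs)) = word (us @ ((x \<star> \<epsilon> y) \<star> \<epsilon> z) # vs)"
      using cs eq ws True \<sigma>_word[of us i x y "z # vs" "Suc n"]
        \<sigma>_word[of us i "x \<star> \<epsilon> y" z vs n] by (auto simp: mem)
    moreover have "\<sigma> (Suc n) i (\<sigma> (Suc (Suc n)) (Suc j) (word cs)) = word (us @ (x \<star> \<epsilon> (y \<star> \<epsilon> z)) # vs)"
      using cs eq ws True \<sigma>_word[of "us @ [x]" "Suc i" y z vs "Suc n"]
        \<sigma>_word[of us i x "y \<star> \<epsilon> z" vs n] by (auto simp: mem)
    ultimately show ?thesis
      using mems by (simp add: counit_ract counit_closed mult_ract)
  next
    case False
    obtain us x ws' v vs where eq': "cs = us @ x # ws' @ v # vs" "length us = i" "i + 1 + length ws' = Suc (Suc j)"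
      by (rule split_word2[OF cs, of i "Suc (Suc j)"]) (use ij False in auto)
    \<comment> \<open>Since \<open>i < j\<close>, at least two letters lie strictly between the positions \<open>i\<close> and \<open>j + 2\<close>.\<close>
    obtain y ws u where ws': "ws' = y # ws @ [u]"
      using eq'(3) ij False by (cases ws'; cases "tl ws'" rule: rev_cases) auto
    have eq: "cs = us @ x # y # ws @ u # v # vs" and len: "length us = i" "i + 1 + length ws = j"
      using eq' ws' by auto
    have "\<sigma> (Suc n) j (\<sigma> (Suc (Suc n)) i (word cs)) = word (us @ (x \<star> \<epsilon> y) # ws @ (u \<star> \<epsilon> v) # vs)"
      using cs eq len \<sigma>_word[of us i x y "ws @ u # v # vs" "Suc n"]
        \<sigma>_word[of "us @ (x \<star> \<epsilon> y) # ws" j u v vs n] by (auto simp: mem)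
    moreover have "\<sigma> (Suc n) i (\<sigma> (Suc (Suc n)) (Suc j) (word cs)) = word (us @ (x \<star> \<epsilon> y) # ws @ (u \<star> \<epsilon> v) # vs)"
      using cs eq len \<sigma>_word[of "us @ x # y # ws" "Suc j" u v vs "Suc n"]
        \<sigma>_word[of us i x y "ws @ (u \<star> \<epsilon> v) # vs" n] by (auto simp: mem)
    ultimately show ?thesis
      by simp
  qed
qed (use ij in auto)

text \<open>The only overlap is \<open>i = j\<close>: the letter \<open>c\<close> that is split is also the one that absorbs a
  scalar, and \<open>\<Delta>(c \<epsilon>(y)) = c\<^bsup>(1)\<^esup> \<otimes> c\<^bsup>(2)\<^esup> \<epsilon>(y)\<close> by right linearity of \<open>\<Delta>\<close>.\<close>

lemma \<sigma>_\<delta>_less: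
  assumes ij: "i \<le> j" "j \<le> n" and x: "x \<in> carrier (Ch (Suc n))"
  shows "\<sigma> (Suc (Suc n)) (Suc j) (\<delta> (Suc n) i x) = \<delta> n i (\<sigma> (Suc n) j x)"
proof (rule words_ext[OF Ch_abelian additive_comp[OF \<delta>_additive \<sigma>_additive]
      additive_comp[OF \<sigma>_additive \<delta>_additive] _ x])
  fix cs assume cs: "cs \<in> gens (Suc (Suc n))"
  show "\<sigma> (Suc (Suc n)) (Suc j) (\<delta> (Suc n) i (word cs)) = \<delta> n i (\<sigma> (Suc n) j (word cs))"
  proof (cases "i = j")
    case True
    obtain us c ws y vs where "cs = us @ c # ws @ y # vs" and len: "length us = i" "i + 1 + length ws = Suc i"
      by (rule split_word2[OF cs, of i "Suc i"]) (use ij True in auto)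
    then have eq: "cs = us @ c # y # vs"
      by auto
    have cy: "c \<in> carrier C" "y \<in> carrier C" "\<epsilon> y \<in> carrier R"
      using cs eq by (auto simp: mem)
    obtain m a b where s: "splits c m a b"
      using sweedler_exists[OF cy(1)] .
    have "\<sigma> (Suc (Suc n)) (Suc j) (\<delta> (Suc n) i (word cs)) =
        word_sum (Suc n) m (\<lambda>l. us @ a l # (b l \<star> \<epsilon> y) # vs)"
      unfolding eq by (rule \<delta>_then[OF \<sigma>_additive len(1) cs[unfolded eq] s])
        (use ij True len \<sigma>_word[of "us @ [a _]" "Suc j" "b _" y vs "Suc n"] in simp_all)
    also have "\<dots> = \<delta> n i (word (us @ (c \<star> \<epsilon> y) # vs))"
      by (rule \<delta>_word[OF len(1) _ sweedler_ract[OF s cy(1,3)], symmetric])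
        (use cs eq in \<open>auto simp: mem\<close>)
    also have "word (us @ (c \<star> \<epsilon> y) # vs) = \<sigma> (Suc n) j (word cs)"
      using \<sigma>_word[of us j c y vs n] cs len True by (simp add: eq)
    finally show ?thesis .
  next
    case False
    obtain us c ws' y vs where eq': "cs = us @ c # ws' @ y # vs" "length us = i" "i + 1 + length ws' = Suc j"
      by (rule split_word2[OF cs, of i "Suc j"]) (use ij False in auto)
    obtain ws x where ws': "ws' = ws @ [x]"
      using eq'(3) ij False by (cases ws' rule: rev_cases) auto
    have eq: "cs = us @ c # ws @ x # y # vs" and len: "length us = i" "i + 1 + length ws = j"
      using eq' ws' by auto
    have c: "c \<in> carrier C"
      using cs eq by (auto simp: mem)
    obtain m a b where s: "splits c m a b"
      using sweedler_exists[OF c] .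
    have "\<sigma> (Suc (Suc n)) (Suc j) (\<delta> (Suc n) i (word cs)) =
        word_sum (Suc n) m (\<lambda>l. us @ a l # b l # ws @ (x \<star> \<epsilon> y) # vs)"
      unfolding eq by (rule \<delta>_then[OF \<sigma>_additive len(1) cs[unfolded eq] s])
        (use ij len \<sigma>_word[of "us @ a _ # b _ # ws" "Suc j" x y vs "Suc n"] in simp_all)
    also have "\<dots> = \<delta> n i (word (us @ c # ws @ (x \<star> \<epsilon> y) # vs))"
      by (rule \<delta>_word[OF len(1) _ s, symmetric]) (use cs eq in \<open>auto simp: mem\<close>)
    also have "word (us @ c # ws @ (x \<star> \<epsilon> y) # vs) = \<sigma> (Suc n) j (word cs)"
      using \<sigma>_word[of "us @ c # ws" j x y vs n] cs len by (simp add: eq)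
    finally show ?thesis .
  qed
qed (use ij in auto)

lemma word_of_sum:
  assumes w: "us @ c # vs \<in> gens (Suc n)" and x: "\<And>l. l < m \<Longrightarrow> x l \<in> carrier C"
  shows "word (us @ (\<Oplus>\<^bsub>C\<^esub>l\<in>{..<m::nat}. x l) # vs) = word_sum n m (\<lambda>l. us @ x l # vs)"
proof (rule additive_finsum[OF C.abelian_group_axioms Ch_abelian])
  have "us @ x # vs \<in> gens (Suc n)" if "x \<in> carrier C" for x
    using that w by (auto simp: mem)
  then show "(\<lambda>c. word (us @ c # vs)) \<in> additive_maps C (Ch n)"
    by (intro additiveI) (auto intro: word_closed simp: balanced_add[OF word_balanced[of n]])
qed (use x in simp)

text \<open>The right counit law \<open>c\<^bsup>(1)\<^esup> \<epsilon>(c\<^bsup>(2)\<^esup>) = c\<close>.\<close>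

lemma \<sigma>_\<delta>_same:
  assumes j: "j \<le> n" and x: "x \<in> carrier (Ch n)"
  shows "\<sigma> (Suc n) j (\<delta> n j x) = x"
proof (rule words_ext[OF Ch_abelian additive_comp[OF \<delta>_additive \<sigma>_additive] _ _ x])
  show "(\<lambda>x. x) \<in> additive_maps (Ch n) (Ch n)"
    by (rule additiveI) auto
  fix cs assume cs: "cs \<in> gens (Suc n)"
  obtain us c vs where eq: "cs = us @ c # vs" and us: "length us = j"
    using split_word[OF cs j] .
  have c: "c \<in> carrier C"
    using cs eq by (auto simp: mem)
  obtain m a b where s: "splits c m a b"
    using sweedler_exists[OF c] .
  note ab = sweedler_closed[OF s]
  have "\<sigma> (Suc n) j (\<delta> n j (word cs)) = word_sum n m (\<lambda>l. us @ (a l \<star> \<epsilon> (b l)) # vs)"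
    unfolding eq by (rule \<delta>_then[OF \<sigma>_additive us cs[unfolded eq] s]) (use j \<sigma>_word[OF us] in simp_all)
  also have "\<dots> = word (us @ (\<Oplus>\<^bsub>C\<^esub>l\<in>{..<m}. a l \<star> \<epsilon> (b l)) # vs)"
    by (rule word_of_sum[symmetric]) (use cs eq ab in \<open>auto simp: mem\<close>)
  also have "(\<Oplus>\<^bsub>C\<^esub>l\<in>{..<m}. a l \<star> \<epsilon> (b l)) = c"
    by (rule counit_right[OF c s])
  finally show "\<sigma> (Suc n) j (\<delta> n j (word cs)) = word cs"
    by (simp add: eq)
qed (use j in auto)

lemma \<tau>_\<sigma>:
  assumes j: "Suc j \<le> n" and x: "x \<in> carrier (Ch (Suc n))"
  shows "\<tau> n (\<sigma> (Suc n) (Suc j) x) = \<sigma> (Suc n) j (\<tau> (Suc n) x)"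
proof (rule words_ext[OF Ch_abelian additive_comp[OF \<sigma>_additive \<tau>_additive]
      additive_comp[OF \<tau>_additive \<sigma>_additive] _ x])
  fix cs assume cs: "cs \<in> gens (Suc (Suc n))"
  obtain us x ws y vs where eq': "cs = us @ x # ws @ y # vs"
    and len: "length us = Suc j" "Suc j + 1 + length ws = Suc (Suc j)"
    by (rule split_word2[OF cs, of "Suc j" "Suc (Suc j)"]) (use j in auto)
  then obtain u us' where us: "us = u # us'"
    by (cases us) auto
  have eq: "cs = u # us' @ x # y # vs"
    using eq' len us by simp
  have "\<sigma> (Suc n) (Suc j) (word cs) = word (u # us' @ (x \<star> \<epsilon> y) # vs)"
    using \<sigma>_word[of us "Suc j" x y vs n] cs len us by (simp add: eq)
  also have "\<tau> n \<dots> = word (us' @ (x \<star> \<epsilon> y) # vs @ [u])"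
    using \<tau>_word[of u "us' @ (x \<star> \<epsilon> y) # vs" n] cs eq by (auto simp: mem)
  also have "\<dots> = \<sigma> (Suc n) j (word (us' @ x # y # vs @ [u]))"
    by (rule \<sigma>_word[symmetric]) (use cs eq len us in \<open>auto simp: mem\<close>)
  also have "word (us' @ x # y # vs @ [u]) = \<tau> (Suc n) (word cs)"
    using \<tau>_word[of u "us' @ x # y # vs" "Suc n"] cs by (simp add: eq)
  finally show "\<tau> n (\<sigma> (Suc n) (Suc j) (word cs)) = \<sigma> (Suc n) j (\<tau> (Suc n) (word cs))" .
qed (use j in auto)

lemma \<tau>_power_additive: "\<tau> n ^^ i \<in> additive_maps (Ch n) (Ch n)"
proof (induction i)
  case (Suc i)
  then show ?case
    using additive_comp[OF Suc \<tau>_additive] by (simp add: comp_def)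
qed (auto intro: additiveI)

lemma \<tau>_power_word: "cs \<in> gens (Suc n) \<Longrightarrow> (\<tau> n ^^ i) (word cs) = word (rotate i cs)"
proof (induction i)
  case (Suc i)
  then have "rotate i cs \<in> gens (Suc n)"
    by (simp add: tpow_gens_def)
  then show ?case
    using Suc rotation[of n] by (simp add: rotation_map_def)
qed simp

lemma \<tau>_order:
  assumes x: "x \<in> carrier (Ch n)"
  shows "(\<tau> n ^^ Suc n) x = x"
proof (rule words_ext[OF Ch_abelian \<tau>_power_additive _ _ x])
  show "(\<lambda>x. x) \<in> additive_maps (Ch n) (Ch n)"
    by (rule additiveI) auto
  show "(\<tau> n ^^ Suc n) (word cs) = word cs" if cs: "cs \<in> gens (Suc n)" for cs
  proof -
    have "length cs = Suc n"
      using cs by (simp add: tpow_gens_def)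
    then have "rotate (Suc n) cs = cs"
      using rotate_id[of "Suc n" cs] by simp
    then show ?thesis
      by (simp only: \<tau>_power_word[OF cs])
  qed
qed

lemma \<tau>_surjective:
  assumes x: "x \<in> carrier (Ch n)"
  shows "\<exists>y\<in>carrier (Ch n). x = \<tau> n y"
  using \<tau>_order[OF x] additive_closed[OF \<tau>_power_additive x, of n] by (intro bexI[of _ "(\<tau> n ^^ n) x"]) simp_all

text \<open>The left counit law \<open>\<epsilon>(c\<^bsup>(1)\<^esup>) c\<^bsup>(2)\<^esup> = c\<close>.  The component \<open>c\<^bsup>(1)\<^esup>\<close> stands at the end of the word,
  so \<open>\<epsilon>(c\<^bsup>(1)\<^esup>)\<close> is first absorbed by the letter before it and then passes, across the end of
  the word, to its cyclic neighbour \<open>c\<^bsup>(2)\<^esup>\<close>.\<close>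

lemma \<sigma>_\<delta>_last:
  assumes x: "x \<in> carrier (Ch n)"
  shows "\<sigma> (Suc n) n (\<delta> n (Suc n) x) = x"
proof (rule words_ext[OF Ch_abelian additive_comp[OF \<delta>_additive \<sigma>_additive] _ _ x])
  show "(\<lambda>x. x) \<in> additive_maps (Ch n) (Ch n)"
    by (rule additiveI) auto
  fix cs assume cs: "cs \<in> gens (Suc n)"
  obtain c vs where eq: "cs = c # vs"
    using cs by (cases cs) auto
  have c: "c \<in> carrier C"
    using cs eq by (auto simp: mem)
  obtain m a b where s: "splits c m a b"
    using sweedler_exists[OF c] .
  note ab = sweedler_closed[OF s]
  have w: "b l # vs @ [a l] \<in> gens (Suc (Suc n))" if "l < m" for l
    using cs eq ab[OF that] by (auto simp: mem)
  have \<sigma>: "\<sigma> (Suc n) n (word (b l # vs @ [a l])) = word ((\<epsilon> (a l) \<bullet> b l) # vs)" if l: "l < m" for l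
  proof (cases vs rule: rev_cases)
    case Nil
    then show ?thesis
      using cs eq ab[OF l] \<sigma>_word[of "[]" n "b l" "a l" "[]" n]
        cyclically_balancedD(2)[OF word_cyclically_balanced, of "b l" n "\<epsilon> (a l)"]
      by (simp add: counit_closed)
  next
    case (snoc vs' v)
    then have len: "length (b l # vs') = n" and v: "v \<in> carrier C" "set vs' \<subseteq> carrier C"
      using cs eq by (auto simp: mem)
    then show ?thesis
      using w[OF l] snoc ab[OF l] \<sigma>_word[OF len, of v "a l" "[]" n]
        cyclically_balancedD(3)[OF word_cyclically_balanced, of "b l" vs' v n "\<epsilon> (a l)"]
      by (auto simp: mem)
  qed
  have "\<sigma> (Suc n) n (\<delta> n (Suc n) (word cs)) =
      word_sum n m (\<lambda>l. [] @ (\<epsilon> (a l) \<bullet> b l) # vs)"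
    unfolding eq by (rule \<delta>_last_then[OF \<sigma>_additive cs[unfolded eq] s]) (use \<sigma> in simp_all)
  also have "\<dots> = word ([] @ (\<Oplus>\<^bsub>C\<^esub>l\<in>{..<m}. \<epsilon> (a l) \<bullet> b l) # vs)"
    by (rule word_of_sum[symmetric]) (use cs eq ab in \<open>auto simp: mem\<close>)
  also have "(\<Oplus>\<^bsub>C\<^esub>l\<in>{..<m}. \<epsilon> (a l) \<bullet> b l) = c"
    by (rule counit_left[OF c s])
  finally show "\<sigma> (Suc n) n (\<delta> n (Suc n) (word cs)) = word cs"
    by (simp add: eq)
qed auto

text \<open>Conjugation by \<open>\<tau>\<close> lowers \<open>j\<close>: \<open>\<sigma>\<^sub>j \<delta>\<^bsub>j+1\<^esub> \<tau> = \<sigma>\<^sub>j \<tau> \<delta>\<^bsub>j+2\<^esub> = \<tau> \<sigma>\<^bsub>j+1\<^esub> \<delta>\<^bsub>j+2\<^esub>\<close>, and \<open>\<tau>\<close> is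
  surjective; so the case \<open>j = n\<close> suffices.\<close>

lemma \<sigma>_\<delta>_Suc:
  assumes j: "j \<le> n" and x: "x \<in> carrier (Ch n)"
  shows "\<sigma> (Suc n) j (\<delta> n (Suc j) x) = x"
  using j x
proof (induction j arbitrary: x rule: inc_induct)
  case base
  then show ?case
    by (rule \<sigma>_\<delta>_last)
next
  case (step j)
  obtain y where y: "y \<in> carrier (Ch n)" and x: "x = \<tau> n y"
    using \<tau>_surjective[OF step.prems] by blast
  have "\<sigma> (Suc n) j (\<delta> n (Suc j) x) = \<sigma> (Suc n) j (\<tau> (Suc n) (\<delta> n (Suc (Suc j)) y))"
    unfolding x using \<tau>_\<delta>[of "Suc (Suc j)" n y] step.hyps y by simp
  also have "\<dots> = \<tau> n (\<sigma> (Suc n) (Suc j) (\<delta> n (Suc (Suc j)) y))"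
    using step.hyps y by (intro \<tau>_\<sigma>[symmetric] \<delta>_closed) auto
  finally show ?case
    using step.IH[OF y] by (simp add: x)
qed

lemma \<tau>_\<sigma>_0:
  assumes x: "x \<in> carrier (Ch (Suc n))"
  shows "\<tau> n (\<sigma> (Suc n) 0 x) = \<sigma> (Suc n) n (\<tau> (Suc n) (\<tau> (Suc n) x))"
proof (rule words_ext[OF Ch_abelian additive_comp[OF \<sigma>_additive \<tau>_additive]
      additive_comp[OF additive_comp[OF \<tau>_additive \<tau>_additive] \<sigma>_additive] _ x])
  fix cs assume cs: "cs \<in> gens (Suc (Suc n))"
  obtain x y vs where eq: "cs = x # y # vs"
    using cs by (cases cs; cases "tl cs") auto
  have "\<sigma> (Suc n) 0 (word cs) = word ((x \<star> \<epsilon> y) # vs)"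
    using \<sigma>_word[of "[]" 0 x y vs n] cs by (simp add: eq)
  also have "\<tau> n \<dots> = word (vs @ [x \<star> \<epsilon> y])"
    using \<tau>_word[of "x \<star> \<epsilon> y" vs n] cs eq by (auto simp: mem)
  also have "\<dots> = \<sigma> (Suc n) n (word (vs @ [x, y]))"
    by (rule \<sigma>_word[symmetric]) (use cs eq in \<open>auto simp: mem\<close>)
  also have "word (vs @ [x, y]) = \<tau> (Suc n) (word (y # vs @ [x]))"
    using \<tau>_word[of y "vs @ [x]" "Suc n"] cs eq by (auto simp: mem)
  also have "word (y # vs @ [x]) = \<tau> (Suc n) (word cs)"
    using \<tau>_word[of x "y # vs" "Suc n"] cs by (simp add: eq)
  finally show "\<tau> n (\<sigma> (Suc n) 0 (word cs)) = \<sigma> (Suc n) n (\<tau> (Suc n) (\<tau> (Suc n) (word cs)))" .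
qed auto

text \<open>For the last coface, \<open>\<sigma>\<^sub>j \<tau> \<delta>\<^sub>0 = \<tau> \<sigma>\<^bsub>j+1\<^esub> \<delta>\<^sub>0 = \<tau> \<delta>\<^sub>0 \<sigma>\<^sub>j\<close>.  Conjugation by \<open>\<tau>\<close>, which
  lowers both indices, carries this over to the other cofaces.\<close>

lemma \<sigma>_\<delta>_greater:
  assumes ij: "j < i" "i \<le> Suc n" and x: "x \<in> carrier (Ch (Suc n))"
  shows "\<sigma> (Suc (Suc n)) j (\<delta> (Suc n) (Suc i) x) = \<delta> n i (\<sigma> (Suc n) j x)"
  using ij(2,1) x
proof (induction i arbitrary: j x rule: inc_induct)
  case base
  have "\<sigma> (Suc (Suc n)) j (\<delta> (Suc n) (Suc (Suc n)) x) = \<sigma> (Suc (Suc n)) j (\<tau> (Suc (Suc n)) (\<delta> (Suc n) 0 x))"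
    by (simp add: \<tau>_\<delta>_0[OF base(2)])
  also have "\<dots> = \<tau> (Suc n) (\<sigma> (Suc (Suc n)) (Suc j) (\<delta> (Suc n) 0 x))"
    by (rule \<tau>_\<sigma>[symmetric]) (use base \<delta>_closed in auto)
  also have "\<dots> = \<tau> (Suc n) (\<delta> n 0 (\<sigma> (Suc n) j x))"
    using \<sigma>_\<delta>_less[of 0 j n x] base by simp
  also have "\<dots> = \<delta> n (Suc n) (\<sigma> (Suc n) j x)"
    by (rule \<tau>_\<delta>_0) (use base \<sigma>_closed in auto)
  finally show ?case .
next
  case (step i)
  obtain y where y: "y \<in> carrier (Ch (Suc n))" and x: "x = \<tau> (Suc n) y"
    using \<tau>_surjective[OF step.prems(2)] by blast
  have "\<sigma> (Suc (Suc n)) j (\<delta> (Suc n) (Suc i) x) = \<sigma> (Suc (Suc n)) j (\<tau> (Suc (Suc n)) (\<delta> (Suc n) (Suc (Suc i)) y))"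
    unfolding x using \<tau>_\<delta>[of "Suc (Suc i)" "Suc n" y] step.hyps y by simp
  also have "\<dots> = \<tau> (Suc n) (\<sigma> (Suc (Suc n)) (Suc j) (\<delta> (Suc n) (Suc (Suc i)) y))"
    using step y by (intro \<tau>_\<sigma>[symmetric] \<delta>_closed) auto
  also have "\<dots> = \<delta> n i (\<tau> n (\<sigma> (Suc n) (Suc j) y))"
    using step.IH[OF _ y, of "Suc j"] \<tau>_\<delta>[of "Suc i" n] \<sigma>_closed[OF _ y, of "Suc j"] step.hyps step.prems
    by simp
  also have "\<tau> n (\<sigma> (Suc n) (Suc j) y) = \<sigma> (Suc n) j x"
    unfolding x using step y by (intro \<tau>_\<sigma>) auto
  finally show ?case .
qed

lemma cocyclic: "cocyclic_module K Ch \<delta> \<sigma> \<tau>"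
proof (intro cocyclic_module.intro cosimplicial_module.intro cocyclic_module_axioms.intro)
  show "module K (Ch n)" for n
    by (rule cochains_module)
  show "\<delta> n i \<in> linear_maps K (Ch n) (Ch (n + 1))" if "i \<le> n + 1" for n i
    using that \<delta>_linear by simp
  show "\<sigma> n j \<in> linear_maps K (Ch n) (Ch (n - 1))" if "j < n" for n j
    using that \<sigma>_linear by (cases n) auto
  show "\<delta> (n + 1) j (\<delta> n i x) = \<delta> (n + 1) i (\<delta> n (j - 1) x)"
    if "i < j" "j \<le> n + 2" "x \<in> carrier (Ch n)" for i j n x
    using that cofaces_commute[of i j n x] last_cofaces_commute[of i n x]
    by (cases "j = n + 2") auto
  show "\<sigma> n j (\<sigma> (n + 1) i x) = \<sigma> n i (\<sigma> (n + 1) (j + 1) x)"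
    if "i \<le> j" "j < n" "x \<in> carrier (Ch (n + 1))" for i j n x
    using that codegeneracies_commute by (cases n) auto
  show "\<sigma> (n + 1) j (\<delta> n i x) = \<delta> (n - 1) i (\<sigma> n (j - 1) x)"
    if "i < j" "j \<le> n" "x \<in> carrier (Ch n)" for i j n x
    using that \<sigma>_\<delta>_less[of i "j - 1" "n - 1" x] by (cases n; cases j) auto
  show "\<sigma> (n + 1) j (\<delta> n i x) = x" if "j \<le> n" "i = j \<or> i = j + 1" "x \<in> carrier (Ch n)" for i j n x
    using that \<sigma>_\<delta>_same \<sigma>_\<delta>_Suc by auto
  show "\<sigma> (n + 1) j (\<delta> n i x) = \<delta> (n - 1) (i - 1) (\<sigma> n j x)"
    if "j + 1 < i" "i \<le> n + 1" "x \<in> carrier (Ch n)" for i j n x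
    using that \<sigma>_\<delta>_greater[of j "i - 1" "n - 1" x] by (cases n; cases i) auto
  show "\<tau> n \<in> linear_maps K (Ch n) (Ch n)" for n
    by (rule \<tau>_linear)
  show "\<tau> (n + 1) (\<delta> n i x) = \<delta> n (i - 1) (\<tau> n x)"
    if "1 \<le> i" "i \<le> n + 1" "x \<in> carrier (Ch n)" for i n x
    using that \<tau>_\<delta> by simp
  show "\<tau> (n + 1) (\<delta> n 0 x) = \<delta> n (n + 1) x" if "x \<in> carrier (Ch n)" for n x
    using that \<tau>_\<delta>_0 by simp
  show "\<tau> n (\<sigma> (n + 1) j x) = \<sigma> (n + 1) (j - 1) (\<tau> (n + 1) x)"
    if "1 \<le> j" "j \<le> n" "x \<in> carrier (Ch (n + 1))" for j n x
    using that \<tau>_\<sigma>[of "j - 1" n x] by simp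
  show "\<tau> n (\<sigma> (n + 1) 0 x) = \<sigma> (n + 1) n (\<tau> (n + 1) (\<tau> (n + 1) x))"
    if "x \<in> carrier (Ch (n + 1))" for n x
    using that \<tau>_\<sigma>_0 by simp
  show "(\<tau> n ^^ (n + 1)) x = x" if "x \<in> carrier (Ch n)" for n x
    using that \<tau>_order by simp
qed

end

section \<open>From words to pure tensors\<close>

lemma ex1_and_the:
  assumes "\<exists>d. Q d" "\<And>d. Q d \<Longrightarrow> P d" "\<And>d e. \<lbrakk>P d; P e\<rbrakk> \<Longrightarrow> d = e"
  shows "(\<exists>!d. P d) \<and> Q (THE d. P d)"
proof -
  obtain d where d: "Q d"
    using assms(1) by blast
  have "(THE d. P d) = d"
    using assms(2,3) d by blast
  then show ?thesis
    using assms(2,3) d by metis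
qed

context coring
begin

lemma is_coface_0I:
  assumes "d \<in> linear_maps K (Ch 0) (Ch 1)"
    and "\<And>c r m a b. \<lbrakk>c \<in> carrier C; r \<in> carrier R; splits c m a b; i = 0\<rbrakk> \<Longrightarrow>
      d (elt0 K R C c r) = (\<Oplus>\<^bsub>Ch 1\<^esub>l\<in>{..<m}. elt K R C (a l) [b l \<star> r])"
    and "\<And>c r m a b. \<lbrakk>c \<in> carrier C; r \<in> carrier R; splits c m a b; i \<noteq> 0\<rbrakk> \<Longrightarrow>
      d (elt0 K R C c r) = (\<Oplus>\<^bsub>Ch 1\<^esub>l\<in>{..<m}. elt K R C (b l) [r \<bullet> a l])"
  shows "is_coface K R C \<Delta> 0 i d"
  using assms by (auto simp: is_coface_def)

lemma coface_on_words_is_coface: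
  assumes i: "i \<le> n" and d: "coface_on_words n i d"
  shows "is_coface K R C \<Delta> n i d"
proof (cases n)
  case 0
  have "d (elt0 K R C c r) = (\<Oplus>\<^bsub>Ch 1\<^esub>l\<in>{..<m}. elt K R C (a l) [b l \<star> r])"
    if c: "c \<in> carrier C" and r: "r \<in> carrier R" and s: "splits c m a b" for c r m a b
  proof -
    have "d (elt0 K R C c r) = d (word ([] @ (c \<star> r) # []))"
      using c r by (simp add: elt0_eq_word(1))
    also have "\<dots> = word_sum 1 m (\<lambda>l. [] @ a l # (b l \<star> r) # [])"
      using coface_on_words_sum[OF d _ _ sweedler_ract[OF s c r], of "[]" "[]"] 0 i c r
      by (simp add: ract_closed)
    also have "\<dots> = (\<Oplus>\<^bsub>Ch 1\<^esub>l\<in>{..<m}. elt K R C (a l) [b l \<star> r])"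
      by (simp add: elt_eq_word)
    finally show ?thesis .
  qed
  then show ?thesis
    unfolding 0 using i d by (intro is_coface_0I) (auto simp: 0 coface_on_words_def)
next
  case (Suc n')
  have "d (elt K R C c0 cs) = (\<Oplus>\<^bsub>Ch (n + 1)\<^esub>l\<in>{..<m}.
            if i = 0 then elt K R C (a l) (b l # cs)
            else if i \<le> n then elt K R C c0 (take (i - 1) cs @ [a l, b l] @ drop i cs)
            else elt K R C (b l) (cs @ [a l]))"
    if c0: "c0 \<in> carrier C" and cs: "cs \<in> gens n"
      and s: "splits (if 1 \<le> i \<and> i \<le> n then cs ! (i - 1) else c0) m a b" for c0 cs m a b
  proof -
    have mem: "c0 # cs \<in> gens (Suc n)" and ne: "cs \<noteq> []"
      using c0 cs Suc by auto
    show ?thesis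
    proof (cases "i = 0")
      case True
      then show ?thesis
        using coface_on_words_sum[OF d, of "[]" c0 cs m a b] mem s ne by (simp add: elt_eq_word)
    next
      case False
      obtain us c vs where eq: "c0 # cs = us @ c # vs" and us: "length us = i"
        using split_word[OF mem i] .
      then obtain us' where us': "us = c0 # us'" "cs = us' @ c # vs" "length us' = i - 1"
        using False by (cases us) auto
      then have "drop i cs = vs" "take (i - 1) cs = us'" "cs ! (i - 1) = c"
        using False by (auto simp: Suc_le_eq nth_append)
      then show ?thesis
        using False i s mem ne us us' coface_on_words_sum[OF d us, of c vs m a b] by (simp add: elt_eq_word)
    qed
  qed
  then show ?thesis
    using d Suc unfolding is_coface_def by (simp add: coface_on_words_def)
qed

lemma last_coface_on_words_is_coface:
  assumes d: "last_coface_on_words n d"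
  shows "is_coface K R C \<Delta> n (Suc n) d"
proof (cases n)
  case 0
  have "d (elt0 K R C c r) = (\<Oplus>\<^bsub>Ch 1\<^esub>l\<in>{..<m}. elt K R C (b l) [r \<bullet> a l])"
    if c: "c \<in> carrier C" and r: "r \<in> carrier R" and s: "splits c m a b" for c r m a b
    using last_coface_on_words_sum[OF d _ sweedler_lact[OF s c r], of "[]"] 0 c r
    by (simp add: lact_closed elt0_eq_word(2) elt_eq_word)
  then show ?thesis
    unfolding 0 using d by (intro is_coface_0I) (auto simp: 0 last_coface_on_words_def)
next
  case (Suc n')
  have "d (elt K R C c0 cs) = (\<Oplus>\<^bsub>Ch (Suc n)\<^esub>l\<in>{..<m}. elt K R C (b l) (cs @ [a l]))"
    if "c0 \<in> carrier C" "cs \<in> gens n" "splits c0 m a b" for c0 cs m a b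
  proof -
    have "cs \<noteq> []"
      using that Suc by auto
    then show ?thesis
      using last_coface_on_words_sum[OF d, of c0 cs m a b] that by (simp add: elt_eq_word)
  qed
  then show ?thesis
    using d Suc by (simp add: is_coface_def last_coface_on_words_def)
qed

text \<open>The informal formula absorbs the scalar to the right where possible, while on words
  it is absorbed to the left; the two differ by one balancing step between neighbours.\<close>

lemma codegeneracy_on_words_is_codegeneracy:
  assumes j: "j \<le> n" and s: "codegeneracy_on_words n j s"
  shows "is_codegeneracy K R C \<epsilon> (Suc n) j s"
proof -
  have "s (elt K R C c0 cs) =
      (if Suc n = 1 then elt0 K R C c0 (\<epsilon> (cs ! 0)) else elt K R C c0 (counit_at C \<epsilon> j cs))"
    if c0: "c0 \<in> carrier C" and cs: "cs \<in> gens (Suc n)" for c0 cs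
  proof -
    have mem: "c0 # cs \<in> gens (Suc (Suc n))" and ne: "cs \<noteq> []"
      using c0 cs by auto
    obtain us x ws y vs where "c0 # cs = us @ x # ws @ y # vs"
      and us: "length us = j" "j + 1 + length ws = Suc j"
      by (rule split_word2[OF mem, of j "Suc j"]) (use j in auto)
    then have eq: "c0 # cs = us @ x # y # vs"
      by simp
    have xy: "x \<in> carrier C" "y \<in> carrier C"
      using mem unfolding eq by (auto simp: tpow_gens_def)
    have sw: "s (elt K R C c0 cs) = word (us @ (x \<star> \<epsilon> y) # vs)"
      using codegeneracy_on_words_word[OF s us(1), of x y vs] mem ne by (simp add: eq elt_eq_word)
    show ?thesis
    proof (cases n)
      case 0
      then have "us = []" "vs = []" "cs = [y]" "x = c0"
        using j us cs eq by (auto simp: tpow_gens_def length_Suc_conv)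
      then show ?thesis
        using 0 xy sw by (simp add: elt0_eq_word(1) counit_closed)
    next
      case (Suc n')
      have "word (us @ (x \<star> \<epsilon> y) # vs) = word (c0 # counit_at C \<epsilon> j cs) \<and> counit_at C \<epsilon> j cs \<noteq> []"
      proof (cases vs)
        \<comment> \<open>The contracted letter is the last one: there is nothing to its right.\<close>
        case Nil
        have "length cs = Suc j"
          using us arg_cong[OF eq, of length] Nil by simp
        then have "j \<noteq> 0"
          using cs Suc by (auto simp: tpow_gens_def)
        then obtain us' where us': "us = c0 # us'" "cs = us' @ [x, y]" "length us' = j - 1"
          using eq us Nil by (cases us) auto
        then have "cs ! j = y" "cs ! (j - 1) = x" "take (j - 1) cs = us'"
          using \<open>j \<noteq> 0\<close> by (auto simp: nth_append nth_Cons')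
        then show ?thesis
          using us' Nil \<open>length cs = Suc j\<close> by (simp add: counit_at_def)
      next
        case (Cons z zs)
        have len: "j + 1 < length cs"
          using us arg_cong[OF eq, of length] Cons by simp
        have "cs = tl us @ (if us = [] then [] else [x]) @ y # z # zs"
          using eq Cons by (cases us) auto
        moreover have "length (tl us @ (if us = [] then [] else [x])) = j"
          using us by (cases us) auto
        ultimately obtain ps where ps: "cs = ps @ y # z # zs" "length ps = j" "c0 # ps = us @ [x]"
          using eq by (cases us) auto
        then have "cs ! j = y" "cs ! (j + 1) = z" "take j cs = ps" "drop (j + 2) cs = zs"
          by (auto simp: nth_append)
        then have "c0 # counit_at C \<epsilon> j cs = us @ x # (\<epsilon> y \<bullet> z) # zs"
          using len ps(3) by (simp add: counit_at_def)
        moreover have "counit_at C \<epsilon> j cs \<noteq> []"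
          using len by (simp add: counit_at_def)
        moreover have "us @ x # z # zs \<in> gens (Suc n)"
          using mem Cons unfolding eq by (auto simp: tpow_gens_def)
        ultimately show ?thesis
          using Cons balanced_swap[OF word_balanced, of us x z zs n "\<epsilon> y"] xy
          by (simp add: counit_closed)
      qed
      then show ?thesis
        using Suc sw by (simp add: elt_eq_word)
    qed
  qed
  then show ?thesis
    using s by (simp add: is_codegeneracy_def codegeneracy_on_words_def)
qed

lemma rotation_map_is_cyclic_operator:
  assumes t: "rotation_map n 1 t"
  shows "is_cyclic_operator K R C n t"
proof -
  have lin: "t \<in> linear_maps K (Ch n) (Ch n)"
    using t by (simp add: rotation_map_def)
  have "t x = x" if n: "n = 0" and x: "x \<in> carrier (Ch 0)" for x
  proof (rule words_ext[OF Ch_abelian linear_additive[OF lin[unfolded n]] _ _ x])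
    show "(\<lambda>x. x) \<in> additive_maps (Ch 0) (Ch 0)"
      by (rule additiveI) auto
    show "t (word cs) = word cs" if "cs \<in> gens (Suc 0)" for cs
      using that t n by (cases cs) (auto simp: rotation_map_def)
  qed
  moreover have "t (elt K R C c0 cs) = elt K R C (hd cs) (tl cs @ [c0])"
    if "n \<ge> 1" "c0 \<in> carrier C" "cs \<in> gens n" for c0 cs
    using that t by (cases cs) (auto simp: rotation_map_def elt_eq_word)
  ultimately show ?thesis
    using lin by (simp add: is_cyclic_operator_def)
qed

text \<open>The tensors \<open>c \<otimes> 1\<close> in degree \<open>0\<close>, and the pure tensors in positive degree, are all the words.
  This gives the uniqueness of the operators from their values.\<close>

lemma linear_elt_ext:
  assumes h: "h \<in> linear_maps K (Ch n) (Ch p)" and g: "g \<in> linear_maps K (Ch n) (Ch p)"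
    and 0: "\<And>c. \<lbrakk>n = 0; c \<in> carrier C\<rbrakk> \<Longrightarrow> h (elt0 K R C c \<one>\<^bsub>R\<^esub>) = g (elt0 K R C c \<one>\<^bsub>R\<^esub>)"
    and Suc: "\<And>c cs. \<lbrakk>n \<ge> 1; c \<in> carrier C; cs \<in> gens n\<rbrakk> \<Longrightarrow> h (elt K R C c cs) = g (elt K R C c cs)"
  shows "h = g"
proof (rule linear_words_ext[OF Ch_abelian h g])
  fix cs assume "cs \<in> gens (Suc n)"
  then obtain c ds where cs: "cs = c # ds" "c \<in> carrier C" "ds \<in> gens n"
    by (cases cs) auto
  show "h (word cs) = g (word cs)"
  proof (cases n)
    case 0
    then have "word cs = elt0 K R C c \<one>\<^bsub>R\<^esub>"
      using cs by (simp add: cyclic_word_def)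
    then show ?thesis
      using assms(3) 0 cs by simp
  next
    case (Suc n')
    then have "word cs = elt K R C c ds"
      using cs by (auto simp: cyclic_word_def)
    then show ?thesis
      using assms(4) Suc cs by simp
  qed
qed

lemma is_coface_unique:
  assumes d: "is_coface K R C \<Delta> n i d" and e: "is_coface K R C \<Delta> n i e"
  shows "d = e"
proof (rule linear_elt_ext)
  show "d \<in> linear_maps K (Ch n) (Ch (n + 1))" "e \<in> linear_maps K (Ch n) (Ch (n + 1))"
    using d e by (simp_all add: is_coface_def)
  show "d (elt0 K R C c \<one>\<^bsub>R\<^esub>) = e (elt0 K R C c \<one>\<^bsub>R\<^esub>)" if "n = 0" and c: "c \<in> carrier C" for c
  proof -
    obtain m a b where "splits c m a b"
      using sweedler_exists[OF c] .
    then show ?thesis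
      using d e that unfolding is_coface_def by simp
  qed
  show "d (elt K R C c cs) = e (elt K R C c cs)"
    if n: "n \<ge> 1" and c: "c \<in> carrier C" and cs: "cs \<in> gens n" for c cs
  proof -
    have "(if 1 \<le> i \<and> i \<le> n then cs ! (i - 1) else c) \<in> carrier C"
      using c cs by (auto simp: tpow_gens_def)
    then obtain m a b where "splits (if 1 \<le> i \<and> i \<le> n then cs ! (i - 1) else c) m a b"
      by (rule sweedler_exists)
    then show ?thesis
      using d e n c cs unfolding is_coface_def by simp
  qed
qed

lemma is_codegeneracy_unique:
  assumes j: "j < n" and s: "is_codegeneracy K R C \<epsilon> n j s" and t: "is_codegeneracy K R C \<epsilon> n j t"
  shows "s = t"
  by (rule linear_elt_ext[of _ n "n - 1"]) (use j s t in \<open>auto simp: is_codegeneracy_def\<close>)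

lemma is_cyclic_operator_unique:
  assumes s: "is_cyclic_operator K R C n s" and t: "is_cyclic_operator K R C n t"
  shows "s = t"
proof (rule linear_elt_ext)
  show "s \<in> linear_maps K (Ch n) (Ch n)" "t \<in> linear_maps K (Ch n) (Ch n)"
    using s t by (simp_all add: is_cyclic_operator_def)
  show "s (elt0 K R C c \<one>\<^bsub>R\<^esub>) = t (elt0 K R C c \<one>\<^bsub>R\<^esub>)" if "n = 0" "c \<in> carrier C" for c
  proof -
    have "elt0 K R C c \<one>\<^bsub>R\<^esub> \<in> carrier (Ch 0)"
      using that word_closed[of "[c]" 0] by (simp add: cyclic_word_def)
    then show ?thesis
      using that s t by (simp add: is_cyclic_operator_def)
  qed
qed (use s t in \<open>simp add: is_cyclic_operator_def\<close>)

end

theorem proposition3p1: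
  fixes K :: "('k, 'x) ring_scheme"
    and R :: "('k, 'r, 'y) module_scheme"
    and C :: "('r, 'c, 'z) bimodule_scheme"
    and \<Delta> :: "'c \<Rightarrow> 'c tp"
    and \<epsilon> :: "'c \<Rightarrow> 'r"
  assumes "coring K R C \<Delta> \<epsilon>"
  shows "(\<forall>n i. i \<le> n + 1 \<longrightarrow> (\<exists>!d. is_coface K R C \<Delta> n i d)) \<and>
    (\<forall>n j. j < n \<longrightarrow> (\<exists>!s. is_codegeneracy K R C \<epsilon> n j s)) \<and>
    (\<forall>n. \<exists>!t. is_cyclic_operator K R C n t) \<and>
    cocyclic_module K (cochains K R C)
      (\<lambda>n i. THE d. is_coface K R C \<Delta> n i d)
      (\<lambda>n j. THE s. is_codegeneracy K R C \<epsilon> n j s)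
      (\<lambda>n. THE t. is_cyclic_operator K R C n t)"
proof -
  interpret coring K R C \<Delta> \<epsilon> by (rule assms)
  have coface: "(\<exists>!d. is_coface K R C \<Delta> n i d) \<and> coface_on_words n i (THE d. is_coface K R C \<Delta> n i d)"
    if "i \<le> n" for n i
    using ex1_and_the[of "coface_on_words n i" "is_coface K R C \<Delta> n i"] coface_exists[OF that]
      coface_on_words_is_coface[OF that] is_coface_unique by blast
  have last: "(\<exists>!d. is_coface K R C \<Delta> n (Suc n) d) \<and>
      last_coface_on_words n (THE d. is_coface K R C \<Delta> n (Suc n) d)" for n
    using ex1_and_the[of "last_coface_on_words n" "is_coface K R C \<Delta> n (Suc n)"] last_coface_exists
      last_coface_on_words_is_coface is_coface_unique by blast
  have codegeneracy: "(\<exists>!s. is_codegeneracy K R C \<epsilon> (Suc n) j s) \<and>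
      codegeneracy_on_words n j (THE s. is_codegeneracy K R C \<epsilon> (Suc n) j s)" if "j \<le> n" for n j
    using ex1_and_the[of "codegeneracy_on_words n j" "is_codegeneracy K R C \<epsilon> (Suc n) j"]
      codegeneracy_exists[OF that] codegeneracy_on_words_is_codegeneracy[OF that]
      is_codegeneracy_unique[OF le_imp_less_Suc[OF that]] by blast
  have cyclic: "(\<exists>!t. is_cyclic_operator K R C n t) \<and> rotation_map n 1 (THE t. is_cyclic_operator K R C n t)"
    for n
    using ex1_and_the[of "rotation_map n 1" "is_cyclic_operator K R C n"] rotation_map_exists
      rotation_map_is_cyclic_operator is_cyclic_operator_unique by blast
  have "word_operators K R C \<Delta> \<epsilon> (\<lambda>n i. THE d. is_coface K R C \<Delta> n i d)
      (\<lambda>n j. THE s. is_codegeneracy K R C \<epsilon> n j s) (\<lambda>n. THE t. is_cyclic_operator K R C n t)"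
    by unfold_locales (simp_all only: coface last codegeneracy cyclic)
  note cocyclic = word_operators.cocyclic[OF this]
  have cofaces: "\<exists>!d. is_coface K R C \<Delta> n i d" if "i \<le> n + 1" for n i
    using that coface last by (cases "i = Suc n") auto
  have codegeneracies: "\<exists>!s. is_codegeneracy K R C \<epsilon> n j s" if "j < n" for n j
    using that codegeneracy by (cases n) auto
  show ?thesis
    by (intro conjI allI impI cofaces codegeneracies conjunct1[OF cyclic] cocyclic)
qed

end
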